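(* Let $(M^3,T)$ be a closed three-dimensional triangulated manifold. The Einstein-Hilbert-Regge functional is convex on each of the following sets of metrics, in the sense that for the given conformal structure $\mathcal{C}:U\to\mathfrak{met}(M,T)$, the Hessian of $f\mapsto\mathcal{EHR}(M,T,\ell(f))$ (with $\ell(f)$ the lengths of $\mathcal{C}[f]$) is positive semidefinite at every $f\in U$ for which $\mathcal{C}[f]$ lies in the set: 1. metrics in the image of the sphere packing conformal structure $\mathcal{C}=\mathcal{C}^P(M^3,T)$ with $K_i\ge0$ for all $i\in V(T)$; 2. metrics in the image of any conformal structure $\mathcal{C}$ of $(M^3,T)$ which satisfy $\ell_{ij}^*-\frac12q_{ij}K_{ij}>0$ for each $\{i,j\}\in E(T)$ and $K_i\ge0$ for all $i\in V(T)$, where $q_{ij}=\dfrac{\partial d_{ij}}{\partial f_j}=\dfrac{\partial d_{ji}}{\partial f_i}$.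
   Context: A triangulated manifold $(M,T)$ is a topological manifold with a triangulation $T$ (here finite, and simplices are determined by their vertices and written $\{i,j,\dots,k\}$). $V(T)$, $E(T)$, $E_+(T)$ are the sets of vertices, edges, and directed edges (each edge $\{i,j\}$ gives two directed edges $(i,j)$ and $(j,i)$); $X^*$ is the vector space of functions $X\to\mathbb{R}$. $(M,T,\ell)$, with $\ell\in E(T)^*$, is piecewise flat if every simplex can be realized as a nondegenerate Euclidean simplex with edge lengths given by $\ell$. A (piecewise flat) metric is $d\in E_+(T)^*$ such that with $\ell_{ij}=d_{ij}+d_{ji}$, $(M,T,\ell)$ is piecewise flat, and for every triangle $\{i,j,k\}$: $d_{ij}^2+d_{jk}^2+d_{ki}^2=d_{ji}^2+d_{ik}^2+d_{kj}^2$. (The $d_{ij}$ may be negative.) $\mathfrak{met}(M,T)$ is the set of all metrics $d$. A conformal structure on an open set $U\subset V(T)^*$ is a smooth map $\mathcal{C}:U\to\mathfrak{met}(M,T)\subset E_+(T)^*$ such that, writing $d=\mathcal{C}[f]$ and $\ell_{ij}=d_{ij}+d_{ji}$, for each $(i,j)\in E_+(T)$ and $k\in V(T)$: $\partial\ell_{ij}/\partial f_i=d_{ij}$, and $\partial d_{ij}/\partial f_k=0$ if $k\ne i$ and $k\neq j$. The sphere packing conformal structure $\mathcal{C}^P(M,T)$ is the map given by $d_{ij}=e^{f_i}$ for every directed edge $(i,j)$ (so $\ell_{ij}=e^{f_i}+e^{f_j}$), restricted to those $f\in V(T)^*$ for which the resulting $d$ is a metric (all tetrahedra nondegenerate). $\gamma_{i,jk}$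 is the angle at vertex $i$ in triangle $\{i,j,k\}$; $\beta_{ij,k\ell}$ is the dihedral angle at edge $\{i,j\}$ in tetrahedron $\{i,j,k,\ell\}$. Define $$h_{ij,k}=\frac{d_{ik}-d_{ij}\cos\gamma_{i,jk}}{\sin\gamma_{i,jk}},\qquad h_{ijk,\ell}=\frac{h_{ij,\ell}-h_{ij,k}\cos\beta_{ij,k\ell}}{\sin\beta_{ij,k\ell}},\qquad A_{ij,k\ell}=\tfrac12\left(h_{ij,k}h_{ijk,\ell}+h_{ij,\ell}h_{ij\ell,k}\right).$$ The dual length is $\ell_{ij}^*=\sum A_{ij,k\ell}$, the sum over all tetrahedra $\{i,j,k,\ell\}$ containing $\{i,j\}$, each counted once. The edge curvature is $K_{ij}=\left(2\pi-\sum\beta_{ij,k\ell}\right)\ell_{ij}$ and the scalar curvature at vertex $i$ is $K_i=\sum_{j}\left(2\pi-\sum\beta_{ij,k\ell}\right)d_{ij}$, where the outer sum is over edges $\{i,j\}$ containing $i$ and the inner sums are over all tetrahedra $\{i,j,k,\ell\}$ containing $\{i,j\}$. The Einstein-Hilbert-Regge functional is $\mathcal{EHR}(M,T,\ell)=\sum_{\{i,j\}\in E(T)}K_{ij}$. *)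

theory Defs
  imports "HOL-Analysis.Analysis"
begin

section \<open>Triangulated closed three-manifolds\<close>

text \<open>
  A finite triangulation is given by its abstract simplicial complex: simplices are the nonempty
  sets of vertices belonging to \<open>T\<close>. The vertex set is the whole type \<open>'v\<close>, so that
  the functions on vertices are the vectors \<open>real ^ 'v\<close>.
\<close>

definition abstract_complex :: "'v::finite set set \<Rightarrow> bool" where
  "abstract_complex T \<longleftrightarrow>
     {} \<notin> T \<and> (\<forall>\<sigma>\<in>T. \<forall>\<tau>. \<tau> \<subseteq> \<sigma> \<and> \<tau> \<noteq> {} \<longrightarrow> \<tau> \<in> T) \<and> \<Union>T = UNIV"

definition geometric_realization :: "'v::finite set set \<Rightarrow> (real ^ 'v) set" where
  "geometric_realization T = (\<Union>\<sigma>\<in>T. convex hull ((\<lambda>v. axis v 1) ` \<sigma>))"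

text \<open>Closed means compact and without boundary; connectedness is not required.\<close>

definition closed_3manifold :: "'m topology \<Rightarrow> bool" where
  "closed_3manifold M \<longleftrightarrow>
     Hausdorff_space M \<and> second_countable M \<and> compact_space M \<and>
     (\<forall>x\<in>topspace M. \<exists>W V. openin M W \<and> x \<in> W \<and> open V \<and>
        subtopology M W homeomorphic_space top_of_set (V :: (real ^ 3) set))"

definition triangulated_closed_3manifold :: "'m topology \<Rightarrow> 'v::finite set set \<Rightarrow> bool" where
  "triangulated_closed_3manifold M T \<longleftrightarrow>
     closed_3manifold M \<and> abstract_complex T \<and>
     top_of_set (geometric_realization T) homeomorphic_space M"

definition edges :: "'v set set \<Rightarrow> 'v set set" where
  "edges T = {\<sigma>\<in>T. card \<sigma> = 2}"

definition triangles :: "'v set set \<Rightarrow> 'v set set" where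
  "triangles T = {\<sigma>\<in>T. card \<sigma> = 3}"

definition tetrahedra :: "'v set set \<Rightarrow> 'v set set" where
  "tetrahedra T = {\<sigma>\<in>T. card \<sigma> = 4}"

definition directed_edges :: "'v set set \<Rightarrow> ('v \<times> 'v) set" where
  "directed_edges T = {(i, j). {i, j} \<in> edges T}"

text \<open>
  Sum of \<open>F k l\<close> over the unordered pairs \<open>{k, l}\<close> satisfying \<open>P\<close>, for symmetric \<open>F\<close>:
  each pair occurs in both orders, whence the factor one half.
\<close>

definition pair_sum :: "('v::finite set \<Rightarrow> bool) \<Rightarrow> ('v \<Rightarrow> 'v \<Rightarrow> real) \<Rightarrow> real" where
  "pair_sum P F = 1/2 * (\<Sum>(k, l) | k \<noteq> l \<and> P {k, l}. F k l)"

lemma pair_sum_eq: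
  assumes "\<And>k l. k \<noteq> l \<Longrightarrow> P {k, l} \<Longrightarrow> F k l = G {k, l}"
  shows "pair_sum P F = (\<Sum>e | card e = 2 \<and> P e. G e)"
proof -
  let ?S = "{(k, l). k \<noteq> l \<and> P {k, l}}"
  let ?E = "{e. card e = 2 \<and> P e}"
  let ?g = "\<lambda>(k, l). {k, l}"
  have fiber: "(\<Sum>x\<in>{x\<in>?S. ?g x = e}. case x of (k, l) \<Rightarrow> F k l) = 2 * G e" if "e \<in> ?E" for e
  proof -
    obtain a b where e: "e = {a, b}" "a \<noteq> b" "P {a, b}"
      using \<open>e \<in> ?E\<close> by (auto simp: card_2_iff)
    have "{x\<in>?S. ?g x = e} = {(a, b), (b, a)}"
      using e by (auto simp: doubleton_eq_iff insert_commute)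
    moreover have "F a b = G e" "F b a = G e"
      using assms[of a b] assms[of b a] e by (auto simp: insert_commute)
    ultimately show ?thesis
      using e(2) by simp
  qed
  have "?g ` ?S \<subseteq> ?E"
    by auto
  then have "(\<Sum>(k, l)\<in>?S. F k l) = (\<Sum>e\<in>?E. \<Sum>x\<in>{x\<in>?S. ?g x = e}. case x of (k, l) \<Rightarrow> F k l)"
    by (intro sum.group[symmetric]) auto
  also have "\<dots> = (\<Sum>e\<in>?E. 2 * G e)"
    using fiber by (intro sum.cong) auto
  finally show ?thesis
    by (simp add: pair_sum_def sum_distrib_left[symmetric])
qed

text \<open>
  The tetrahedra containing the edge \<open>{i, j}\<close> are the sets \<open>{i, j, k, l}\<close>, each determined by
  the unordered pair \<open>{k, l}\<close>.
\<close>

definition sum_tetrahedra ::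
  "'v::finite set set \<Rightarrow> 'v \<Rightarrow> 'v \<Rightarrow> ('v \<Rightarrow> 'v \<Rightarrow> real) \<Rightarrow> real" where
  "sum_tetrahedra T i j F = pair_sum (\<lambda>e. {i, j} \<union> e \<in> tetrahedra T) F"

definition sum_edges :: "'v::finite set set \<Rightarrow> ('v \<Rightarrow> 'v \<Rightarrow> real) \<Rightarrow> real" where
  "sum_edges T F = pair_sum (\<lambda>e. e \<in> edges T) F"


section \<open>Piecewise flat metrics\<close>

text \<open>
  Functions on edges and on directed edges are functions of two vertices whose values off the
  (directed) edges are never used. Since the complexes of interest are three-dimensional, simplices
  are realized in \<open>real ^ 3\<close>.
\<close>

definition realizes :: "('v \<Rightarrow> 'v \<Rightarrow> real) \<Rightarrow> 'v set \<Rightarrow> ('v \<Rightarrow> real ^ 3) \<Rightarrow> bool" where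
  "realizes L \<sigma> p \<longleftrightarrow>
     inj_on p \<sigma> \<and> \<not> affine_dependent (p ` \<sigma>) \<and>
     (\<forall>i\<in>\<sigma>. \<forall>j\<in>\<sigma>. i \<noteq> j \<longrightarrow> dist (p i) (p j) = L i j)"

definition piecewise_flat :: "'v set set \<Rightarrow> ('v \<Rightarrow> 'v \<Rightarrow> real) \<Rightarrow> bool" where
  "piecewise_flat T L \<longleftrightarrow> (\<forall>\<sigma>\<in>T. \<exists>p. realizes L \<sigma> p)"

definition edge_length :: "('v \<Rightarrow> 'v \<Rightarrow> real) \<Rightarrow> 'v \<Rightarrow> 'v \<Rightarrow> real" where
  "edge_length d i j = d i j + d j i"

definition metrics :: "'v set set \<Rightarrow> ('v \<Rightarrow> 'v \<Rightarrow> real) set" where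
  "metrics T = {d. piecewise_flat T (edge_length d) \<and>
     (\<forall>i j k. {i, j, k} \<in> triangles T \<longrightarrow>
        (d i j)\<^sup>2 + (d j k)\<^sup>2 + (d k i)\<^sup>2 = (d j i)\<^sup>2 + (d i k)\<^sup>2 + (d k j)\<^sup>2)}"


section \<open>Angles, dual lengths and curvatures\<close>

text \<open>A realization is unique up to isometry, so the angles do not depend on its choice.\<close>

definition realization :: "('v \<Rightarrow> 'v \<Rightarrow> real) \<Rightarrow> 'v set \<Rightarrow> 'v \<Rightarrow> real ^ 3" where
  "realization L \<sigma> = (SOME p. realizes L \<sigma> p)"

definition angle_between :: "'a::real_inner \<Rightarrow> 'a \<Rightarrow> real" where
  "angle_between u v = arccos (u \<bullet> v / (norm u * norm v))"

definition orth_part :: "'a::real_inner \<Rightarrow> 'a \<Rightarrow> 'a" where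
  "orth_part a u = u - ((u \<bullet> a) / (a \<bullet> a)) *\<^sub>R a"

text \<open>\<open>face_angle L i j k\<close> is $\gamma_{i,jk}$ and \<open>dihedral_angle L i j k l\<close> is $\beta_{ij,kl}$.\<close>

definition face_angle :: "('v \<Rightarrow> 'v \<Rightarrow> real) \<Rightarrow> 'v \<Rightarrow> 'v \<Rightarrow> 'v \<Rightarrow> real" where
  "face_angle L i j k =
     (let p = realization L {i, j, k} in angle_between (p j - p i) (p k - p i))"

definition dihedral_angle :: "('v \<Rightarrow> 'v \<Rightarrow> real) \<Rightarrow> 'v \<Rightarrow> 'v \<Rightarrow> 'v \<Rightarrow> 'v \<Rightarrow> real" where
  "dihedral_angle L i j k l =
     (let p = realization L {i, j, k, l}
      in angle_between (orth_part (p j - p i) (p k - p i)) (orth_part (p j - p i) (p l - p i)))"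

lemma dihedral_angle_commute: "dihedral_angle L i j l k = dihedral_angle L i j k l"
  by (simp add: dihedral_angle_def angle_between_def insert_commute inner_commute mult.commute)

text \<open>
  \<open>height_edge d i j k\<close> is $h_{ij,k}$, \<open>height_face d i j k l\<close> is $h_{ijk,l}$ and
  \<open>dual_area d i j k l\<close> is $A_{ij,kl}$.
\<close>

definition height_edge :: "('v \<Rightarrow> 'v \<Rightarrow> real) \<Rightarrow> 'v \<Rightarrow> 'v \<Rightarrow> 'v \<Rightarrow> real" where
  "height_edge d i j k =
     (let \<gamma> = face_angle (edge_length d) i j k in (d i k - d i j * cos \<gamma>) / sin \<gamma>)"

definition height_face :: "('v \<Rightarrow> 'v \<Rightarrow> real) \<Rightarrow> 'v \<Rightarrow> 'v \<Rightarrow> 'v \<Rightarrow> 'v \<Rightarrow> real" where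
  "height_face d i j k l =
     (let \<beta> = dihedral_angle (edge_length d) i j k l
      in (height_edge d i j l - height_edge d i j k * cos \<beta>) / sin \<beta>)"

definition dual_area :: "('v \<Rightarrow> 'v \<Rightarrow> real) \<Rightarrow> 'v \<Rightarrow> 'v \<Rightarrow> 'v \<Rightarrow> 'v \<Rightarrow> real" where
  "dual_area d i j k l =
     1/2 * (height_edge d i j k * height_face d i j k l
            + height_edge d i j l * height_face d i j l k)"

definition dual_length :: "'v::finite set set \<Rightarrow> ('v \<Rightarrow> 'v \<Rightarrow> real) \<Rightarrow> 'v \<Rightarrow> 'v \<Rightarrow> real" where
  "dual_length T d i j = sum_tetrahedra T i j (dual_area d i j)"

definition cone_deficit :: "'v::finite set set \<Rightarrow> ('v \<Rightarrow> 'v \<Rightarrow> real) \<Rightarrow> 'v \<Rightarrow> 'v \<Rightarrow> real" where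
  "cone_deficit T L i j = 2 * pi - sum_tetrahedra T i j (dihedral_angle L i j)"

definition edge_curvature :: "'v::finite set set \<Rightarrow> ('v \<Rightarrow> 'v \<Rightarrow> real) \<Rightarrow> 'v \<Rightarrow> 'v \<Rightarrow> real" where
  "edge_curvature T L i j = cone_deficit T L i j * L i j"

definition scalar_curvature :: "'v::finite set set \<Rightarrow> ('v \<Rightarrow> 'v \<Rightarrow> real) \<Rightarrow> 'v \<Rightarrow> real" where
  "scalar_curvature T d i =
     (\<Sum>j | {i, j} \<in> edges T. cone_deficit T (edge_length d) i j * d i j)"

definition EHR :: "'v::finite set set \<Rightarrow> ('v \<Rightarrow> 'v \<Rightarrow> real) \<Rightarrow> real" where
  "EHR T L = sum_edges T (edge_curvature T L)"


section \<open>Conformal structures\<close>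

text \<open>\<open>C_k_on n S f\<close>: the function \<open>f\<close> is \<open>n\<close> times continuously differentiable on the open set \<open>S\<close>.\<close>

primrec C_k_on :: "nat \<Rightarrow> 'a::euclidean_space set \<Rightarrow> ('a \<Rightarrow> real) \<Rightarrow> bool" where
  "C_k_on 0 S f \<longleftrightarrow> continuous_on S f"
| "C_k_on (Suc n) S f \<longleftrightarrow>
     (\<forall>x\<in>S. f differentiable (at x)) \<and> (\<forall>v. C_k_on n S (\<lambda>x. frechet_derivative f (at x) v))"

definition smooth_on :: "'a::euclidean_space set \<Rightarrow> ('a \<Rightarrow> real) \<Rightarrow> bool" where
  "smooth_on S f \<longleftrightarrow> (\<forall>n. C_k_on n S f)"

definition partial_deriv :: "(real ^ 'v \<Rightarrow> real) \<Rightarrow> 'v::finite \<Rightarrow> real ^ 'v \<Rightarrow> real" where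
  "partial_deriv g k f = frechet_derivative g (at f) (axis k 1)"

definition conformal_structure ::
  "'v::finite set set \<Rightarrow> (real ^ 'v) set \<Rightarrow> (real ^ 'v \<Rightarrow> 'v \<Rightarrow> 'v \<Rightarrow> real) \<Rightarrow> bool" where
  "conformal_structure T U C \<longleftrightarrow>
     open U \<and> (\<forall>f\<in>U. C f \<in> metrics T) \<and>
     (\<forall>(i, j)\<in>directed_edges T. smooth_on U (\<lambda>f. C f i j)) \<and>
     (\<forall>f\<in>U. \<forall>(i, j)\<in>directed_edges T.
        partial_deriv (\<lambda>f. edge_length (C f) i j) i f = C f i j \<and>
        (\<forall>k. k \<noteq> i \<and> k \<noteq> j \<longrightarrow> partial_deriv (\<lambda>f. C f i j) k f = 0))"

text \<open>
  The sphere packing conformal structure is \<open>sphere_packing\<close> on the domain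
  \<open>sphere_packing_domain T\<close>.
\<close>

definition sphere_packing :: "real ^ 'v \<Rightarrow> 'v::finite \<Rightarrow> 'v \<Rightarrow> real" where
  "sphere_packing f i j = exp (f $ i)"

definition sphere_packing_domain :: "'v::finite set set \<Rightarrow> (real ^ 'v) set" where
  "sphere_packing_domain T = {f. sphere_packing f \<in> metrics T}"


section \<open>Hessians\<close>

text \<open>
  \<open>has_hessian g H x\<close>: the function \<open>g\<close> is differentiable near \<open>x\<close>, its gradient is differentiable
  at \<open>x\<close>, and \<open>H\<close> is the matrix of second partial derivatives.
\<close>

definition has_hessian :: "(real ^ 'v \<Rightarrow> real) \<Rightarrow> real ^ 'v ^ 'v \<Rightarrow> real ^ 'v::finite \<Rightarrow> bool" where
  "has_hessian g H x \<longleftrightarrow>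
     (\<exists>G. (\<forall>\<^sub>F y in nhds x. (g has_derivative (\<lambda>h. G y \<bullet> h)) (at y)) \<and>
          (G has_derivative (\<lambda>h. H *v h)) (at x))"

text \<open>Only used for Hessians in the sense above, which are automatically symmetric.\<close>

definition positive_semidefinite :: "real ^ 'v ^ 'v::finite \<Rightarrow> bool" where
  "positive_semidefinite H \<longleftrightarrow> (\<forall>v. 0 \<le> v \<bullet> (H *v v))"

end

theory Submission
  imports Defs
begin

text \<open>
  Write \<open>\<kappa>\<^sub>i\<^sub>j\<close> for the cone deficit at an edge. Since \<open>\<ell>\<^sub>i\<^sub>j = d\<^sub>i\<^sub>j + d\<^sub>j\<^sub>i\<close>, the functional is the
  sum of the scalar curvatures \<open>K\<^sub>i = \<Sum>\<^sub>j \<kappa>\<^sub>i\<^sub>j d\<^sub>i\<^sub>j\<close>, so everything follows from the derivative of \<open>K\<^sub>i\<close>.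

  Under a conformal variation \<open>v\<close> only differences \<open>v\<^sub>j - v\<^sub>i\<close> can change an angle, because a
  variation by a constant rescales all lengths. Differentiating the planar law of cosines gives the
  rates of the face angles as \<open>h\<^sub>i\<^sub>j\<^sub>,\<^sub>k / \<ell>\<^sub>i\<^sub>j\<close> (\<open>has_derivative_face_angle\<close>), and differentiating
  the spherical law of cosines in the link of \<open>i\<close> expresses the rates of the dihedral angles by the
  heights over the faces (\<open>has_derivative_dihedral_angle\<close>). Weighted by the \<open>d\<^sub>i\<^sub>m\<close>, the three
  dihedral angles at \<open>i\<close> in a tetrahedron respond to a variation at \<open>j\<close> exactly by
  \<open>2 A\<^sub>i\<^sub>j\<^sub>,\<^sub>k\<^sub>l / \<ell>\<^sub>i\<^sub>j\<close> (\<open>dual_area_rate\<close>). Summing over tetrahedra,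
  \<open>\<delta>K\<^sub>i = K\<^sub>i v\<^sub>i - \<Sum>\<^sub>j w\<^sub>i\<^sub>j (v\<^sub>j - v\<^sub>i)\<close> with \<open>w\<^sub>i\<^sub>j = 2 \<ell>\<^sub>i\<^sub>j\<^sup>* / \<ell>\<^sub>i\<^sub>j - q\<^sub>i\<^sub>j \<kappa>\<^sub>i\<^sub>j\<close>
  (\<open>has_derivative_scalar_curvature\<close>). These weights are symmetric in \<open>i\<close> and \<open>j\<close>. Hence the sums
  over \<open>j\<close> cancel when the \<open>\<delta>K\<^sub>i\<close> are added up, the gradient of the functional is \<open>(K\<^sub>i)\<close> (this replaces
  the Schlaefli formula), and its Hessian is the quadratic form
  \<open>\<Sum>\<^sub>i K\<^sub>i v\<^sub>i\<^sup>2 + 1/2 \<Sum>\<^sub>(\<^sub>i\<^sub>,\<^sub>j\<^sub>) w\<^sub>i\<^sub>j (v\<^sub>i - v\<^sub>j)\<^sup>2\<close>. In the second part of the theorem all terms are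
  nonnegative by assumption.

  For sphere packings \<open>q = 0\<close>, but single dual areas can be negative, so the weights of the six
  edges of a tetrahedron have to be treated together. In terms of the inverse radii \<open>x\<^sub>i\<close>, the
  Descartes form \<open>D = (\<Sum>x)\<^sup>2 - 2 \<Sum>x\<^sup>2\<close> and \<open>y\<^sub>i = \<Sum>x - 2 x\<^sub>i\<close>, all angles are explicit, and
  \<open>A\<^sub>i\<^sub>j\<^sub>,\<^sub>k\<^sub>l / \<ell>\<^sub>i\<^sub>j\<close> is, up to a positive factor common to the tetrahedron,
  \<open>m\<^sub>i m\<^sub>j (D + y\<^sub>k y\<^sub>l)\<close> with positive \<open>m\<^sub>i\<close> (\<open>packing_weight\<close>). At most one \<open>y\<^sub>i\<close> can be negative. The
  contribution of \<open>D\<close> to the form is a variance; that of the \<open>y\<^sub>k y\<^sub>l\<close> is,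
  up to the factor \<open>\<Prod>y\<close>, again a variance with the weights \<open>m\<^sub>i / y\<^sub>i\<close>, one of which may be negative, and an identity shows
  that the total of these weights then has the sign that makes the form nonnegative
  (\<open>weighted_form_nonneg\<close>, \<open>mixed_sum_identity\<close>). Finally \<open>D > 0\<close> characterises nondegenerate
  tetrahedra, so that the domain of the sphere packing structure is open and it is a conformal
  structure (\<open>conformal_structure_sphere_packing\<close>).
\<close>

section \<open>Angles of Euclidean simplices\<close>

text \<open>
  Affine independence in the form used below: based at a vertex \<open>i\<close>, the edge vectors of a realized
  simplex are linearly independent.
\<close>

lemma realizes_independent:
  assumes p: "realizes L \<sigma> p" and fin: "finite \<sigma>" and i: "i \<in> \<sigma>"
    and zero: "(\<Sum>m\<in>\<sigma> - {i}. u m *\<^sub>R (p m - p i)) = 0" and m: "m \<in> \<sigma> - {i}"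
  shows "u m = 0"
proof (rule ccontr)
  assume um: "u m \<noteq> 0"
  define U where "U m = (if m = i then - (\<Sum>m\<in>\<sigma> - {i}. u m) else u m)" for m
  define q where "q = the_inv_into \<sigma> p"
  have inj: "inj_on p \<sigma>" using p by (simp add: realizes_def)
  have q: "q (p m) = m" if "m \<in> \<sigma>" for m
    using inj that by (simp add: q_def the_inv_into_f_f)
  have "sum (U \<circ> q) (p ` \<sigma>) = sum U \<sigma>"
    using inj by (simp add: sum.reindex q cong: sum.cong)
  also have "\<dots> = 0"
    using fin i by (simp add: sum.remove[of \<sigma> i] U_def cong: sum.cong_simp)
  finally have 1: "sum (U \<circ> q) (p ` \<sigma>) = 0" .
  have "(\<Sum>x\<in>p ` \<sigma>. (U \<circ> q) x *\<^sub>R x) = (\<Sum>m\<in>\<sigma>. U m *\<^sub>R p m)"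
    using inj by (simp add: sum.reindex q cong: sum.cong)
  also have "\<dots> = (\<Sum>m\<in>\<sigma> - {i}. u m *\<^sub>R (p m - p i))"
    using fin i by (simp add: sum.remove[of \<sigma> i] U_def scaleR_diff_right sum_subtractf
        scaleR_sum_left cong: sum.cong_simp)
  finally have 2: "(\<Sum>x\<in>p ` \<sigma>. (U \<circ> q) x *\<^sub>R x) = 0" using zero by simp
  have "affine_dependent (p ` \<sigma>)"
    unfolding affine_dependent_explicit_finite[OF finite_imageI[OF fin]]
  proof (intro exI[of _ "U \<circ> q"] conjI)
    show "\<exists>x\<in>p ` \<sigma>. (U \<circ> q) x \<noteq> 0"
      using um m q[of m] by (intro bexI[of _ "p m"]) (auto simp: U_def)
  qed (use 1 2 in auto)
  then show False using p by (simp add: realizes_def)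
qed

lemma realizes_subset:
  assumes "realizes L \<sigma> p" "\<tau> \<subseteq> \<sigma>"
  shows "realizes L \<tau> p"
  using assms unfolding realizes_def
  by (meson affine_independent_subset image_mono inj_on_subset subsetD)

lemma realizes_realization: "realizes L \<sigma> p \<Longrightarrow> realizes L \<sigma> (realization L \<sigma>)"
  unfolding realization_def by (rule someI[of "realizes L \<sigma>"])

lemma realizes_length:
  assumes "realizes L \<sigma> p" "i \<in> \<sigma>" "j \<in> \<sigma>" "i \<noteq> j"
  shows "L i j > 0" "L j i = L i j" "norm (p j - p i) = L i j"
  using assms by (auto simp: realizes_def inj_on_def dist_norm norm_minus_commute)
    (metis dist_norm norm_minus_commute zero_less_dist_iff)+

lemma realizes_inner:
  assumes "realizes L \<sigma> p" "i \<in> \<sigma>" "j \<in> \<sigma>" "k \<in> \<sigma>" "i \<noteq> j" "i \<noteq> k" "j \<noteq> k"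
  shows "(p j - p i) \<bullet> (p k - p i) = ((L i j)\<^sup>2 + (L i k)\<^sup>2 - (L j k)\<^sup>2) / 2"
proof -
  have "(p j - p i) \<bullet> (p k - p i)
      = ((norm (p j - p i))\<^sup>2 + (norm (p k - p i))\<^sup>2 - (norm (p k - p j))\<^sup>2) / 2"
    by (simp add: power2_norm_eq_inner algebra_simps inner_commute)
  then show ?thesis using realizes_length[OF assms(1)] assms by metis
qed

definition cos_law :: "real \<Rightarrow> real \<Rightarrow> real \<Rightarrow> real" where
  "cos_law a b c = (a\<^sup>2 + b\<^sup>2 - c\<^sup>2) / (2 * a * b)"

lemma realizes_triangle_independent:
  assumes p: "realizes L {i, j, k} p" and ne: "i \<noteq> j" "i \<noteq> k" "j \<noteq> k"
    and "u *\<^sub>R (p j - p i) + v *\<^sub>R (p k - p i) = 0"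
  shows "u = 0" "v = 0"
proof -
  let ?U = "\<lambda>m. if m = j then u else v"
  have s: "{i, j, k} - {i} = {j, k}" using ne by auto
  have z: "(\<Sum>m\<in>{i, j, k} - {i}. ?U m *\<^sub>R (p m - p i)) = 0"
    unfolding s using assms by simp
  show "u = 0" "v = 0"
    using realizes_independent[OF p _ _ z, of j] realizes_independent[OF p _ _ z, of k] ne by auto
qed

lemma realizes_tetrahedron_independent:
  assumes p: "realizes L {i, j, k, l} p" and ne: "distinct [i, j, k, l]"
    and "u *\<^sub>R (p j - p i) + v *\<^sub>R (p k - p i) + w *\<^sub>R (p l - p i) = 0"
  shows "u = 0" "v = 0" "w = 0"
proof -
  let ?U = "\<lambda>m. if m = j then u else if m = k then v else w"
  have ne': "j \<noteq> k" "j \<noteq> l" "k \<noteq> l" "k \<noteq> j" "l \<noteq> j" "l \<noteq> k" using ne by auto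
  have s: "{i, j, k, l} - {i} = {j, k, l}" using ne by auto
  have z: "(\<Sum>m\<in>{i, j, k, l} - {i}. ?U m *\<^sub>R (p m - p i)) = 0"
    unfolding s using assms(3) ne' by (simp add: add.assoc)
  show "u = 0" "v = 0" "w = 0"
    using realizes_independent[OF p _ _ z, of j] realizes_independent[OF p _ _ z, of k]
      realizes_independent[OF p _ _ z, of l] ne by auto
qed

lemma cos_angle_between:
  assumes "\<And>s t. s *\<^sub>R u + t *\<^sub>R v = 0 \<Longrightarrow> s = 0 \<and> t = 0"
  shows "cos (angle_between u v) = u \<bullet> v / (norm u * norm v)"
    and "0 < angle_between u v" "angle_between u v < pi"
proof -
  have u: "norm u > 0" using assms[of 1 0] by auto
  have v: "norm v > 0" using assms[of 0 1] by auto
  have "\<bar>u \<bullet> v\<bar> \<noteq> norm u * norm v"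
    unfolding norm_cauchy_schwarz_abs_eq
    using assms[of "- norm v" "norm u"] assms[of "norm v" "norm u"] u v by auto
  then have "\<bar>u \<bullet> v\<bar> < norm u * norm v"
    using Cauchy_Schwarz_ineq2[of u v] by linarith
  then have "\<bar>u \<bullet> v / (norm u * norm v)\<bar> < 1"
    using u v by (simp add: abs_mult)
  then have b: "-1 < u \<bullet> v / (norm u * norm v)" "u \<bullet> v / (norm u * norm v) < 1" by linarith+
  show "cos (angle_between u v) = u \<bullet> v / (norm u * norm v)"
    using b by (simp add: angle_between_def)
  show "0 < angle_between u v" "angle_between u v < pi"
    using arccos_lt_bounded[OF b] by (auto simp: angle_between_def)
qed

lemma cos_face_angle:
  assumes p: "realizes L {i, j, k} p" and ne: "i \<noteq> j" "i \<noteq> k" "j \<noteq> k"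
  shows "cos (face_angle L i j k) = cos_law (L i j) (L i k) (L j k)"
    and "0 < face_angle L i j k" "face_angle L i j k < pi"
proof -
  define q where "q = realization L {i, j, k}"
  have q: "realizes L {i, j, k} q" using realizes_realization[OF p] by (simp add: q_def)
  have fa: "face_angle L i j k = angle_between (q j - q i) (q k - q i)"
    by (simp only: face_angle_def q_def Let_def)
  note * = cos_angle_between[of "q j - q i" "q k - q i"]
  have ind: "s = 0 \<and> t = 0" if "s *\<^sub>R (q j - q i) + t *\<^sub>R (q k - q i) = 0" for s t
    using realizes_triangle_independent[OF q ne that] by simp
  have cos: "cos (angle_between (q j - q i) (q k - q i))
      = (q j - q i) \<bullet> (q k - q i) / (norm (q j - q i) * norm (q k - q i))"
    by (rule *(1)) (rule ind)
  show "0 < face_angle L i j k" "face_angle L i j k < pi"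
    unfolding fa using *(2,3) ind by blast+
  show "cos (face_angle L i j k) = cos_law (L i j) (L i k) (L j k)"
    unfolding fa cos cos_law_def realizes_inner[OF q insertI1 insertI2[OF insertI1] insertI2[OF insertI2[OF insertI1]] ne]
    using realizes_length(3)[OF q, of i j] realizes_length(3)[OF q, of i k] ne by simp
qed

lemma sin_face_angle_pos:
  assumes "realizes L {i, j, k} p" and "i \<noteq> j" "i \<noteq> k" "j \<noteq> k"
  shows "sin (face_angle L i j k) > 0"
  using cos_face_angle(2,3)[OF assms] by (rule sin_gt_zero)

lemma face_angle_commute: "face_angle L i k j = face_angle L i j k"
  by (simp add: face_angle_def angle_between_def insert_commute inner_commute mult.commute)

lemma inner_orth_part: "orth_part a u \<bullet> orth_part a v = u \<bullet> v - (u \<bullet> a) * (v \<bullet> a) / (a \<bullet> a)"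
  by (cases "a = 0") (simp_all add: orth_part_def inner_diff inner_commute field_simps)

lemma norm_orth_part:
  assumes "norm a > 0" "norm u > 0" "cos \<gamma> = a \<bullet> u / (norm a * norm u)" "sin \<gamma> \<ge> 0"
  shows "norm (orth_part a u) = norm u * sin \<gamma>"
proof -
  have "(norm (orth_part a u))\<^sup>2 = (norm u)\<^sup>2 * (1 - (cos \<gamma>)\<^sup>2)"
    unfolding power2_norm_eq_inner[of "orth_part a u"] inner_orth_part assms(3)
    using assms(1,2) by (simp add: dot_square_norm inner_commute power_divide
        power_mult_distrib right_diff_distrib power2_eq_square)
  also have "\<dots> = (norm u * sin \<gamma>)\<^sup>2"
    by (simp add: power_mult_distrib sin_squared_eq)
  finally show ?thesis using assms by (simp add: power2_eq_iff_nonneg)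
qed

text \<open>
  The spherical law of cosines in the link of \<open>i\<close>: the dihedral angle at the edge \<open>{i, j}\<close> is the
  angle of the spherical triangle with sides the three face angles at \<open>i\<close>. Affine independence makes
  the two projections orthogonal to the edge independent, so the angle is not degenerate.
\<close>

lemma cos_dihedral_angle:
  assumes p: "realizes L {i, j, k, l} p" and ne: "distinct [i, j, k, l]"
  shows "cos (dihedral_angle L i j k l)
      = (cos (face_angle L i k l) - cos (face_angle L i j k) * cos (face_angle L i j l))
        / (sin (face_angle L i j k) * sin (face_angle L i j l))"
    and "0 < dihedral_angle L i j k l" "dihedral_angle L i j k l < pi"
proof -
  define q where "q = realization L {i, j, k, l}"
  have q: "realizes L {i, j, k, l} q" using realizes_realization[OF p] by (simp add: q_def)
  define a b c where "a = q j - q i" and "b = q k - q i" and "c = q l - q i"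
  have da: "dihedral_angle L i j k l = angle_between (orth_part a b) (orth_part a c)"
    by (simp only: dihedral_angle_def q_def a_def b_def c_def Let_def)
  have ind: "s = 0 \<and> t = 0" if "s *\<^sub>R orth_part a b + t *\<^sub>R orth_part a c = 0" for s t
  proof -
    \<comment> \<open>A relation between the projections is one between the edge vectors themselves.\<close>
    have "(- (s * ((b \<bullet> a) / (a \<bullet> a)) + t * ((c \<bullet> a) / (a \<bullet> a)))) *\<^sub>R a + s *\<^sub>R b + t *\<^sub>R c
        = s *\<^sub>R orth_part a b + t *\<^sub>R orth_part a c"
      by (simp add: orth_part_def algebra_simps)
    also note that
    finally show ?thesis
      using realizes_tetrahedron_independent[OF q ne] unfolding a_def b_def c_def by blast
  qed
  have sub: "realizes L {i, j, k} q" "realizes L {i, j, l} q" "realizes L {i, k, l} q"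
    using realizes_subset[OF q] by auto
  have pos: "L i j > 0" "L i k > 0" "L i l > 0"
    using realizes_length(1)[OF q, of i] ne by auto
  have nrm: "norm a = L i j" "norm b = L i k" "norm c = L i l"
    using realizes_length(3)[OF q, of i] ne by (auto simp: a_def b_def c_def)
  have inn: "a \<bullet> b = L i j * L i k * cos (face_angle L i j k)"
    "a \<bullet> c = L i j * L i l * cos (face_angle L i j l)"
    "b \<bullet> c = L i k * L i l * cos (face_angle L i k l)"
    using cos_face_angle(1)[OF sub(1)] cos_face_angle(1)[OF sub(2)] cos_face_angle(1)[OF sub(3)]
      realizes_inner[OF q, of i] ne pos by (auto simp: a_def b_def c_def cos_law_def)
  have s: "sin (face_angle L i j k) > 0" "sin (face_angle L i j l) > 0"
    using sin_face_angle_pos[OF sub(1)] sin_face_angle_pos[OF sub(2)] ne by auto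
  have nb: "norm (orth_part a b) = L i k * sin (face_angle L i j k)"
    using norm_orth_part[of a b "face_angle L i j k"] nrm pos inn s by simp
  have nc: "norm (orth_part a c) = L i l * sin (face_angle L i j l)"
    using norm_orth_part[of a c "face_angle L i j l"] nrm pos inn s by simp
  have "a \<bullet> a = (L i j)\<^sup>2" using nrm by (simp add: power2_norm_eq_inner[symmetric])
  then have ib: "orth_part a b \<bullet> orth_part a c = L i k * L i l *
      (cos (face_angle L i k l) - cos (face_angle L i j k) * cos (face_angle L i j l))"
    using pos inn by (simp add: inner_orth_part inner_commute field_simps power2_eq_square)
  note * = cos_angle_between[of "orth_part a b" "orth_part a c"]
  have cos: "cos (angle_between (orth_part a b) (orth_part a c))
      = orth_part a b \<bullet> orth_part a c / (norm (orth_part a b) * norm (orth_part a c))"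
    by (rule *(1)) (rule ind)
  show "0 < dihedral_angle L i j k l" "dihedral_angle L i j k l < pi"
    unfolding da using *(2,3) ind by blast+
  show "cos (dihedral_angle L i j k l)
      = (cos (face_angle L i k l) - cos (face_angle L i j k) * cos (face_angle L i j l))
        / (sin (face_angle L i j k) * sin (face_angle L i j l))"
    unfolding da cos ib nb nc using pos s by (simp add: divide_simps) (simp add: algebra_simps)?
qed

text \<open>
  Exchanging the end points of an edge replaces \<open>a\<close> by \<open>- a\<close> and changes the other edge vectors by
  a multiple of \<open>a\<close>, which projection orthogonal to \<open>a\<close> does not see.
\<close>

lemma orth_part_reverse: "orth_part (- a) (u - a) = orth_part a u"
proof (cases "a = 0")
  case False
  then have "(u - a) \<bullet> a / (a \<bullet> a) = u \<bullet> a / (a \<bullet> a) - 1"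
    by (simp add: inner_diff diff_divide_distrib)
  then have "orth_part a (u - a) = orth_part a u"
    unfolding orth_part_def by (simp only: scaleR_left_diff_distrib) simp
  then show ?thesis
    by (simp add: orth_part_def)
qed (simp add: orth_part_def)

lemma dihedral_angle_reverse: "dihedral_angle L j i k l = dihedral_angle L i j k l"
proof -
  define p where "p = realization L {i, j, k, l}"
  have "{j, i, k, l} = {i, j, k, l}" by auto
  then have "dihedral_angle L j i k l
      = angle_between (orth_part (p i - p j) (p k - p j)) (orth_part (p i - p j) (p l - p j))"
    by (simp only: dihedral_angle_def p_def Let_def)
  also have "\<dots> = dihedral_angle L i j k l"
    using orth_part_reverse[of "p j - p i" "p k - p i"] orth_part_reverse[of "p j - p i" "p l - p i"]
    by (simp only: dihedral_angle_def p_def Let_def minus_diff_eq diff_diff_eq2 diff_add_cancel)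
  finally show ?thesis .
qed

section \<open>Differentiating the cosine laws\<close>

text \<open>
  Angles are recovered from their cosines by \<open>arccos\<close>, whose derivative is \<open>- 1 / sin\<close>; nondegeneracy
  on a neighbourhood keeps them away from the end points \<open>0\<close> and \<open>pi\<close>.
\<close>

lemma has_derivative_angle:
  fixes F \<gamma> :: "'a::real_normed_vector \<Rightarrow> real"
  assumes F: "(F has_derivative F') (at f)" and U: "open U" "f \<in> U"
    and cos: "\<And>g. g \<in> U \<Longrightarrow> cos (\<gamma> g) = F g"
    and bounds: "\<And>g. g \<in> U \<Longrightarrow> 0 < \<gamma> g \<and> \<gamma> g < pi"
  shows "(\<gamma> has_derivative (\<lambda>h. - F' h / sin (\<gamma> f))) (at f)"
proof -
  have s: "sin (\<gamma> f) > 0" using bounds[OF U(2)] sin_gt_zero by blast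
  have Ff: "F f = cos (\<gamma> f)" using cos U by simp
  have "(F f)\<^sup>2 < 1"
    unfolding Ff using s by (simp add: cos_squared_eq)
  then have b: "-1 < F f" "F f < 1" by (simp_all add: power2_less_1_iff abs_less_iff)
  have "(arccos has_field_derivative inverse (- sqrt (1 - (F f)\<^sup>2))) (at (F f))"
    by (rule DERIV_arccos) (use b in auto)
  moreover have "sqrt (1 - (F f)\<^sup>2) = sin (\<gamma> f)"
    unfolding Ff using s by (simp add: cos_squared_eq)
  ultimately have "(arccos has_derivative (*) (inverse (- sin (\<gamma> f)))) (at (F f))"
    by (simp add: has_field_derivative_def)
  from has_derivative_compose[OF F this]
  have "((\<lambda>g. arccos (F g)) has_derivative (\<lambda>h. - F' h / sin (\<gamma> f))) (at f)"
    by (simp add: divide_inverse mult.commute)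
  then show ?thesis
  proof (rule has_derivative_transform_within_open[OF _ U])
    fix g assume "g \<in> U"
    then show "arccos (F g) = \<gamma> g"
      using cos[of g] bounds[of g] arccos_cos[of "\<gamma> g"] by auto
  qed
qed

text \<open>
  The quotient rule with the value of the quotient itself in the derivative, so that in the applications
  below the cosine reappears there.
\<close>

lemma has_derivative_quotient:
  fixes N D :: "'a::real_normed_vector \<Rightarrow> real"
  assumes "(N has_derivative N') (at f)" "(D has_derivative D') (at f)" "D f \<noteq> 0"
  shows "((\<lambda>g. N g / D g) has_derivative (\<lambda>h. (N' h - N f / D f * D' h) / D f)) (at f)"
  by (rule has_derivative_eq_rhs[OF has_derivative_divide'[OF assms]])
     (use assms(3) in \<open>simp add: fun_eq_iff diff_divide_distrib\<close>)

lemma has_derivative_cos_law: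
  fixes a b c :: "'a::real_normed_vector \<Rightarrow> real"
  assumes d: "(a has_derivative a') (at f)" "(b has_derivative b') (at f)" "(c has_derivative c') (at f)"
    and pos: "a f > 0" "b f > 0"
  shows "((\<lambda>g. cos_law (a g) (b g) (c g)) has_derivative
      (\<lambda>h. (1 / b f - cos_law (a f) (b f) (c f) / a f) * a' h
        + (1 / a f - cos_law (a f) (b f) (c f) / b f) * b' h - c f / (a f * b f) * c' h)) (at f)"
proof -
  have *: "(2 * x * x' + 2 * y * y' - 2 * z * z' - F * (2 * (x' * y + x * y'))) / (2 * x * y)
      = (1 / y - F / x) * x' + (1 / x - F / y) * y' - z / (x * y) * z'"
    if "x > 0" "y > 0" for x y z x' y' z' F :: real
  proof -
    have "(2 * x * y) * ((1 / y - F / x) * x' + (1 / x - F / y) * y' - z / (x * y) * z')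
      = 2 * x * (y * (1 / y)) * x' - 2 * y * F * (x * (1 / x)) * x'
        + 2 * y * (x * (1 / x)) * y' - 2 * x * F * (y * (1 / y)) * y'
        - 2 * z * ((x * y) * (1 / (x * y))) * z'"
      by (simp only: divide_inverse ring_distribs) (simp only: mult_1 mult_1_right mult_ac)
    also have "\<dots> = 2 * x * x' + 2 * y * y' - 2 * z * z' - F * (2 * (x' * y + x * y'))"
      using that by (simp add: algebra_simps)
    finally show ?thesis
      using that by (metis less_irrefl mult_eq_0_iff nonzero_mult_div_cancel_left zero_neq_numeral)
  qed
  have N: "((\<lambda>g. (a g)\<^sup>2 + (b g)\<^sup>2 - (c g)\<^sup>2) has_derivative
      (\<lambda>h. 2 * a f * a' h + 2 * b f * b' h - 2 * c f * c' h)) (at f)"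
    by (rule has_derivative_eq_rhs, (rule derivative_intros d)+) (simp add: fun_eq_iff)
  have D: "((\<lambda>g. 2 * a g * b g) has_derivative (\<lambda>h. 2 * (a' h * b f + a f * b' h))) (at f)"
    by (rule has_derivative_eq_rhs, (rule derivative_intros d)+) (simp add: fun_eq_iff algebra_simps)
  from has_derivative_quotient[OF N D] show ?thesis
    unfolding cos_law_def[symmetric] *[OF pos] using pos by simp
qed

lemma has_derivative_spherical_cos_law:
  fixes a b c :: "'a::real_normed_vector \<Rightarrow> real"
  assumes d: "(a has_derivative a') (at f)" "(b has_derivative b') (at f)" "(c has_derivative c') (at f)"
    and pos: "sin (b f) > 0" "sin (c f) > 0"
    and A: "cos A = (cos (a f) - cos (b f) * cos (c f)) / (sin (b f) * sin (c f))"
  shows "((\<lambda>g. (cos (a g) - cos (b g) * cos (c g)) / (sin (b g) * sin (c g))) has_derivative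
      (\<lambda>h. - (sin (a f) * a' h
          - (sin (b f) * cos (c f) - cos A * cos (b f) * sin (c f)) * b' h
          - (cos (b f) * sin (c f) - cos A * sin (b f) * cos (c f)) * c' h)
         / (sin (b f) * sin (c f)))) (at f)"
proof -
  have N: "((\<lambda>g. cos (a g) - cos (b g) * cos (c g)) has_derivative (\<lambda>h. - sin (a f) * a' h
      + sin (b f) * cos (c f) * b' h + cos (b f) * sin (c f) * c' h)) (at f)"
    by (rule has_derivative_eq_rhs, (rule derivative_intros d)+) (simp add: fun_eq_iff algebra_simps)
  have D: "((\<lambda>g. sin (b g) * sin (c g)) has_derivative
      (\<lambda>h. cos (b f) * sin (c f) * b' h + sin (b f) * cos (c f) * c' h)) (at f)"
    by (rule has_derivative_eq_rhs, (rule derivative_intros d)+) (simp add: fun_eq_iff algebra_simps)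
  from has_derivative_quotient[OF N D] show ?thesis
    unfolding A[symmetric]
    by (rule has_derivative_eq_rhs) (use pos in \<open>simp_all add: fun_eq_iff algebra_simps\<close>)
qed

text \<open>
  Divided by the sine of the angle at \<open>i\<close>, the left side is the rate of that angle under a variation at
  \<open>j\<close>, computed from the law of cosines, and the right side is the height \<open>h\<^sub>i\<^sub>j\<^sub>,\<^sub>k\<close> over the
  length of \<open>{i, j}\<close>. The compatibility condition on metrics makes them equal.
\<close>

lemma height_edge_identity:
  fixes dij djk dki dji dik dkj F :: real
  assumes met: "dij\<^sup>2 + djk\<^sup>2 + dki\<^sup>2 = dji\<^sup>2 + dik\<^sup>2 + dkj\<^sup>2"
    and ab: "dij + dji > 0" "dik + dki > 0" and F: "F = cos_law (dij + dji) (dik + dki) (djk + dkj)"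
  shows "(F / (dij + dji) - 1 / (dik + dki)) * dji
      + (djk + dkj) / ((dij + dji) * (dik + dki)) * djk = (dik - dij * F) / (dij + dji)"
proof -
  let ?a = "dij + dji" and ?b = "dik + dki" and ?c = "djk + dkj"
  have "2 * ?a * ?b * F = ?a\<^sup>2 + ?b\<^sup>2 - ?c\<^sup>2"
    unfolding F cos_law_def using ab by simp
  then have "F * ?a * ?b + ?c * djk = ?b * dik + ?a * dji"
    using met by algebra
  then have "(F * ?b - ?a) * dji + ?c * djk = ?b * (dik - dij * F)" by algebra
  then have "((F * ?b - ?a) * dji + ?c * djk) / (?a * ?b) = ?b * (dik - dij * F) / (?a * ?b)" by simp
  moreover have "?b * (dik - dij * F) / (?a * ?b) = (dik - dij * F) / ?a" using ab by simp
  moreover have "((F * ?b - ?a) * dji + ?c * djk) / (?a * ?b)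
      = (F / ?a - 1 / ?b) * dji + ?c / (?a * ?b) * djk"
    using ab by (simp add: add_divide_distrib[of "_ - _"] left_diff_distrib diff_divide_distrib)
  ultimately show ?thesis by simp
qed

text \<open>
  The rates of the dihedral angles at the vertex \<open>i\<close> under a variation at \<open>j\<close>: \<open>axis_rate d i j k l\<close>
  for the angle at \<open>{i, j}\<close> itself, \<open>hinge_rate d i j k l\<close> for the angle at \<open>{i, k}\<close>, about which the
  face \<open>{i, j, k}\<close> turns.
\<close>

definition axis_rate :: "('v \<Rightarrow> 'v \<Rightarrow> real) \<Rightarrow> 'v \<Rightarrow> 'v \<Rightarrow> 'v \<Rightarrow> 'v \<Rightarrow> real" where
  "axis_rate d i j k l =
     - (height_face d i j k l * cot (face_angle (edge_length d) i j k)
        + height_face d i j l k * cot (face_angle (edge_length d) i j l)) / edge_length d i j"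

definition hinge_rate :: "('v \<Rightarrow> 'v \<Rightarrow> real) \<Rightarrow> 'v \<Rightarrow> 'v \<Rightarrow> 'v \<Rightarrow> 'v \<Rightarrow> real" where
  "hinge_rate d i j k l =
     height_face d i j k l / (edge_length d i j * sin (face_angle (edge_length d) i j k))"

text \<open>
  The five-part formula and the law of sines of a spherical triangle with sides \<open>a\<close>, \<open>b\<close>, \<open>c\<close> and
  opposite angles \<open>A\<close>, \<open>B\<close>.
\<close>

lemma spherical_triangle:
  assumes s: "sin a > 0" "sin b > 0" "sin c > 0" "sin A > 0" "sin B > (0::real)"
    and A: "cos A = (cos a - cos b * cos c) / (sin b * sin c)"
    and B: "cos B = (cos b - cos a * cos c) / (sin a * sin c)"
  shows "cos b * sin c - cos A * sin b * cos c = sin a * cos B"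
    and "sin A * sin b = sin a * sin B"
proof -
  have A': "cos A * sin b * sin c = cos a - cos b * cos c" using A s by simp
  have B': "cos B * sin a * sin c = cos b - cos a * cos c" using B s by simp
  have c: "(sin c)\<^sup>2 + (cos c)\<^sup>2 = 1" by simp
  have "sin c * (cos b * sin c - cos A * sin b * cos c) = sin c * (sin a * cos B)"
    using A' B' c by algebra
  then show "cos b * sin c - cos A * sin b * cos c = sin a * cos B"
    using s by simp
  have "(sin A * sin b * sin c)\<^sup>2 = (sin a * sin B * sin c)\<^sup>2"
    using A' B' c sin_cos_squared_add[of A] sin_cos_squared_add[of B] sin_cos_squared_add[of a]
      sin_cos_squared_add[of b] by algebra
  then have "sin A * sin b * sin c = sin a * sin B * sin c"
    using s by (simp add: power2_eq_iff_nonneg)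
  then show "sin A * sin b = sin a * sin B" using s by simp
qed

lemma face_rate_identity:
  fixes F :: real
  assumes "(F / a - 1 / b) * dji + c / (a * b) * djk = (dik - dij * F) / a"
    and "(F / b - 1 / a) * dki + c / (a * b) * dkj = (dij - dik * F) / b"
  shows "- ((1 / b - F / a) * (dij * hi + dji * hj) + (1 / a - F / b) * (dik * hi + dki * hk)
        - c / (a * b) * (djk * hj + dkj * hk))
      = (dik - dij * F) / a * (hj - hi) + (dij - dik * F) / b * (hk - hi)"
proof -
  have "- ((1 / b - F / a) * (dij * hi + dji * hj) + (1 / a - F / b) * (dik * hi + dki * hk)
        - c / (a * b) * (djk * hj + dkj * hk))
      = ((F / a - 1 / b) * dji + c / (a * b) * djk) * hj
        + ((F / b - 1 / a) * dki + c / (a * b) * dkj) * hk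
        - ((dik - dij * F) / a + (dij - dik * F) / b) * hi"
    by (simp add: diff_divide_distrib ring_distribs mult_ac)
  then show ?thesis unfolding assms by (simp add: ring_distribs)
qed

text \<open>
  The differentiated spherical law of cosines, sorted by the vertex whose variation causes the change.
  The sides \<open>a\<close>, \<open>b\<close>, \<open>c\<close> are the face angles \<open>\<gamma>\<^sub>i\<^sub>,\<^sub>k\<^sub>l\<close>, \<open>\<gamma>\<^sub>i\<^sub>,\<^sub>j\<^sub>l\<close>, \<open>\<gamma>\<^sub>i\<^sub>,\<^sub>j\<^sub>k\<close>, whose rates are
  combinations of heights over lengths; \<open>hjk\<close> stands for \<open>h\<^sub>i\<^sub>j\<^sub>,\<^sub>k\<close> and \<open>lj\<close> for the length of
  \<open>{i, j}\<close>. By the five-part formula and the law of sines, the coefficients for \<open>k\<close> and \<open>l\<close>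
  become heights over faces.
\<close>

lemma dihedral_rate_identity:
  fixes lj lk ll :: real
  assumes s: "sin a > 0" "sin b > 0" "sin c > 0" "sin A > 0" "sin B > 0" "sin C > 0"
    and A: "cos A = (cos a - cos b * cos c) / (sin b * sin c)"
    and B: "cos B = (cos b - cos a * cos c) / (sin a * sin c)"
    and C: "cos C = (cos c - cos a * cos b) / (sin a * sin b)"
    and l: "lj > 0" "lk > 0" "ll > 0"
  shows "(sin a * (hkl / lk * k + hlk / ll * l)
        - (sin b * cos c - cos A * cos b * sin c) * (hjl / lj * j + hlj / ll * l)
        - (cos b * sin c - cos A * sin b * cos c) * (hjk / lj * j + hkj / lk * k)) / (sin b * sin c) / sin A
      = - ((hjl - hjk * cos A) / sin A * cot c + (hjk - hjl * cos A) / sin A * cot b) / lj * j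
        + (hkl - hkj * cos B) / sin B / (lk * sin c) * k
        + (hlk - hlj * cos C) / sin C / (ll * sin b) * l"
proof -
  note B' = spherical_triangle[OF s(1,2,3,4,5) A B]
  have A2: "cos A = (cos a - cos c * cos b) / (sin c * sin b)" using A by (simp add: mult.commute)
  note C' = spherical_triangle[OF s(1,3,2,4,6) A2 C]
  have j: "- ((hjl - hjk * cos A) / sin A * cot c + (hjk - hjl * cos A) / sin A * cot b) / lj
    = - ((sin b * cos c - cos A * cos b * sin c) * hjl
        + (cos b * sin c - cos A * sin b * cos c) * hjk) / (lj * (sin b * sin c * sin A))"
    using s l by (simp add: cot_def divide_simps) (simp add: algebra_simps)
  have k: "(hkl - hkj * cos B) / sin B / (lk * sin c)
    = (sin a * hkl - (sin a * cos B) * hkj) / (lk * (sin b * sin c * sin A))"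
  proof -
    have "sin b * sin c * sin A = sin c * (sin a * sin B)" using B'(2) by (simp add: mult_ac)
    then show ?thesis using s l by (simp add: divide_simps) (simp add: algebra_simps)
  qed
  have l': "(hlk - hlj * cos C) / sin C / (ll * sin b)
    = (sin a * hlk - (sin a * cos C) * hlj) / (ll * (sin b * sin c * sin A))"
  proof -
    have "sin b * sin c * sin A = sin b * (sin a * sin C)" using C'(2) by (simp add: mult_ac)
    then show ?thesis using s l by (simp add: divide_simps) (simp add: algebra_simps)
  qed
  have C1: "sin b * cos c - cos A * cos b * sin c = sin a * cos C" using C'(1) by (simp add: mult_ac)
  have "(sin a * (hkl / lk * k + hlk / ll * l) - X * (hjl / lj * j + hlj / ll * l)
        - Y * (hjk / lj * j + hkj / lk * k)) / Z
      = - (X * hjl + Y * hjk) / (lj * Z) * j + (sin a * hkl - Y * hkj) / (lk * Z) * k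
        + (sin a * hlk - X * hlj) / (ll * Z) * l" if "Z > 0" for X Y Z
  proof -
    have "(sin a * (hkl / lk * k + hlk / ll * l) - X * (hjl / lj * j + hlj / ll * l)
        - Y * (hjk / lj * j + hkj / lk * k))
      = - (X * hjl + Y * hjk) / lj * j + (sin a * hkl - Y * hkj) / lk * k
        + (sin a * hlk - X * hlj) / ll * l"
      by (simp add: diff_divide_distrib add_divide_distrib ring_distribs)
    then show ?thesis
      by (simp add: diff_divide_distrib add_divide_distrib ring_distribs mult.commute)
  qed
  from this[of "sin b * sin c * sin A"] show ?thesis
    unfolding j k l' C1[symmetric] B'(1)[symmetric] using s by simp
qed

section \<open>Mixed partial derivatives\<close>

lemma partial_deriv_eq:
  assumes "(g has_derivative g') (at f)"
  shows "partial_deriv g k f = g' (axis k 1)"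
  using assms by (simp add: partial_deriv_def frechet_derivative_at[symmetric])

lemma has_derivative_two_partials:
  fixes g :: "real ^ 'v \<Rightarrow> real"
  assumes "g differentiable (at f)" "i \<noteq> j"
    and "\<And>k. k \<noteq> i \<Longrightarrow> k \<noteq> j \<Longrightarrow> partial_deriv g k f = 0"
  shows "(g has_derivative (\<lambda>h. partial_deriv g i f * h $ i + partial_deriv g j f * h $ j)) (at f)"
proof -
  have D: "(g has_derivative frechet_derivative g (at f)) (at f)"
    using assms(1) by (simp add: frechet_derivative_works)
  then have lin: "linear (frechet_derivative g (at f))"
    by (rule has_derivative_linear)
  have "frechet_derivative g (at f) h = partial_deriv g i f * h $ i + partial_deriv g j f * h $ j"
    for h
  proof -
    have "h = (\<Sum>k\<in>UNIV. h $ k *\<^sub>R axis k 1)"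
      using basis_expansion[of h] by (simp add: scalar_mult_eq_scaleR)
    then have "frechet_derivative g (at f) h
        = (\<Sum>k\<in>UNIV. h $ k *\<^sub>R frechet_derivative g (at f) (axis k 1))"
      using linear_sum[OF lin] linear_scale[OF lin] by (metis (no_types, lifting) sum.cong)
    also have "\<dots> = (\<Sum>k\<in>UNIV. h $ k * partial_deriv g k f)"
      by (simp add: partial_deriv_def)
    also have "\<dots> = (\<Sum>k\<in>{i, j}. h $ k * partial_deriv g k f)"
      by (rule sum.mono_neutral_right) (use assms(3) in auto)
    finally show ?thesis using assms(2) by (simp add: mult.commute)
  qed
  then show ?thesis using D by (metis (no_types, lifting) ext)
qed

text \<open>
  The heart of the symmetry of second derivatives: if the derivative in direction \<open>u\<close> is itself
  differentiable at \<open>f\<close>, then the mean value theorem in direction \<open>u\<close> identifies the limit of the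
  second difference quotient, an expression symmetric in \<open>u\<close> and \<open>w\<close>.
\<close>

lemma second_difference_limit:
  fixes g a :: "real ^ 'v::finite \<Rightarrow> real"
  assumes U: "open U" "f \<in> U"
    and diff: "\<And>x. x \<in> U \<Longrightarrow> g differentiable (at x)"
    and a: "\<And>x. x \<in> U \<Longrightarrow> frechet_derivative g (at x) u = a x"
    and a': "(a has_derivative a') (at f)"
  shows "((\<lambda>t. (g (f + t *\<^sub>R u + t *\<^sub>R w) - g (f + t *\<^sub>R u) - g (f + t *\<^sub>R w) + g f) / t\<^sup>2)
      \<longlongrightarrow> a' w) (at_right 0)"
proof (rule tendstoI)
  fix e :: real assume e: "e > 0"
  \<comment> \<open>For \<open>0 \<le> s, c \<le> t\<close> the displacement \<open>s u + c w\<close> has norm at most \<open>t N\<close>.\<close>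
  define N where "N = norm u + norm w + 1"
  have N: "N > 0" by (simp add: N_def add_nonneg_pos)
  obtain r where r: "r > 0" "ball f r \<subseteq> U" using U openE by blast
  have lin: "linear a'" using a' has_derivative_linear by blast
  have e': "e / (4 * N) > 0" using e N by simp
  obtain \<delta> where \<delta>: "\<delta> > 0"
    and close: "\<And>y. norm (y - f) < \<delta> \<Longrightarrow> norm (a y - a f - a' (y - f)) \<le> e / (4 * N) * norm (y - f)"
    using a'[unfolded has_derivative_at_alt] e' by blast
  define \<tau> where "\<tau> = min r \<delta> / N"
  have \<tau>: "\<tau> > 0" using r \<delta> N by (simp add: \<tau>_def)
  have "dist ((g (f + t *\<^sub>R u + t *\<^sub>R w) - g (f + t *\<^sub>R u) - g (f + t *\<^sub>R w) + g f) / t\<^sup>2) (a' w) < e"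
    if t: "0 < t" "t < \<tau>" for t
  proof -
    define G where "G s = g (f + s *\<^sub>R u + t *\<^sub>R w) - g (f + s *\<^sub>R u)" for s
    have bound: "norm (s *\<^sub>R u + c *\<^sub>R w) < min r \<delta>" "norm (s *\<^sub>R u + c *\<^sub>R w) \<le> t * N"
      if "0 \<le> s" "s \<le> t" "0 \<le> c" "c \<le> t" for s c
    proof -
      have "norm (s *\<^sub>R u + c *\<^sub>R w) \<le> s * norm u + c * norm w"
        using norm_triangle_ineq[of "s *\<^sub>R u" "c *\<^sub>R w"] that by simp
      also have "\<dots> \<le> t * norm u + t * norm w"
        using that by (intro add_mono mult_right_mono) auto
      also have "\<dots> \<le> t * N" using t by (simp add: N_def algebra_simps)
      finally show 1: "norm (s *\<^sub>R u + c *\<^sub>R w) \<le> t * N" .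
      have "t * N < \<tau> * N" using t N by simp
      also have "\<dots> = min r \<delta>" using N by (simp add: \<tau>_def)
      finally show "norm (s *\<^sub>R u + c *\<^sub>R w) < min r \<delta>" using 1 by simp
    qed
    have inU: "f + s *\<^sub>R u + c *\<^sub>R w \<in> U" if "0 \<le> s" "s \<le> t" "0 \<le> c" "c \<le> t" for s c
      using bound(1)[OF that] r(2) by (auto simp: dist_norm add.assoc norm_minus_commute subset_iff)
    have dg: "((\<lambda>s. g (f + s *\<^sub>R u + c *\<^sub>R w)) has_real_derivative a (f + s *\<^sub>R u + c *\<^sub>R w)) (at s)"
      if "0 \<le> s" "s \<le> t" "0 \<le> c" "c \<le> t" for s c
    proof -
      let ?x = "f + s *\<^sub>R u + c *\<^sub>R w"
      have D: "(g has_derivative frechet_derivative g (at ?x)) (at ?x)"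
        using diff[OF inU[OF that]] by (simp add: frechet_derivative_works)
      have "((\<lambda>s. f + s *\<^sub>R u + c *\<^sub>R w) has_derivative (\<lambda>h. h *\<^sub>R u)) (at s)"
        by (auto intro!: derivative_eq_intros)
      from has_derivative_compose[OF this D]
      have "((\<lambda>s. g (f + s *\<^sub>R u + c *\<^sub>R w)) has_derivative
          (\<lambda>h. frechet_derivative g (at ?x) (h *\<^sub>R u))) (at s)" .
      then show ?thesis
        using linear_scale[OF has_derivative_linear[OF D]] a[OF inU[OF that]]
        by (simp add: has_field_derivative_def mult_commute_abs)
    qed
    have dG: "(G has_real_derivative (a (f + s *\<^sub>R u + t *\<^sub>R w) - a (f + s *\<^sub>R u))) (at s)"
      if "0 \<le> s" "s \<le> t" for s
      unfolding G_def using DERIV_diff[OF dg[of s t] dg[of s 0]] that t by simp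
    obtain s where s: "0 < s" "s < t"
      and mvt: "G t - G 0 = t * (a (f + s *\<^sub>R u + t *\<^sub>R w) - a (f + s *\<^sub>R u))"
      using MVT2[of 0 t G "\<lambda>s. a (f + s *\<^sub>R u + t *\<^sub>R w) - a (f + s *\<^sub>R u)"] dG t by auto
    define x y where "x = s *\<^sub>R u + t *\<^sub>R w" and "y = s *\<^sub>R u + 0 *\<^sub>R w"
    have nx: "norm x < \<delta>" "norm x \<le> t * N" and ny: "norm y < \<delta>" "norm y \<le> t * N"
      using bound[of s t] bound[of s 0] s t by (auto simp: x_def y_def)
    have "a' x - a' y = t * a' w"
      using linear_diff[OF lin, of x y] linear_scale[OF lin] by (simp add: x_def y_def)
    then have "a (f + x) - a (f + y) - t * a' w
        = (a (f + x) - a f - a' x) - (a (f + y) - a f - a' y)"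
      by simp
    moreover have "\<bar>a (f + x) - a f - a' x\<bar> \<le> e / (4 * N) * norm x"
      using close[of "f + x"] nx by simp
    moreover have "\<bar>a (f + y) - a f - a' y\<bar> \<le> e / (4 * N) * norm y"
      using close[of "f + y"] ny by simp
    moreover have "e / (4 * N) * norm x \<le> e / (4 * N) * (t * N)"
      using nx e' by (intro mult_left_mono) auto
    moreover have "e / (4 * N) * norm y \<le> e / (4 * N) * (t * N)"
      using ny e' by (intro mult_left_mono) auto
    moreover have "e / (4 * N) * (t * N) = t * e / 4" using N by simp
    ultimately have "\<bar>a (f + x) - a (f + y) - t * a' w\<bar> \<le> t * e / 2" by linarith
    then have "\<bar>(a (f + x) - a (f + y)) / t - a' w\<bar> \<le> e / 2"
      using t by (simp add: abs_le_iff field_simps)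
    moreover have "(g (f + t *\<^sub>R u + t *\<^sub>R w) - g (f + t *\<^sub>R u) - g (f + t *\<^sub>R w) + g f) / t\<^sup>2
        = (a (f + x) - a (f + y)) / t"
    proof -
      have "g (f + t *\<^sub>R u + t *\<^sub>R w) - g (f + t *\<^sub>R u) - g (f + t *\<^sub>R w) + g f
          = t * (a (f + x) - a (f + y))"
        using mvt by (simp add: G_def x_def y_def add.assoc)
      then show ?thesis using t by (simp add: power2_eq_square)
    qed
    ultimately show ?thesis using e by (simp add: dist_real_def)
  qed
  then show "\<forall>\<^sub>F t in at_right 0. dist ((g (f + t *\<^sub>R u + t *\<^sub>R w) - g (f + t *\<^sub>R u)
      - g (f + t *\<^sub>R w) + g f) / t\<^sup>2) (a' w) < e"
    using \<tau> unfolding eventually_at_right_field by blast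
qed

lemma mixed_partials_commute:
  fixes g a b :: "real ^ 'v::finite \<Rightarrow> real"
  assumes U: "open U" "f \<in> U"
    and diff: "\<And>x. x \<in> U \<Longrightarrow> g differentiable (at x)"
    and a: "\<And>x. x \<in> U \<Longrightarrow> partial_deriv g i x = a x" "a differentiable (at f)"
    and b: "\<And>x. x \<in> U \<Longrightarrow> partial_deriv g j x = b x" "b differentiable (at f)"
  shows "partial_deriv a j f = partial_deriv b i f"
proof -
  define u w :: "real ^ 'v" where "u = axis i 1" and "w = axis j 1"
  have D: "(a has_derivative frechet_derivative a (at f)) (at f)"
    "(b has_derivative frechet_derivative b (at f)) (at f)"
    using a(2) b(2) by (simp_all add: frechet_derivative_works)
  have 1: "((\<lambda>t. (g (f + t *\<^sub>R u + t *\<^sub>R w) - g (f + t *\<^sub>R u) - g (f + t *\<^sub>R w) + g f) / t\<^sup>2)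
      \<longlongrightarrow> frechet_derivative a (at f) w) (at_right 0)"
    by (rule second_difference_limit[OF U diff _ D(1)])
       (use a(1) in \<open>auto simp: partial_deriv_def u_def\<close>)
  have 2: "((\<lambda>t. (g (f + t *\<^sub>R w + t *\<^sub>R u) - g (f + t *\<^sub>R w) - g (f + t *\<^sub>R u) + g f) / t\<^sup>2)
      \<longlongrightarrow> frechet_derivative b (at f) u) (at_right 0)"
    by (rule second_difference_limit[OF U diff _ D(2)])
       (use b(1) in \<open>auto simp: partial_deriv_def w_def\<close>)
  have "(\<lambda>t. (g (f + t *\<^sub>R w + t *\<^sub>R u) - g (f + t *\<^sub>R w) - g (f + t *\<^sub>R u) + g f) / t\<^sup>2)
      = (\<lambda>t. (g (f + t *\<^sub>R u + t *\<^sub>R w) - g (f + t *\<^sub>R u) - g (f + t *\<^sub>R w) + g f) / t\<^sup>2)"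
    by (simp add: algebra_simps)
  with 2 have "((\<lambda>t. (g (f + t *\<^sub>R u + t *\<^sub>R w) - g (f + t *\<^sub>R u) - g (f + t *\<^sub>R w) + g f) / t\<^sup>2)
      \<longlongrightarrow> frechet_derivative b (at f) u) (at_right 0)"
    by simp
  from tendsto_unique[OF trivial_limit_at_right_real 1 this] show ?thesis
    by (simp add: partial_deriv_def u_def w_def)
qed

section \<open>Lengths and angles under a conformal variation\<close>

locale conformal =
  fixes T :: "'v::finite set set" and U :: "(real ^ 'v) set" and C :: "real ^ 'v \<Rightarrow> 'v \<Rightarrow> 'v \<Rightarrow> real"
  assumes complex: "abstract_complex T" and conf: "conformal_structure T U C"
begin

abbreviation len :: "real ^ 'v \<Rightarrow> 'v \<Rightarrow> 'v \<Rightarrow> real" where "len f \<equiv> edge_length (C f)"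
abbreviation q :: "real ^ 'v \<Rightarrow> 'v \<Rightarrow> 'v \<Rightarrow> real" where "q f i j \<equiv> partial_deriv (\<lambda>f. C f i j) j f"

lemma open_domain: "open U"
  using conf by (simp add: conformal_structure_def)

lemma realizable: "f \<in> U \<Longrightarrow> \<sigma> \<in> T \<Longrightarrow> \<exists>p. realizes (len f) \<sigma> p"
  using conf by (auto simp: conformal_structure_def metrics_def piecewise_flat_def)

lemma metric_identity:
  "f \<in> U \<Longrightarrow> {i, j, k} \<in> triangles T \<Longrightarrow>
   (C f i j)\<^sup>2 + (C f j k)\<^sup>2 + (C f k i)\<^sup>2 = (C f j i)\<^sup>2 + (C f i k)\<^sup>2 + (C f k j)\<^sup>2"
  using conf by (auto simp: conformal_structure_def metrics_def)

lemma edge_length_commute: "len f i j = len f j i"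
  by (simp add: edge_length_def)

lemma edge_distinct: "{i, j} \<in> edges T \<Longrightarrow> i \<noteq> j"
  by (auto simp: edges_def)

lemma edge_commute: "{i, j} \<in> edges T \<Longrightarrow> {j, i} \<in> edges T"
  by (simp add: insert_commute)

lemma edge_length_pos:
  assumes "f \<in> U" "{i, j} \<in> edges T"
  shows "len f i j > 0"
proof -
  obtain p where "realizes (len f) {i, j} p" using realizable assms by (auto simp: edges_def)
  from realizes_length(1)[OF this, of i j] show ?thesis using edge_distinct assms by auto
qed

lemma differentiable_C:
  assumes "f \<in> U" "{i, j} \<in> edges T"
  shows "(\<lambda>f. C f i j) differentiable (at f)"
proof -
  have "smooth_on U (\<lambda>f. C f i j)"
    using conf assms by (auto simp: conformal_structure_def directed_edges_def)
  then have "C_k_on (Suc 0) U (\<lambda>f. C f i j)" unfolding smooth_on_def by blast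
  then show ?thesis using assms by simp
qed

lemma differentiable_length:
  assumes "f \<in> U" "{i, j} \<in> edges T"
  shows "(\<lambda>f. len f i j) differentiable (at f)"
  unfolding edge_length_def
  using differentiable_C[OF assms] differentiable_C[OF assms(1) edge_commute[OF assms(2)]]
  by (rule differentiable_add)

lemma partial_deriv_length:
  assumes "f \<in> U" "{i, j} \<in> edges T"
  shows "partial_deriv (\<lambda>f. len f i j) i f = C f i j"
    and "partial_deriv (\<lambda>f. len f i j) j f = C f j i"
proof -
  have "(i, j) \<in> directed_edges T" "(j, i) \<in> directed_edges T"
    using assms by (auto simp: directed_edges_def insert_commute)
  then have "partial_deriv (\<lambda>f. len f i j) i f = C f i j" "partial_deriv (\<lambda>f. len f j i) j f = C f j i"
    using conf assms by (auto simp: conformal_structure_def)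
  moreover have "(\<lambda>f. len f j i) = (\<lambda>f. len f i j)"
    by (simp add: edge_length_def add.commute)
  ultimately show "partial_deriv (\<lambda>f. len f i j) i f = C f i j"
    "partial_deriv (\<lambda>f. len f i j) j f = C f j i" by simp_all
qed

lemma partial_deriv_C_zero:
  assumes "f \<in> U" "{i, j} \<in> edges T" "k \<noteq> i" "k \<noteq> j"
  shows "partial_deriv (\<lambda>f. C f i j) k f = 0"
  using conf assms by (auto simp: conformal_structure_def directed_edges_def)

lemma partial_deriv_length_sum:
  assumes "f \<in> U" "{i, j} \<in> edges T"
  shows "partial_deriv (\<lambda>f. len f i j) k f
    = partial_deriv (\<lambda>f. C f i j) k f + partial_deriv (\<lambda>f. C f j i) k f"
proof -
  note D = differentiable_C[OF assms, unfolded frechet_derivative_works]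
    differentiable_C[OF assms(1) edge_commute[OF assms(2)], unfolded frechet_derivative_works]
  show ?thesis
    unfolding edge_length_def partial_deriv_eq[OF has_derivative_add[OF D]]
    by (simp add: partial_deriv_def)
qed

lemma has_derivative_length:
  assumes "f \<in> U" "{i, j} \<in> edges T"
  shows "((\<lambda>f. len f i j) has_derivative (\<lambda>h. C f i j * h $ i + C f j i * h $ j)) (at f)"
proof -
  have "partial_deriv (\<lambda>f. len f i j) k f = 0" if "k \<noteq> i" "k \<noteq> j" for k
    using partial_deriv_length_sum partial_deriv_C_zero edge_commute assms that by simp
  from has_derivative_two_partials[OF differentiable_length[OF assms] edge_distinct[OF assms(2)] this]
  show ?thesis using partial_deriv_length[OF assms] by simp
qed

text \<open>
  Both sides are mixed second partial derivatives of the length of \<open>{i, j}\<close>.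
\<close>

lemma q_commute:
  assumes "f \<in> U" "{i, j} \<in> edges T"
  shows "q f i j = q f j i"
  by (rule mixed_partials_commute[OF open_domain assms(1), of "\<lambda>f. len f i j"])
     (use assms edge_commute[OF assms(2)] in \<open>simp_all add: differentiable_length partial_deriv_length differentiable_C\<close>)

lemma has_derivative_C:
  assumes "f \<in> U" "{i, j} \<in> edges T"
  shows "((\<lambda>f. C f i j) has_derivative (\<lambda>h. C f i j * h $ i + q f i j * (h $ j - h $ i))) (at f)"
proof -
  have "partial_deriv (\<lambda>f. C f i j) i f = C f i j - q f i j"
    using partial_deriv_length_sum[OF assms, of i] partial_deriv_length[OF assms] q_commute[OF assms]
    by simp
  with has_derivative_two_partials[OF differentiable_C[OF assms] edge_distinct[OF assms(2)]
      partial_deriv_C_zero[OF assms]]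
  show ?thesis by (simp add: algebra_simps)
qed

end

context conformal
begin

text \<open>
  The vertex \<open>i\<close> itself contributes through the differences only, because the angles are invariant
  under rescaling.
\<close>

lemma has_derivative_face_angle:
  assumes f: "f \<in> U" and t: "{i, j, k} \<in> triangles T"
  shows "((\<lambda>f. face_angle (len f) i j k) has_derivative
      (\<lambda>h. height_edge (C f) i j k / len f i j * (h $ j - h $ i)
         + height_edge (C f) i k j / len f i k * (h $ k - h $ i))) (at f)"
proof -
  have ne: "i \<noteq> j" "i \<noteq> k" "j \<noteq> k" and tT: "{i, j, k} \<in> T"
    using t by (auto simp: triangles_def card_insert_if split: if_splits)
  have e: "{i, j} \<in> edges T" "{i, k} \<in> edges T" "{j, k} \<in> edges T"
    using tT ne complex by (auto simp: edges_def abstract_complex_def)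
  define F where "F g = cos_law (len g i j) (len g i k) (len g j k)" for g
  have rz: "\<exists>p. realizes (len g) {i, j, k} p" if "g \<in> U" for g
    using realizable[OF that tT] .
  have cos: "cos (face_angle (len g) i j k) = F g"
    and bounds: "0 < face_angle (len g) i j k \<and> face_angle (len g) i j k < pi" if g: "g \<in> U" for g
  proof -
    obtain p where "realizes (len g) {i, j, k} p" using rz[OF g] ..
    note * = cos_face_angle[OF this ne]
    show "cos (face_angle (len g) i j k) = F g" unfolding F_def by (rule *(1))
    show "0 < face_angle (len g) i j k \<and> face_angle (len g) i j k < pi" using *(2,3) ..
  qed
  have "(F has_derivative (\<lambda>h.
      (1 / len f i k - F f / len f i j) * (C f i j * h $ i + C f j i * h $ j)
      + (1 / len f i j - F f / len f i k) * (C f i k * h $ i + C f k i * h $ k)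
      - len f j k / (len f i j * len f i k) * (C f j k * h $ j + C f k j * h $ k))) (at f)"
    unfolding F_def
    by (rule has_derivative_cos_law) (use e f in \<open>auto intro: has_derivative_length edge_length_pos\<close>)
  note D = has_derivative_angle[OF this open_domain f]
  show ?thesis
  proof (rule has_derivative_eq_rhs[OF D[OF cos bounds]])
    have met: "(C f i j)\<^sup>2 + (C f j k)\<^sup>2 + (C f k i)\<^sup>2 = (C f j i)\<^sup>2 + (C f i k)\<^sup>2 + (C f k j)\<^sup>2"
      by (rule metric_identity[OF f t])
    have pos: "C f i j + C f j i > 0" "C f i k + C f k i > 0"
      using edge_length_pos[OF f e(1)] edge_length_pos[OF f e(2)] by (simp_all add: edge_length_def)
    have 1: "(F f / len f i j - 1 / len f i k) * C f j i
        + len f j k / (len f i j * len f i k) * C f j k = (C f i k - C f i j * F f) / len f i j"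
      using height_edge_identity[OF met pos] by (simp add: F_def edge_length_def)
    have "F f = cos_law (C f i k + C f k i) (C f i j + C f j i) (C f k j + C f j k)"
      by (simp add: F_def edge_length_def cos_law_def algebra_simps)
    from height_edge_identity[OF _ pos(2,1) this] met
    have 2: "(F f / len f i k - 1 / len f i j) * C f k i
        + len f j k / (len f i j * len f i k) * C f k j = (C f i j - C f i k * F f) / len f i k"
      by (simp add: edge_length_def ac_simps)
    show "(\<lambda>h. - ((1 / len f i k - F f / len f i j) * (C f i j * h $ i + C f j i * h $ j)
        + (1 / len f i j - F f / len f i k) * (C f i k * h $ i + C f k i * h $ k)
        - len f j k / (len f i j * len f i k) * (C f j k * h $ j + C f k j * h $ k))
        / sin (face_angle (len f) i j k))
      = (\<lambda>h. height_edge (C f) i j k / len f i j * (h $ j - h $ i)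
        + height_edge (C f) i k j / len f i k * (h $ k - h $ i))"
      unfolding face_rate_identity[OF 1 2]
      by (simp add: height_edge_def face_angle_commute cos[OF f] fun_eq_iff add_divide_distrib
          divide_divide_eq_left mult.commute)
  qed
qed

lemma tetrahedron_faces:
  assumes t: "{i, j, k, l} \<in> tetrahedra T"
  shows "distinct [i, j, k, l]" "{i, j, k, l} \<in> T"
    "{i, j, k} \<in> triangles T" "{i, j, l} \<in> triangles T" "{i, k, l} \<in> triangles T"
    "{i, j} \<in> edges T" "{i, k} \<in> edges T" "{i, l} \<in> edges T"
proof -
  show ne: "distinct [i, j, k, l]" and tT: "{i, j, k, l} \<in> T"
    using t by (auto simp: tetrahedra_def card_insert_if split: if_splits)
  have "\<tau> \<in> T" if "\<tau> \<subseteq> {i, j, k, l}" "\<tau> \<noteq> {}" for \<tau>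
    using complex tT that unfolding abstract_complex_def by blast
  then show "{i, j, k} \<in> triangles T" "{i, j, l} \<in> triangles T" "{i, k, l} \<in> triangles T"
    "{i, j} \<in> edges T" "{i, k} \<in> edges T" "{i, l} \<in> edges T"
    using ne by (auto simp: triangles_def edges_def)
qed

lemma has_derivative_dihedral_angle:
  assumes f: "f \<in> U" and t: "{i, j, k, l} \<in> tetrahedra T"
  shows "((\<lambda>f. dihedral_angle (len f) i j k l) has_derivative
      (\<lambda>h. axis_rate (C f) i j k l * (h $ j - h $ i)
         + hinge_rate (C f) i k j l * (h $ k - h $ i)
         + hinge_rate (C f) i l j k * (h $ l - h $ i))) (at f)"
proof -
  note faces = tetrahedron_faces[OF t]
  note ne = faces(1)
  have same: "{i, k, j, l} = {i, j, k, l}" "{i, l, j, k} = {i, j, k, l}" by auto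
  let ?a = "\<lambda>g. face_angle (len g) i k l" and ?b = "\<lambda>g. face_angle (len g) i j l"
    and ?c = "\<lambda>g. face_angle (len g) i j k"
  let ?A = "dihedral_angle (len f) i j k l" and ?B = "dihedral_angle (len f) i k j l"
    and ?C = "dihedral_angle (len f) i l j k"
  define F where "F g = (cos (?a g) - cos (?b g) * cos (?c g)) / (sin (?b g) * sin (?c g))" for g
  have rz: "\<exists>p. realizes (len g) {i, j, k, l} p" if "g \<in> U" for g
    using realizable[OF that faces(2)] .
  have cos: "cos (dihedral_angle (len g) i j k l) = F g"
    and bounds: "0 < dihedral_angle (len g) i j k l \<and> dihedral_angle (len g) i j k l < pi"
    if g: "g \<in> U" for g
  proof -
    obtain p where "realizes (len g) {i, j, k, l} p" using rz[OF g] ..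
    note * = cos_dihedral_angle[OF this ne]
    show "cos (dihedral_angle (len g) i j k l) = F g"
      unfolding F_def *(1) by (simp only: mult.commute)
    show "0 < dihedral_angle (len g) i j k l \<and> dihedral_angle (len g) i j k l < pi"
      using *(2,3) ..
  qed
  obtain p where p: "realizes (len f) {i, j, k, l} p" using rz[OF f] ..
  have sub: "realizes (len f) {i, k, l} p" "realizes (len f) {i, j, l} p" "realizes (len f) {i, j, k} p"
    by (rule realizes_subset[OF p], blast)+
  have s: "sin (?a f) > 0" "sin (?b f) > 0" "sin (?c f) > 0"
    using sin_face_angle_pos[OF sub(1)] sin_face_angle_pos[OF sub(2)] sin_face_angle_pos[OF sub(3)] ne
    by simp_all
  have S: "sin ?A > 0" "sin ?B > 0" "sin ?C > 0"
    using cos_dihedral_angle(2,3)[of "len f" i j k l p] cos_dihedral_angle(2,3)[of "len f" i k j l p]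
      cos_dihedral_angle(2,3)[of "len f" i l j k p] p ne unfolding same by (auto intro: sin_gt_zero)
  have cA: "cos ?A = (cos (?a f) - cos (?b f) * cos (?c f)) / (sin (?b f) * sin (?c f))"
    using cos[OF f] by (simp add: F_def)
  have cB: "cos ?B = (cos (?b f) - cos (?a f) * cos (?c f)) / (sin (?a f) * sin (?c f))"
    using cos_dihedral_angle(1)[of "len f" i k j l p] p ne unfolding same
    by (auto simp: face_angle_commute mult.commute)
  have cC: "cos ?C = (cos (?c f) - cos (?a f) * cos (?b f)) / (sin (?a f) * sin (?b f))"
    using cos_dihedral_angle(1)[of "len f" i l j k p] p ne unfolding same
    by (auto simp: face_angle_commute[of "len f" i k l] face_angle_commute[of "len f" i j l] mult.commute)
  have pos: "len f i j > 0" "len f i k > 0" "len f i l > 0"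
    using edge_length_pos[OF f] faces by blast+
  note da = has_derivative_face_angle[OF f]
  have "(F has_derivative (\<lambda>h. - (sin (?a f) *
      (height_edge (C f) i k l / len f i k * (h $ k - h $ i)
        + height_edge (C f) i l k / len f i l * (h $ l - h $ i))
      - (sin (?b f) * cos (?c f) - cos ?A * cos (?b f) * sin (?c f)) *
      (height_edge (C f) i j l / len f i j * (h $ j - h $ i)
        + height_edge (C f) i l j / len f i l * (h $ l - h $ i))
      - (cos (?b f) * sin (?c f) - cos ?A * sin (?b f) * cos (?c f)) *
      (height_edge (C f) i j k / len f i j * (h $ j - h $ i)
        + height_edge (C f) i k j / len f i k * (h $ k - h $ i)))
      / (sin (?b f) * sin (?c f)))) (at f)"
    unfolding F_def
    by (rule has_derivative_spherical_cos_law[OF da[OF faces(5)] da[OF faces(4)] da[OF faces(3)] s(2,3) cA])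
  note D = has_derivative_angle[OF this open_domain f]
  show ?thesis
  proof (rule has_derivative_eq_rhs[OF D[OF cos bounds]], goal_cases)
    case 3
    show ?case
      unfolding minus_divide_left[symmetric] minus_minus dihedral_rate_identity[OF s S cA cB cC pos]
        axis_rate_def hinge_rate_def height_face_def Let_def dihedral_angle_commute[of "len f" i j l k]
        face_angle_commute[of "len f" i k j] face_angle_commute[of "len f" i l j] ..
  qed
qed

end

section \<open>Gradient and Hessian of the Einstein-Hilbert-Regge functional\<close>

text \<open>
  By the compatibility condition, the perpendiculars erected on the edges of a triangle at the points that
  divide them into \<open>d\<^sub>i\<^sub>j\<close> and \<open>d\<^sub>j\<^sub>i\<close> meet in one point. The height is its signed distance from
  the edge, whichever end point is used to compute it. In formulas: multiplied by the two adjacent lengths,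
  the sines at \<open>i\<close> and \<open>j\<close> both become twice the area of the triangle, and the numerators agree.
\<close>

lemma height_edge_commute_triangle:
  assumes p: "realizes (edge_length d) {i, j, k} p" and ne: "i \<noteq> j" "i \<noteq> k" "j \<noteq> k"
    and met: "(d i j)\<^sup>2 + (d j k)\<^sup>2 + (d k i)\<^sup>2 = (d j i)\<^sup>2 + (d i k)\<^sup>2 + (d k j)\<^sup>2"
  shows "height_edge d j i k = height_edge d i j k"
proof -
  let ?L = "edge_length d"
  let ?\<gamma> = "face_angle ?L i j k" and ?\<delta> = "face_angle ?L j i k"
  define a b c where "a = ?L i j" and "b = ?L i k" and "c = ?L j k"
  have p': "realizes ?L {j, i, k} p" using p by (simp add: insert_commute)
  have pos: "a > 0" "b > 0" "c > 0"
    using realizes_length(1)[OF p] ne by (auto simp: a_def b_def c_def)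
  have ji: "?L j i = a" by (simp add: a_def edge_length_def)
  have cos: "2 * (cos ?\<gamma> * a * b) = a\<^sup>2 + b\<^sup>2 - c\<^sup>2" "2 * (cos ?\<delta> * a * c) = a\<^sup>2 + c\<^sup>2 - b\<^sup>2"
    using cos_face_angle(1)[OF p ne] cos_face_angle(1)[OF p' ne(1)[symmetric] ne(3,2)] pos
    by (simp_all add: cos_law_def a_def[symmetric] b_def[symmetric] c_def[symmetric] ji)
  have sin: "sin ?\<gamma> > 0" "sin ?\<delta> > 0"
    using sin_face_angle_pos[OF p ne] sin_face_angle_pos[OF p' ne(1)[symmetric] ne(3,2)] .
  have "4 * (sin ?\<gamma> * a * b)\<^sup>2 = 4 * (a * b)\<^sup>2 - (2 * (cos ?\<gamma> * a * b))\<^sup>2"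
    by (simp add: power_mult_distrib sin_squared_eq algebra_simps)
  also have "\<dots> = 4 * (a * c)\<^sup>2 - (2 * (cos ?\<delta> * a * c))\<^sup>2"
    unfolding cos by algebra
  also have "\<dots> = 4 * (sin ?\<delta> * a * c)\<^sup>2"
    by (simp add: power_mult_distrib sin_squared_eq algebra_simps)
  finally have "(sin ?\<gamma> * a * b)\<^sup>2 = (sin ?\<delta> * a * c)\<^sup>2" by simp
  then have S: "sin ?\<gamma> * a * b = sin ?\<delta> * a * c"
    using sin pos by (simp add: power2_eq_iff_nonneg)
  have L: "a = d i j + d j i" "b = d i k + d k i" "c = d j k + d k j"
    by (simp_all add: a_def b_def c_def edge_length_def)
  \<comment> \<open>The two numerators, multiplied by the adjacent lengths, agree by the compatibility condition.\<close>
  have "2 * ((d i k - d i j * cos ?\<gamma>) * (a * b)) = 2 * (a * b * d i k) - d i j * (2 * (cos ?\<gamma> * a * b))"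
    by (simp add: algebra_simps)
  also have "\<dots> = 2 * (a * c * d j k) - d j i * (2 * (cos ?\<delta> * a * c))"
  proof -
    have "2 * (b * d i k) - 2 * (c * d j k) - (d i j - d j i) * a - (b\<^sup>2 - c\<^sup>2) = 0"
      using met unfolding L by algebra
    then have "a * (2 * (b * d i k) - 2 * (c * d j k) - (d i j - d j i) * a - (b\<^sup>2 - c\<^sup>2)) = 0" by simp
    then have "2 * (a * b * d i k) - 2 * (a * c * d j k) - (d i j - d j i) * a\<^sup>2
        - (d i j + d j i) * (b\<^sup>2 - c\<^sup>2) = 0"
      unfolding L(1)[symmetric] by (simp add: algebra_simps power2_eq_square)
    then show ?thesis unfolding cos by (simp add: algebra_simps)
  qed
  also have "\<dots> = 2 * ((d j k - d j i * cos ?\<delta>) * (a * c))" by (simp add: algebra_simps)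
  finally have N: "(d i k - d i j * cos ?\<gamma>) * (a * b) = (d j k - d j i * cos ?\<delta>) * (a * c)" by simp
  have "height_edge d i j k = (d i k - d i j * cos ?\<gamma>) * (a * b) / (sin ?\<gamma> * a * b)"
    using pos by (simp add: height_edge_def Let_def)
  also have "\<dots> = (d j k - d j i * cos ?\<delta>) * (a * c) / (sin ?\<delta> * a * c)" unfolding N S ..
  also have "\<dots> = height_edge d j i k" using pos by (simp add: height_edge_def Let_def)
  finally show ?thesis ..
qed

text \<open>
  The origin of the dual area: it is, up to the factor \<open>2 / \<ell>\<^sub>i\<^sub>j\<close>, the total rate of the dihedral
  angles at the edges \<open>{i, j}\<close>, \<open>{i, k}\<close>, \<open>{i, l}\<close> under a variation at \<open>j\<close>, each weighted with
  the part of the edge at \<open>i\<close>.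
\<close>

lemma dual_area_rate:
  "d i j * axis_rate d i j k l + d i k * hinge_rate d i j k l + d i l * hinge_rate d i j l k
    = 2 * dual_area d i j k l / edge_length d i j"
proof -
  let ?\<gamma> = "face_angle (edge_length d) i j k" and ?\<delta> = "face_angle (edge_length d) i j l"
  have e: "height_edge d i j k = d i k / sin ?\<gamma> - d i j * cot ?\<gamma>"
    "height_edge d i j l = d i l / sin ?\<delta> - d i j * cot ?\<delta>"
    by (simp_all add: height_edge_def Let_def cot_def diff_divide_distrib)
  have "2 * dual_area d i j k l = d i j * - (height_face d i j k l * cot ?\<gamma> + height_face d i j l k * cot ?\<delta>)
      + d i k * (height_face d i j k l / sin ?\<gamma>) + d i l * (height_face d i j l k / sin ?\<delta>)"
    unfolding dual_area_def e by (simp add: algebra_simps)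
  then show ?thesis
    by (simp add: axis_rate_def hinge_rate_def add_divide_distrib mult.commute)
qed

lemma sum_tetrahedra_eq:
  "sum_tetrahedra T i j F = 1 / 2 * (\<Sum>(k, l) | k \<noteq> l \<and> {i, j, k, l} \<in> tetrahedra T. F k l)"
proof -
  have "{i, j} \<union> {k, l} = {i, j, k, l}" for k l by auto
  then show ?thesis by (simp only: sum_tetrahedra_def pair_sum_def)
qed

lemma cone_deficit_commute: "cone_deficit T L j i = cone_deficit T L i j"
proof -
  have "{j, i, k, l} = {i, j, k, l}" for k l by auto
  then show ?thesis
    by (simp only: cone_deficit_def sum_tetrahedra_eq dihedral_angle_reverse[of L j i])
qed

text \<open>
  The curvature of an edge is shared between its end points according to
  \<open>\<ell>\<^sub>i\<^sub>j = d\<^sub>i\<^sub>j + d\<^sub>j\<^sub>i\<close>.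
\<close>

lemma EHR_eq_sum_scalar_curvature: "EHR T (edge_length d) = (\<Sum>i\<in>UNIV. scalar_curvature T d i)"
proof -
  let ?L = "edge_length d"
  let ?E = "{(i, j). {i, j} \<in> edges T}"
  have "(\<Sum>i\<in>UNIV. scalar_curvature T d i)
      = (\<Sum>(i, j)\<in>?E. cone_deficit T ?L i j * d i j)"
  proof -
    have "?E = Sigma UNIV (\<lambda>i. {j. {i, j} \<in> edges T})" by auto
    then show ?thesis unfolding scalar_curvature_def by (simp add: sum.Sigma)
  qed
  moreover have "(\<Sum>(i, j)\<in>?E. cone_deficit T ?L i j * d i j)
      = (\<Sum>(i, j)\<in>?E. cone_deficit T ?L i j * d j i)"
    by (rule sum.reindex_bij_witness[of _ prod.swap prod.swap])
       (auto simp: insert_commute cone_deficit_commute)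
  moreover have "EHR T ?L = 1 / 2 * (\<Sum>(i, j)\<in>?E. cone_deficit T ?L i j * d i j + cone_deficit T ?L i j * d j i)"
  proof -
    have "{(i, j). i \<noteq> j \<and> {i, j} \<in> edges T} = ?E" by (auto simp: edges_def)
    then show ?thesis
      by (simp add: EHR_def sum_edges_def pair_sum_def edge_curvature_def edge_length_def distrib_left)
  qed
  ultimately show ?thesis
    by (simp add: sum.distrib case_prod_unfold)
qed

lemma sum_edges_tetrahedra:
  fixes F :: "'v::finite \<Rightarrow> 'v \<Rightarrow> 'v \<Rightarrow> real"
  assumes "abstract_complex T"
  shows "(\<Sum>j | {i, j} \<in> edges T. \<Sum>(k, l) | k \<noteq> l \<and> {i, j, k, l} \<in> tetrahedra T. F j k l)
    = (\<Sum>(j, k, l) | {i, j, k, l} \<in> tetrahedra T. F j k l)"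
proof -
  have "{i, j} \<in> edges T \<and> k \<noteq> l" if "{i, j, k, l} \<in> tetrahedra T" for j k l
  proof -
    have ne: "i \<noteq> j" "k \<noteq> l"
      using that by (auto simp: tetrahedra_def card_insert_if split: if_splits)
    have "{i, j, k, l} \<in> T" using that by (simp add: tetrahedra_def)
    moreover have "{i, j} \<subseteq> {i, j, k, l}" "{i, j} \<noteq> {}" by auto
    ultimately have "{i, j} \<in> T" using assms unfolding abstract_complex_def by metis
    then show ?thesis using ne by (simp add: edges_def)
  qed
  then have "{(j, k, l). {i, j, k, l} \<in> tetrahedra T}
      = Sigma {j. {i, j} \<in> edges T} (\<lambda>j. {(k, l). k \<noteq> l \<and> {i, j, k, l} \<in> tetrahedra T})"
    by auto
  then show ?thesis by (simp add: sum.Sigma)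
qed

text \<open>
  A graph Laplacian with symmetric weights has column sums zero, and its quadratic form is half the
  weighted sum of the squared differences.
\<close>

lemma sum_edges_symmetric:
  fixes c :: "'v::finite \<Rightarrow> 'v \<Rightarrow> real"
  assumes "\<And>i j. (i, j) \<in> directed_edges T \<Longrightarrow> c j i = c i j"
  shows "(\<Sum>(i, j)\<in>directed_edges T. c i j * (v j - v i)) = 0"
    and "(\<Sum>(i, j)\<in>directed_edges T. v i * (c i j * (v j - v i)))
      = - (1 / 2) * (\<Sum>(i, j)\<in>directed_edges T. c i j * (v i - v j)\<^sup>2)"
proof -
  have swap: "(\<Sum>(i, j)\<in>directed_edges T. G i j) = (\<Sum>(i, j)\<in>directed_edges T. G j i)"
    for G :: "'v \<Rightarrow> 'v \<Rightarrow> real"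
    by (rule sum.reindex_bij_witness[of _ prod.swap prod.swap])
       (auto simp: directed_edges_def insert_commute)
  have "(\<Sum>(i, j)\<in>directed_edges T. c i j * (v j - v i)) = (\<Sum>(i, j)\<in>directed_edges T. - (c i j * (v j - v i)))"
    by (subst swap) (auto intro!: sum.cong simp: assms algebra_simps)
  then show "(\<Sum>(i, j)\<in>directed_edges T. c i j * (v j - v i)) = 0"
    by (simp add: sum_negf case_prod_unfold)
  have "(\<Sum>(i, j)\<in>directed_edges T. v i * (c i j * (v j - v i)))
      = (\<Sum>(i, j)\<in>directed_edges T. v j * (c i j * (v i - v j)))"
    by (subst swap) (auto intro!: sum.cong simp: assms)
  moreover have "(\<Sum>(i, j)\<in>directed_edges T. v i * (c i j * (v j - v i)))
      + (\<Sum>(i, j)\<in>directed_edges T. v j * (c i j * (v i - v j)))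
      = - (\<Sum>(i, j)\<in>directed_edges T. c i j * (v i - v j)\<^sup>2)"
    unfolding sum.distrib[symmetric] sum_negf[symmetric]
    by (rule sum.cong) (auto simp: algebra_simps power2_eq_square)
  ultimately show "(\<Sum>(i, j)\<in>directed_edges T. v i * (c i j * (v j - v i)))
      = - (1 / 2) * (\<Sum>(i, j)\<in>directed_edges T. c i j * (v i - v j)\<^sup>2)"
    by simp
qed

context conformal
begin

lemma height_edge_commute:
  assumes "f \<in> U" "{i, j, k} \<in> triangles T"
  shows "height_edge (C f) j i k = height_edge (C f) i j k"
proof -
  have ne: "i \<noteq> j" "i \<noteq> k" "j \<noteq> k" and "{i, j, k} \<in> T"
    using assms(2) by (auto simp: triangles_def card_insert_if split: if_splits)
  then obtain p where "realizes (len f) {i, j, k} p" using realizable[OF assms(1)] by blast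
  from height_edge_commute_triangle[OF this ne metric_identity[OF assms]] show ?thesis .
qed

lemma dual_area_commute:
  assumes f: "f \<in> U" and t: "{i, j, k, l} \<in> tetrahedra T"
  shows "dual_area (C f) j i k l = dual_area (C f) i j k l"
  using height_edge_commute[OF f tetrahedron_faces(3)[OF t]]
    height_edge_commute[OF f tetrahedron_faces(4)[OF t]]
  by (simp add: dual_area_def height_face_def dihedral_angle_reverse)

lemma dual_length_commute:
  assumes f: "f \<in> U"
  shows "dual_length T (C f) j i = dual_length T (C f) i j"
proof -
  have "{j, i, k, l} = {i, j, k, l}" for k l by auto
  then show ?thesis
    unfolding dual_length_def sum_tetrahedra_eq
    by (auto intro!: sum.cong dual_area_commute[OF f])
qed

text \<open>
  Relabelling the vertices other than \<open>i\<close> collects the terms caused by the same vertex, to which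
  \<open>dual_area_rate\<close> applies.
\<close>

lemma sum_tetrahedra_rates:
  assumes f: "f \<in> U"
  shows "(\<Sum>(j, k, l) | {i, j, k, l} \<in> tetrahedra T. C f i j *
      (axis_rate (C f) i j k l * (h $ j - h $ i)
         + hinge_rate (C f) i k j l * (h $ k - h $ i)
         + hinge_rate (C f) i l j k * (h $ l - h $ i)))
    = (\<Sum>(j, k, l) | {i, j, k, l} \<in> tetrahedra T. 2 * dual_area (C f) i j k l / len f i j * (h $ j - h $ i))"
    (is "?lhs = _")
proof -
  let ?X = "{(j, k, l). {i, j, k, l} \<in> tetrahedra T}"
  have "?lhs = (\<Sum>(j, k, l)\<in>?X. C f i j * axis_rate (C f) i j k l * (h $ j - h $ i))
      + (\<Sum>(j, k, l)\<in>?X. C f i j * hinge_rate (C f) i k j l * (h $ k - h $ i))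
      + (\<Sum>(j, k, l)\<in>?X. C f i j * hinge_rate (C f) i l j k * (h $ l - h $ i))"
    unfolding sum.distrib[symmetric] by (rule sum.cong) (auto simp: algebra_simps)
  also have "(\<Sum>(j, k, l)\<in>?X. C f i j * hinge_rate (C f) i k j l * (h $ k - h $ i))
      = (\<Sum>(j, k, l)\<in>?X. C f i k * hinge_rate (C f) i j k l * (h $ j - h $ i))"
    by (rule sum.reindex_bij_witness[of _ "\<lambda>(j, k, l). (k, j, l)" "\<lambda>(j, k, l). (k, j, l)"])
       (auto simp: insert_commute)
  also have "(\<Sum>(j, k, l)\<in>?X. C f i j * hinge_rate (C f) i l j k * (h $ l - h $ i))
      = (\<Sum>(j, k, l)\<in>?X. C f i l * hinge_rate (C f) i j l k * (h $ j - h $ i))"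
    by (rule sum.reindex_bij_witness[of _ "\<lambda>(j, k, l). (l, k, j)" "\<lambda>(j, k, l). (l, k, j)"])
       (auto simp: insert_commute)
  also have "(\<Sum>(j, k, l)\<in>?X. C f i j * axis_rate (C f) i j k l * (h $ j - h $ i))
      + (\<Sum>(j, k, l)\<in>?X. C f i k * hinge_rate (C f) i j k l * (h $ j - h $ i))
      + (\<Sum>(j, k, l)\<in>?X. C f i l * hinge_rate (C f) i j l k * (h $ j - h $ i))
      = (\<Sum>(j, k, l)\<in>?X. 2 * dual_area (C f) i j k l / len f i j * (h $ j - h $ i))"
    unfolding sum.distrib[symmetric] dual_area_rate[symmetric]
    by (rule sum.cong) (auto simp: algebra_simps)
  finally show ?thesis .
qed

text \<open>
  Up to sign, the off-diagonal entries of the Hessian.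
\<close>

definition weight :: "real ^ 'v \<Rightarrow> 'v \<Rightarrow> 'v \<Rightarrow> real" where
  "weight f i j = 2 * dual_length T (C f) i j / len f i j - q f i j * cone_deficit T (len f) i j"

lemma weight_commute:
  "f \<in> U \<Longrightarrow> (i, j) \<in> directed_edges T \<Longrightarrow> weight f j i = weight f i j"
  using dual_length_commute[of f j i] q_commute[of f i j] cone_deficit_commute[of T "len f" j i]
    edge_length_commute[of f i j]
  by (simp add: weight_def directed_edges_def)

lemma has_derivative_cone_deficit:
  assumes f: "f \<in> U"
  shows "((\<lambda>f. cone_deficit T (len f) i j) has_derivative
      (\<lambda>h. - (1 / 2) * (\<Sum>(k, l) | k \<noteq> l \<and> {i, j, k, l} \<in> tetrahedra T.
         axis_rate (C f) i j k l * (h $ j - h $ i)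
         + hinge_rate (C f) i k j l * (h $ k - h $ i)
         + hinge_rate (C f) i l j k * (h $ l - h $ i)))) (at f)"
proof -
  have "((\<lambda>f. \<Sum>x | fst x \<noteq> snd x \<and> {i, j, fst x, snd x} \<in> tetrahedra T.
        dihedral_angle (len f) i j (fst x) (snd x)) has_derivative
      (\<lambda>h. \<Sum>x | fst x \<noteq> snd x \<and> {i, j, fst x, snd x} \<in> tetrahedra T.
         axis_rate (C f) i j (fst x) (snd x) * (h $ j - h $ i)
         + hinge_rate (C f) i (fst x) j (snd x) * (h $ fst x - h $ i)
         + hinge_rate (C f) i (snd x) j (fst x) * (h $ snd x - h $ i))) (at f)"
    by (rule has_derivative_sum, rule has_derivative_dihedral_angle[OF f]) simp
  then have "((\<lambda>f. 2 * pi - 1 / 2 * (\<Sum>x | fst x \<noteq> snd x \<and> {i, j, fst x, snd x} \<in> tetrahedra T.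
        dihedral_angle (len f) i j (fst x) (snd x))) has_derivative
      (\<lambda>h. 0 - 1 / 2 * (\<Sum>x | fst x \<noteq> snd x \<and> {i, j, fst x, snd x} \<in> tetrahedra T.
         axis_rate (C f) i j (fst x) (snd x) * (h $ j - h $ i)
         + hinge_rate (C f) i (fst x) j (snd x) * (h $ fst x - h $ i)
         + hinge_rate (C f) i (snd x) j (fst x) * (h $ snd x - h $ i)))) (at f)"
    by (intro has_derivative_diff has_derivative_const has_derivative_mult_right)
  then show ?thesis
    unfolding cone_deficit_def sum_tetrahedra_eq
    by (simp add: case_prod_unfold)
qed

lemma has_derivative_scalar_curvature:
  assumes f: "f \<in> U"
  shows "((\<lambda>f. scalar_curvature T (C f) i) has_derivative
      (\<lambda>h. scalar_curvature T (C f) i * h $ i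
         - (\<Sum>j | {i, j} \<in> edges T. weight f i j * (h $ j - h $ i)))) (at f)"
proof -
  let ?D = "\<lambda>j. cone_deficit T (len f) i j"
  let ?R = "\<lambda>h j k l. axis_rate (C f) i j k l * (h $ j - h $ i)
         + hinge_rate (C f) i k j l * (h $ k - h $ i)
         + hinge_rate (C f) i l j k * (h $ l - h $ i)"
  let ?S = "\<lambda>j. {(k, l). k \<noteq> l \<and> {i, j, k, l} \<in> tetrahedra T}"
  have D: "((\<lambda>f. scalar_curvature T (C f) i) has_derivative
      (\<lambda>h. \<Sum>j | {i, j} \<in> edges T. ?D j * (C f i j * h $ i + q f i j * (h $ j - h $ i))
         + - (1 / 2) * (\<Sum>(k, l)\<in>?S j. ?R h j k l) * C f i j)) (at f)"
    unfolding scalar_curvature_def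
    by (rule has_derivative_sum, rule has_derivative_mult[OF has_derivative_cone_deficit[OF f] has_derivative_C[OF f]])
       simp
  have "(\<Sum>j | {i, j} \<in> edges T. ?D j * (C f i j * h $ i + q f i j * (h $ j - h $ i))
         + - (1 / 2) * (\<Sum>(k, l)\<in>?S j. ?R h j k l) * C f i j)
      = scalar_curvature T (C f) i * h $ i
         - (\<Sum>j | {i, j} \<in> edges T. weight f i j * (h $ j - h $ i))" for h
  proof -
    have "(\<Sum>j | {i, j} \<in> edges T. (\<Sum>(k, l)\<in>?S j. ?R h j k l) * C f i j)
        = (\<Sum>j | {i, j} \<in> edges T. \<Sum>(k, l)\<in>?S j. C f i j * ?R h j k l)"
      by (simp add: sum_distrib_left case_prod_unfold mult.commute)
    also have "\<dots> = (\<Sum>(j, k, l) | {i, j, k, l} \<in> tetrahedra T. C f i j * ?R h j k l)"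
      by (rule sum_edges_tetrahedra[OF complex])
    also have "\<dots> = (\<Sum>(j, k, l) | {i, j, k, l} \<in> tetrahedra T.
        2 * dual_area (C f) i j k l / len f i j * (h $ j - h $ i))"
      by (rule sum_tetrahedra_rates[OF f])
    also have "\<dots> = (\<Sum>j | {i, j} \<in> edges T. \<Sum>(k, l)\<in>?S j.
        2 * dual_area (C f) i j k l / len f i j * (h $ j - h $ i))"
      by (rule sum_edges_tetrahedra[OF complex, symmetric])
    also have "\<dots> = (\<Sum>j | {i, j} \<in> edges T. 2 * (2 * dual_length T (C f) i j / len f i j * (h $ j - h $ i)))"
      by (simp add: dual_length_def sum_tetrahedra_eq sum_distrib_left
          sum_distrib_right sum_divide_distrib case_prod_unfold mult_ac)
    finally have *: "(\<Sum>j | {i, j} \<in> edges T. (\<Sum>(k, l)\<in>?S j. ?R h j k l) * C f i j)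
        = (\<Sum>j | {i, j} \<in> edges T. 2 * (2 * dual_length T (C f) i j / len f i j * (h $ j - h $ i)))" .
    have split: "(\<Sum>j\<in>X. A j + - (1 / 2) * S j * B j) = (\<Sum>j\<in>X. A j) - 1 / 2 * (\<Sum>j\<in>X. S j * B j)"
      for A B S :: "'v \<Rightarrow> real" and X
      by (simp add: sum.distrib sum_subtractf sum_negf sum_divide_distrib)
    have pointwise: "D * (c * x + q * y) - 1 / 2 * (2 * (w * y)) = D * c * x - (w - q * D) * y"
      for D c x q y w :: real
      by (simp add: algebra_simps)
    show ?thesis
      unfolding split * scalar_curvature_def
      unfolding weight_def sum_distrib_left sum_distrib_right sum_subtractf[symmetric]
      by (rule sum.cong[OF refl], rule pointwise)
  qed
  then show ?thesis by (intro has_derivative_eq_rhs[OF D] ext)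
qed

lemma sum_directed_edges:
  "(\<Sum>i\<in>UNIV. \<Sum>j | {i, j} \<in> edges T. F i j) = (\<Sum>(i, j)\<in>directed_edges T. F i j)"
proof -
  have "directed_edges T = Sigma UNIV (\<lambda>i. {j. {i, j} \<in> edges T})"
    by (auto simp: directed_edges_def)
  then show ?thesis by (simp add: sum.Sigma)
qed

text \<open>
  The Laplacian parts of the derivatives of the scalar curvatures cancel in the sum over all vertices.
  This takes the place of the Schlaefli formula \<open>\<Sum> \<ell> \<delta>\<beta> = 0\<close>.
\<close>

lemma has_derivative_EHR:
  assumes f: "f \<in> U"
  shows "((\<lambda>f. EHR T (len f)) has_derivative
      (\<lambda>h. (\<chi> i. scalar_curvature T (C f) i) \<bullet> h)) (at f)"
proof -
  have "((\<lambda>f. EHR T (len f)) has_derivative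
      (\<lambda>h. \<Sum>i\<in>UNIV. scalar_curvature T (C f) i * h $ i
         - (\<Sum>j | {i, j} \<in> edges T. weight f i j * (h $ j - h $ i)))) (at f)"
    unfolding EHR_eq_sum_scalar_curvature
    by (rule has_derivative_sum, rule has_derivative_scalar_curvature[OF f])
  moreover have "(\<Sum>i\<in>UNIV. scalar_curvature T (C f) i * h $ i
         - (\<Sum>j | {i, j} \<in> edges T. weight f i j * (h $ j - h $ i)))
      = (\<chi> i. scalar_curvature T (C f) i) \<bullet> h" for h
    using sum_edges_symmetric(1)[of T "weight f" "\<lambda>i. h $ i", OF weight_commute[OF f]]
    by (simp add: sum_subtractf sum_directed_edges inner_vec_def)
  ultimately show ?thesis by simp
qed

text \<open>
  Positivity of the weights is required only of the form they define, as single weights of a sphere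
  packing can be negative.
\<close>

lemma hessian_EHR_positive_semidefinite:
  assumes f: "f \<in> U"
    and K: "\<And>i. scalar_curvature T (C f) i \<ge> 0"
    and W: "\<And>v. (\<Sum>(i, j)\<in>directed_edges T. weight f i j * (v $ i - v $ j)\<^sup>2) \<ge> 0"
  shows "\<exists>H. has_hessian (\<lambda>f. EHR T (len f)) H f \<and> positive_semidefinite H"
proof -
  define G where "G f = (\<chi> i. scalar_curvature T (C f) i)" for f
  define G' :: "real ^ 'v \<Rightarrow> real ^ 'v" where
    "G' h = (\<chi> i. scalar_curvature T (C f) i * h $ i
         - (\<Sum>j | {i, j} \<in> edges T. weight f i j * (h $ j - h $ i)))" for h
  have G': "(G has_derivative G') (at f)"
    unfolding G_def G'_def
    by (subst has_derivative_componentwise_within)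
       (auto simp: Basis_vec_def inner_axis intro!: has_derivative_scalar_curvature[OF f])
  have H: "matrix G' *v h = G' h" for h
    using matrix_vector_mul(2)[OF has_derivative_linear[OF G']] by (rule fun_cong)
  have "has_hessian (\<lambda>f. EHR T (len f)) (matrix G') f"
    unfolding has_hessian_def
  proof (intro exI[of _ G] conjI)
    show "\<forall>\<^sub>F y in nhds f. ((\<lambda>f. EHR T (len f)) has_derivative (\<lambda>h. G y \<bullet> h)) (at y)"
      unfolding eventually_nhds G_def using open_domain f has_derivative_EHR by blast
    show "(G has_derivative (\<lambda>h. matrix G' *v h)) (at f)" unfolding H by (rule G')
  qed
  moreover have "0 \<le> v \<bullet> (matrix G' *v v)" for v
  proof -
    have "v \<bullet> (matrix G' *v v) = (\<Sum>i\<in>UNIV. scalar_curvature T (C f) i * (v $ i)\<^sup>2)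
        - (\<Sum>i\<in>UNIV. \<Sum>j | {i, j} \<in> edges T. v $ i * (weight f i j * (v $ j - v $ i)))"
      unfolding H by (simp add: inner_vec_def G'_def right_diff_distrib sum_subtractf
          sum_distrib_left power2_eq_square mult_ac)
    also have "\<dots> = (\<Sum>i\<in>UNIV. scalar_curvature T (C f) i * (v $ i)\<^sup>2)
        + 1 / 2 * (\<Sum>(i, j)\<in>directed_edges T. weight f i j * (v $ i - v $ j)\<^sup>2)"
      unfolding sum_directed_edges
      using sum_edges_symmetric(2)[of T "weight f" "\<lambda>i. v $ i", OF weight_commute[OF f]] by simp
    also have "\<dots> \<ge> 0"
      using K W[of v] by (intro add_nonneg_nonneg sum_nonneg) auto
    finally show ?thesis .
  qed
  ultimately show ?thesis unfolding positive_semidefinite_def by blast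
qed

lemma hessian_EHR_positive_dual_lengths:
  assumes f: "f \<in> U"
    and K: "\<And>i. scalar_curvature T (C f) i \<ge> 0"
    and pos: "\<And>i j. (i, j) \<in> directed_edges T \<Longrightarrow>
      dual_length T (C f) i j - 1 / 2 * q f i j * edge_curvature T (len f) i j > 0"
  shows "\<exists>H. has_hessian (\<lambda>f. EHR T (len f)) H f \<and> positive_semidefinite H"
proof (rule hessian_EHR_positive_semidefinite[OF f K])
  have "weight f i j \<ge> 0" if "(i, j) \<in> directed_edges T" for i j
  proof -
    have l: "len f i j > 0" using edge_length_pos[OF f] that by (simp add: directed_edges_def)
    have "weight f i j = 2 * (dual_length T (C f) i j - 1 / 2 * q f i j * edge_curvature T (len f) i j) / len f i j"
      using l by (simp add: weight_def edge_curvature_def diff_divide_distrib)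
    then show ?thesis using pos[OF that] l by simp
  qed
  then show "(\<Sum>(i, j)\<in>directed_edges T. weight f i j * (v $ i - v $ j)\<^sup>2) \<ge> 0" for v
    by (intro sum_nonneg) auto
qed

end

section \<open>A quadratic form attached to four mutually tangent spheres\<close>

text \<open>
  The quadratic form of Descartes' circle theorem. For the inverse radii of four mutually tangent
  spheres it is positive exactly if their centres span a tetrahedron.
\<close>

definition descartes :: "real \<Rightarrow> real \<Rightarrow> real \<Rightarrow> real \<Rightarrow> real" where
  "descartes a b c d = (a + b + c + d)\<^sup>2 - 2 * (a\<^sup>2 + b\<^sup>2 + c\<^sup>2 + d\<^sup>2)"

text \<open>
  For three mutually tangent spheres with inverse radii \<open>a\<close>, \<open>b\<close>, \<open>c\<close> this is \<open>1 / \<rho>\<^sup>2\<close>, where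
  \<open>\<rho>\<close> is the inradius of the triangle of their centres.
\<close>

definition inv_inradius_sq :: "real \<Rightarrow> real \<Rightarrow> real \<Rightarrow> real" where
  "inv_inradius_sq a b c = a * b + b * c + c * a"

lemma inv_inradius_sq_pos: "a > 0 \<Longrightarrow> b > 0 \<Longrightarrow> c > 0 \<Longrightarrow> inv_inradius_sq a b c > 0"
  by (simp add: inv_inradius_sq_def add_pos_pos)

text \<open>
  With \<open>m\<^sub>i\<close> the product of \<open>x\<^sub>i\<close> and the value of \<open>inv_inradius_sq\<close> on the other three, the left
  side is \<open>\<Sum>\<^sub>i m\<^sub>i \<Prod>\<^sub>j\<^sub>\<noteq>\<^sub>i y\<^sub>j\<close>. Its factorisation shows that it is nonnegative for nondegenerate
  tetrahedra, even though one of the \<open>y\<^sub>i\<close> may be negative.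
\<close>

lemma mixed_sum_identity:
  fixes x1 x2 x3 x4 :: real
  defines "y1 \<equiv> x2 + x3 + x4 - x1" and "y2 \<equiv> x1 + x3 + x4 - x2"
    and "y3 \<equiv> x1 + x2 + x4 - x3" and "y4 \<equiv> x1 + x2 + x3 - x4"
  shows "x1 * inv_inradius_sq x2 x3 x4 * (y2 * y3 * y4) + x2 * inv_inradius_sq x1 x3 x4 * (y1 * y3 * y4)
      + x3 * inv_inradius_sq x1 x2 x4 * (y1 * y2 * y4) + x4 * inv_inradius_sq x1 x2 x3 * (y1 * y2 * y3)
    = descartes x1 x2 x3 x4
      * (x1 * x1 * (x2 * x4 + x3 * x4 + x2 * x3) + x2 * x2 * (x1 * x4 + x3 * x4 + x1 * x3)
        + x3 * x3 * (x1 * x4 + x2 * x4 + x1 * x2) + x4 * x4 * (x1 * x2 + x1 * x3 + x2 * x3))"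
  unfolding y1_def y2_def y3_def y4_def inv_inradius_sq_def descartes_def by algebra

text \<open>
  A complete graph with weights \<open>t\<^sub>i t\<^sub>j\<close> yields the variance form
  \<open>\<Sum>t \<Sum>t v\<^sup>2 - (\<Sum>t v)\<^sup>2\<close>, here with the value at the fourth vertex normalised to \<open>0\<close>.
\<close>

lemma laplacian_identity:
  fixes t1 t2 t3 t4 :: real
  shows "y1 * y2 * y3 * y4 * (t1 * t2 * (v1 - v2)\<^sup>2 + t1 * t3 * (v1 - v3)\<^sup>2 + t1 * t4 * v1\<^sup>2
      + t2 * t3 * (v2 - v3)\<^sup>2 + t2 * t4 * v2\<^sup>2 + t3 * t4 * v3\<^sup>2)
    = (y1 * y2 * y3 * y4 * (t1 + t2 + t3 + t4)) * (t1 * v1\<^sup>2 + t2 * v2\<^sup>2 + t3 * v3\<^sup>2)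
      - y1 * y2 * y3 * y4 * (t1 * v1 + t2 * v2 + t3 * v3)\<^sup>2"
proof -
  have "t1 * t2 * (v1 - v2)\<^sup>2 + t1 * t3 * (v1 - v3)\<^sup>2 + t1 * t4 * v1\<^sup>2
      + t2 * t3 * (v2 - v3)\<^sup>2 + t2 * t4 * v2\<^sup>2 + t3 * t4 * v3\<^sup>2
    = (t1 + t2 + t3 + t4) * (t1 * v1\<^sup>2 + t2 * v2\<^sup>2 + t3 * v3\<^sup>2) - (t1 * v1 + t2 * v2 + t3 * v3)\<^sup>2"
    by (simp add: power2_eq_square algebra_simps)
  then show ?thesis by (simp add: right_diff_distrib mult.assoc)
qed

text \<open>
  Only \<open>y4 < 0\<close> is of interest. The part with \<open>D\<close> is a variance with positive weights \<open>m\<^sub>i\<close>. The rest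
  is \<open>y1 y2 y3 y4\<close> times the variance form with weights \<open>t\<^sub>i = m\<^sub>i / y\<^sub>i\<close>. Shifting the values so that
  the one at the fourth vertex vanishes removes the only negative weight from \<open>\<Sum>t v\<^sup>2\<close>; the hypothesis
  \<open>c\<close> gives the coefficient of that sum the right sign, and the square \<open>(\<Sum>t v)\<^sup>2\<close> is subtracted with
  the nonpositive factor \<open>y1 y2 y3 y4\<close>.
\<close>

lemma weighted_form_nonneg:
  fixes m1 m2 m3 m4 y1 y2 y3 y4 D v1 v2 v3 v4 :: real
  assumes m: "m1 > 0" "m2 > 0" "m3 > 0" "m4 > 0" and D: "D > 0" and y: "y1 > 0" "y2 > 0" "y3 > 0"
    and c: "m1 * (y2 * y3 * y4) + m2 * (y1 * y3 * y4) + m3 * (y1 * y2 * y4) + m4 * (y1 * y2 * y3) \<ge> 0"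
  shows "m1 * m2 * (D + y3 * y4) * (v1 - v2)\<^sup>2 + m1 * m3 * (D + y2 * y4) * (v1 - v3)\<^sup>2
    + m1 * m4 * (D + y2 * y3) * (v1 - v4)\<^sup>2 + m2 * m3 * (D + y1 * y4) * (v2 - v3)\<^sup>2
    + m2 * m4 * (D + y1 * y3) * (v2 - v4)\<^sup>2 + m3 * m4 * (D + y1 * y2) * (v3 - v4)\<^sup>2 \<ge> 0"
proof (cases "y4 \<ge> 0")
  case True
  then show ?thesis using D m y by (intro add_nonneg_nonneg mult_nonneg_nonneg) auto
next
  case False
  define t1 t2 t3 t4 where "t1 = m1 / y1" and "t2 = m2 / y2" and "t3 = m3 / y3" and "t4 = m4 / y4"
  define w1 w2 w3 where "w1 = v1 - v4" and "w2 = v2 - v4" and "w3 = v3 - v4"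
  have mt: "m1 = t1 * y1" "m2 = t2 * y2" "m3 = t3 * y3" "m4 = t4 * y4"
    using y False by (simp_all add: t1_def t2_def t3_def t4_def)
  have t: "t1 > 0" "t2 > 0" "t3 > 0" using m y by (simp_all add: t1_def t2_def t3_def)
  have v: "v1 - v2 = w1 - w2" "v1 - v3 = w1 - w3" "v2 - v3 = w2 - w3"
    "v1 - v4 = w1" "v2 - v4 = w2" "v3 - v4 = w3"
    by (simp_all add: w1_def w2_def w3_def)
  have "y1 * y2 * y3 * y4 * (t1 + t2 + t3 + t4)
      = m1 * (y2 * y3 * y4) + m2 * (y1 * y3 * y4) + m3 * (y1 * y2 * y4) + m4 * (y1 * y2 * y3)"
    unfolding mt by (simp add: algebra_simps)
  with c have c': "y1 * y2 * y3 * y4 * (t1 + t2 + t3 + t4) \<ge> 0" by simp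
  have "y1 * y2 * y3 * y4 \<le> 0" using y False by (simp add: mult_nonneg_nonpos)
  then have n: "y1 * y2 * y3 * y4 * (t1 * w1 + t2 * w2 + t3 * w3)\<^sup>2 \<le> 0"
    by (simp add: mult_nonpos_nonneg)
  have p: "t1 * w1\<^sup>2 + t2 * w2\<^sup>2 + t3 * w3\<^sup>2 \<ge> 0"
    using t by (intro add_nonneg_nonneg mult_nonneg_nonneg) auto
  have variance: "m1 * m2 * (w1 - w2)\<^sup>2 + m1 * m3 * (w1 - w3)\<^sup>2 + m1 * m4 * w1\<^sup>2
      + m2 * m3 * (w2 - w3)\<^sup>2 + m2 * m4 * w2\<^sup>2 + m3 * m4 * w3\<^sup>2 \<ge> 0"
    using m by (intro add_nonneg_nonneg mult_nonneg_nonneg) auto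
  have split: "m1 * m2 * (D + y3 * y4) * a + m1 * m3 * (D + y2 * y4) * b + m1 * m4 * (D + y2 * y3) * c
      + m2 * m3 * (D + y1 * y4) * d + m2 * m4 * (D + y1 * y3) * e + m3 * m4 * (D + y1 * y2) * g
    = D * (m1 * m2 * a + m1 * m3 * b + m1 * m4 * c + m2 * m3 * d + m2 * m4 * e + m3 * m4 * g)
      + y1 * y2 * y3 * y4 * (t1 * t2 * a + t1 * t3 * b + t1 * t4 * c + t2 * t3 * d + t2 * t4 * e + t3 * t4 * g)"
    for a b c d e g :: real
    unfolding mt by (simp add: algebra_simps)
  show ?thesis
    unfolding v split laplacian_identity
    using mult_nonneg_nonneg[OF less_imp_le[OF D] variance] mult_nonneg_nonneg[OF c' p] n by linarith
qed

text \<open>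
  Any two of the \<open>y\<^sub>i\<close> have a positive sum, so at least three of them are positive, and up to the order
  of the vertices the previous lemma applies.
\<close>

lemma packing_form_nonneg:
  fixes x1 x2 x3 x4 v1 v2 v3 v4 :: real
  defines "y1 \<equiv> x2 + x3 + x4 - x1" and "y2 \<equiv> x1 + x3 + x4 - x2"
    and "y3 \<equiv> x1 + x2 + x4 - x3" and "y4 \<equiv> x1 + x2 + x3 - x4"
    and "m1 \<equiv> x1 * inv_inradius_sq x2 x3 x4" and "m2 \<equiv> x2 * inv_inradius_sq x1 x3 x4"
    and "m3 \<equiv> x3 * inv_inradius_sq x1 x2 x4" and "m4 \<equiv> x4 * inv_inradius_sq x1 x2 x3"
    and "D \<equiv> descartes x1 x2 x3 x4"
  assumes x: "x1 > 0" "x2 > 0" "x3 > 0" "x4 > 0" and D: "D > 0"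
  shows "m1 * m2 * (D + y3 * y4) * (v1 - v2)\<^sup>2 + m1 * m3 * (D + y2 * y4) * (v1 - v3)\<^sup>2
    + m1 * m4 * (D + y2 * y3) * (v1 - v4)\<^sup>2 + m2 * m3 * (D + y1 * y4) * (v2 - v3)\<^sup>2
    + m2 * m4 * (D + y1 * y3) * (v2 - v4)\<^sup>2 + m3 * m4 * (D + y1 * y2) * (v3 - v4)\<^sup>2 \<ge> 0"
    (is "?F \<ge> 0")
proof -
  have m: "m1 > 0" "m2 > 0" "m3 > 0" "m4 > 0"
    using x by (simp_all add: m1_def m2_def m3_def m4_def inv_inradius_sq_pos)
  have "m1 * (y2 * y3 * y4) + m2 * (y1 * y3 * y4) + m3 * (y1 * y2 * y4) + m4 * (y1 * y2 * y3)
      = D * (x1 * x1 * (x2 * x4 + x3 * x4 + x2 * x3) + x2 * x2 * (x1 * x4 + x3 * x4 + x1 * x3)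
          + x3 * x3 * (x1 * x4 + x2 * x4 + x1 * x2) + x4 * x4 * (x1 * x2 + x1 * x3 + x2 * x3))"
    unfolding y1_def y2_def y3_def y4_def m1_def m2_def m3_def m4_def D_def by (rule mixed_sum_identity)
  also have "\<dots> \<ge> 0"
    using x D by (intro mult_nonneg_nonneg add_nonneg_nonneg) auto
  finally have c: "m1 * (y2 * y3 * y4) + m2 * (y1 * y3 * y4) + m3 * (y1 * y2 * y4) + m4 * (y1 * y2 * y3) \<ge> 0" .
  consider "y1 > 0" "y2 > 0" "y3 > 0" | "y4 > 0" "y2 > 0" "y3 > 0"
    | "y1 > 0" "y4 > 0" "y3 > 0" | "y1 > 0" "y2 > 0" "y4 > 0"
    using x unfolding y1_def y2_def y3_def y4_def by linarith
  then show ?thesis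
  proof cases
    case 1
    from weighted_form_nonneg[OF m D this c] show ?thesis .
  next
    case 2
    show ?thesis
      using weighted_form_nonneg[OF m(4,2,3,1) D 2, of y1 v4 v2 v3 v1] c
      by (simp add: power2_commute[of v4] power2_commute[of _ v1] mult_ac add_ac)
  next
    case 3
    show ?thesis
      using weighted_form_nonneg[OF m(1,4,3,2) D 3, of y2 v1 v4 v3 v2] c
      by (simp add: power2_commute[of v4] power2_commute[of v3 v2] mult_ac add_ac)
  next
    case 4
    show ?thesis
      using weighted_form_nonneg[OF m(1,2,4,3) D 4, of y3 v1 v2 v4 v3] c
      by (simp add: power2_commute[of v4] mult_ac add_ac)
  qed
qed

section \<open>Angles and dual areas of sphere packings\<close>

lemma cos_law_packing:
  fixes x y z :: real
  assumes "x > 0" "y > 0" "z > 0"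
  shows "cos_law (1 / x + 1 / y) (1 / x + 1 / z) (1 / y + 1 / z)
    = (inv_inradius_sq x y z - x\<^sup>2) / ((x + y) * (x + z))"
proof -
  have s: "1 / x + 1 / y = (x + y) / (x * y)" "1 / x + 1 / z = (x + z) / (x * z)"
    "1 / y + 1 / z = (y + z) / (y * z)"
    using assms by (simp_all add: add_frac_eq add.commute)
  have "((x + y) / (x * y))\<^sup>2 + ((x + z) / (x * z))\<^sup>2 - ((y + z) / (y * z))\<^sup>2
      = (((x + y) * z)\<^sup>2 + ((x + z) * y)\<^sup>2 - ((y + z) * x)\<^sup>2) / (x * y * z)\<^sup>2"
  proof -
    have "((x + y) / (x * y))\<^sup>2 = ((x + y) * z)\<^sup>2 / (x * y * z)\<^sup>2"
      "((x + z) / (x * z))\<^sup>2 = ((x + z) * y)\<^sup>2 / (x * y * z)\<^sup>2"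
      "((y + z) / (y * z))\<^sup>2 = ((y + z) * x)\<^sup>2 / (x * y * z)\<^sup>2"
      using assms by (simp_all add: power_divide power_mult_distrib)
    then show ?thesis by (simp only: diff_divide_distrib add_divide_distrib)
  qed
  also have "((x + y) * z)\<^sup>2 + ((x + z) * y)\<^sup>2 - ((y + z) * x)\<^sup>2 = 2 * (y * z * (inv_inradius_sq x y z - x\<^sup>2))"
    by (simp add: inv_inradius_sq_def power2_eq_square algebra_simps)
  finally have N: "((x + y) / (x * y))\<^sup>2 + ((x + z) / (x * z))\<^sup>2 - ((y + z) / (y * z))\<^sup>2
      = 2 * (y * z * (inv_inradius_sq x y z - x\<^sup>2)) / (x * y * z)\<^sup>2" .
  have M: "2 * ((x + y) / (x * y)) * ((x + z) / (x * z)) = 2 * (y * z * ((x + y) * (x + z))) / (x * y * z)\<^sup>2"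
  proof -
    have "2 * (a / (x * y)) * (b / (x * z)) = 2 * (y * z * (a * b)) / (x * y * z)\<^sup>2" for a b
      using assms by (simp add: power2_eq_square mult_ac)
    then show ?thesis .
  qed
  have "2 * (y * z * A) / w / (2 * (y * z * B) / w) = A / B" if "w \<noteq> 0" for A B w :: real
    using assms that by simp
  from this[of "(x * y * z)\<^sup>2" "inv_inradius_sq x y z - x\<^sup>2" "(x + y) * (x + z)"]
  show ?thesis unfolding s cos_law_def N M using assms by simp
qed

text \<open>
  In other words \<open>tan (\<gamma> / 2) = x \<rho>\<close>, with \<open>\<rho>\<close> the inradius.
\<close>

lemma sin_packing:
  fixes x y z \<gamma> :: real
  assumes x: "x > 0" "y > 0" "z > 0"
    and cos: "cos \<gamma> = (inv_inradius_sq x y z - x\<^sup>2) / ((x + y) * (x + z))" and sin: "sin \<gamma> > 0"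
  shows "sin \<gamma> = 2 * x * sqrt (inv_inradius_sq x y z) / ((x + y) * (x + z))"
proof -
  let ?\<sigma> = "inv_inradius_sq x y z"
  have \<sigma>: "?\<sigma> > 0" using x by (simp add: inv_inradius_sq_pos)
  have P: "(x + y) * (x + z) = ?\<sigma> + x\<^sup>2"
    by (simp add: inv_inradius_sq_def power2_eq_square algebra_simps)
  have P0: "?\<sigma> + x\<^sup>2 > 0" using \<sigma> by (simp add: add_pos_nonneg)
  have quot: "1 - (a / b)\<^sup>2 = (b\<^sup>2 - a\<^sup>2) / b\<^sup>2" if "b > 0" for a b :: real
    using that by (simp add: power_divide diff_divide_distrib)
  have "(sin \<gamma>)\<^sup>2 = 1 - ((?\<sigma> - x\<^sup>2) / (?\<sigma> + x\<^sup>2))\<^sup>2"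
    using cos unfolding P by (simp add: sin_squared_eq)
  also have "\<dots> = ((?\<sigma> + x\<^sup>2)\<^sup>2 - (?\<sigma> - x\<^sup>2)\<^sup>2) / (?\<sigma> + x\<^sup>2)\<^sup>2"
    using P0 by (rule quot)
  also have "(?\<sigma> + x\<^sup>2)\<^sup>2 - (?\<sigma> - x\<^sup>2)\<^sup>2 = (2 * x)\<^sup>2 * ?\<sigma>"
    by (simp add: power2_eq_square algebra_simps)
  also have "(2 * x)\<^sup>2 * ?\<sigma> / (?\<sigma> + x\<^sup>2)\<^sup>2 = (2 * x * sqrt ?\<sigma> / (?\<sigma> + x\<^sup>2))\<^sup>2"
    using \<sigma> by (simp add: power_divide power_mult_distrib)
  finally show ?thesis
    using sin P0 \<sigma> x unfolding P by (simp add: power2_eq_iff_nonneg)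
qed

lemma packing_edge_length:
  "edge_length (sphere_packing f) i j = 1 / exp (- f $ i) + 1 / exp (- f $ j)"
  by (simp add: edge_length_def sphere_packing_def exp_minus inverse_eq_divide)

text \<open>
  The height over an edge is the inradius, since each \<open>d i j\<close> is the distance from the vertex \<open>i\<close> to
  the points where the inscribed circle touches the two sides at \<open>i\<close>.
\<close>

lemma packing_face_angle:
  fixes f :: "real ^ 'v::finite"
  defines "x \<equiv> \<lambda>v. exp (- f $ v)"
  assumes p: "realizes (edge_length (sphere_packing f)) {i, j, k} p" and ne: "i \<noteq> j" "i \<noteq> k" "j \<noteq> k"
  shows "cos (face_angle (edge_length (sphere_packing f)) i j k)
      = (inv_inradius_sq (x i) (x j) (x k) - (x i)\<^sup>2) / ((x i + x j) * (x i + x k))" (is "cos ?\<gamma> = _")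
    and "sin (face_angle (edge_length (sphere_packing f)) i j k)
      = 2 * x i * sqrt (inv_inradius_sq (x i) (x j) (x k)) / ((x i + x j) * (x i + x k))"
    and "height_edge (sphere_packing f) i j k = 1 / sqrt (inv_inradius_sq (x i) (x j) (x k))"
proof -
  let ?\<sigma> = "inv_inradius_sq (x i) (x j) (x k)"
  have x: "x v > 0" for v by (simp add: x_def)
  have \<sigma>: "?\<sigma> > 0" using x by (simp add: inv_inradius_sq_pos)
  have P: "(x i + x j) * (x i + x k) = ?\<sigma> + (x i)\<^sup>2"
    by (simp add: inv_inradius_sq_def power2_eq_square algebra_simps)
  have P0: "?\<sigma> + (x i)\<^sup>2 > 0" using \<sigma> by (simp add: add_pos_nonneg)
  show cos: "cos ?\<gamma> = (?\<sigma> - (x i)\<^sup>2) / ((x i + x j) * (x i + x k))"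
    using cos_face_angle(1)[OF p ne] cos_law_packing[OF x x x, of i j k]
    by (simp only: packing_edge_length x_def)
  show sin: "sin ?\<gamma> = 2 * x i * sqrt ?\<sigma> / ((x i + x j) * (x i + x k))"
    by (rule sin_packing[OF x x x cos sin_face_angle_pos[OF p ne]])
  have d: "sphere_packing f i v = 1 / x i" for v
    by (simp add: sphere_packing_def x_def exp_minus inverse_eq_divide)
  have "1 - cos ?\<gamma> = 2 * (x i)\<^sup>2 / (?\<sigma> + (x i)\<^sup>2)"
    unfolding cos P using P0 by (simp add: field_simps)
  then have "1 / x i - 1 / x i * cos ?\<gamma> = 2 * x i / (?\<sigma> + (x i)\<^sup>2)"
    using x[of i] by (simp add: right_diff_distrib[of "1 / x i" 1, symmetric, simplified] power2_eq_square field_simps)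
  then have "height_edge (sphere_packing f) i j k
      = 2 * x i / (?\<sigma> + (x i)\<^sup>2) / (2 * x i * sqrt ?\<sigma> / (?\<sigma> + (x i)\<^sup>2))"
    by (simp only: height_edge_def Let_def d sin P)
  also have "\<dots> = 1 / sqrt ?\<sigma>" using P0 x[of i] by simp
  finally show "height_edge (sphere_packing f) i j k = 1 / sqrt ?\<sigma>" .
qed

lemma spherical_cos_law_packing:
  fixes X xj xk xl sk sl :: real
  assumes x: "X > 0" "xj > 0" "xk > 0" "xl > 0" and s: "sk > 0" "sl > 0"
  shows "((inv_inradius_sq X xk xl - X\<^sup>2) / ((X + xk) * (X + xl))
      - (inv_inradius_sq X xj xk - X\<^sup>2) / ((X + xj) * (X + xk)) * ((inv_inradius_sq X xj xl - X\<^sup>2) / ((X + xj) * (X + xl))))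
      / (2 * X * sl / ((X + xj) * (X + xk)) * (2 * X * sk / ((X + xj) * (X + xl))))
    = (descartes X xj xk xl - (X + xj + xl - xk) * (X + xj + xk - xl)) / (4 * sk * sl)"
proof -
  have N: "(inv_inradius_sq X xk xl - X\<^sup>2) * (X + xj)\<^sup>2 - (inv_inradius_sq X xj xk - X\<^sup>2) * (inv_inradius_sq X xj xl - X\<^sup>2)
      = X\<^sup>2 * (descartes X xj xk xl - (X + xj + xl - xk) * (X + xj + xk - xl))"
    unfolding inv_inradius_sq_def descartes_def by algebra
  have "(A / (b * c) - B / (a * b) * (C / (a * c))) / (2 * X * sl / (a * b) * (2 * X * sk / (a * c)))
      = (A * a\<^sup>2 - B * C) / (X\<^sup>2 * (4 * sk * sl))" if "a > 0" "b > 0" "c > 0" for A B C a b c :: real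
  proof -
    have "A / (b * c) - B / (a * b) * (C / (a * c)) = (A * a\<^sup>2 - B * C) / (a\<^sup>2 * b * c)"
      using that by (simp add: diff_divide_distrib power2_eq_square)
    moreover have "2 * X * sl / (a * b) * (2 * X * sk / (a * c)) = X\<^sup>2 * (4 * sk * sl) / (a\<^sup>2 * b * c)"
      by (simp add: power2_eq_square mult_ac)
    ultimately show ?thesis using that by simp
  qed
  note this[of "X + xj" "X + xk" "X + xl" "inv_inradius_sq X xk xl - X\<^sup>2" "inv_inradius_sq X xj xk - X\<^sup>2" "inv_inradius_sq X xj xl - X\<^sup>2",
      unfolded N]
  then show ?thesis using x by (simp only: add_pos_pos) simp
qed

text \<open>
  This computes \<open>sin\<^sup>2 \<beta>\<close> from the cosine of a dihedral angle \<open>\<beta>\<close>; it rests on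
  \<open>4 \<sigma>\<^sub>k = D + y\<^sub>k\<^sup>2\<close>, where \<open>\<sigma>\<^sub>k\<close> is the value of \<open>inv_inradius_sq\<close> on the face opposite \<open>k\<close>.
\<close>

lemma descartes_sine_identity:
  fixes X xj xk xl :: real
  shows "16 * inv_inradius_sq X xj xl * inv_inradius_sq X xj xk - (descartes X xj xk xl - (X + xj + xl - xk) * (X + xj + xk - xl))\<^sup>2
    = 4 * descartes X xj xk xl * (X + xj)\<^sup>2"
proof -
  define D yk yl where "D = descartes X xj xk xl" and "yk = X + xj + xl - xk" and "yl = X + xj + xk - xl"
  have \<sigma>D: "4 * inv_inradius_sq X xj xl = D + yk\<^sup>2" "4 * inv_inradius_sq X xj xk = D + yl\<^sup>2"
    unfolding D_def yk_def yl_def inv_inradius_sq_def descartes_def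
    by (simp_all add: power2_eq_square algebra_simps)
  have y: "yk + yl = 2 * (X + xj)" by (simp add: yk_def yl_def)
  have "(4 * inv_inradius_sq X xj xl) * (4 * inv_inradius_sq X xj xk) - (D - yk * yl)\<^sup>2 = D * (yk + yl)\<^sup>2"
    unfolding \<sigma>D by (simp add: power2_eq_square algebra_simps)
  then show ?thesis
    unfolding y power_mult_distrib unfolding D_def yk_def yl_def by simp
qed

text \<open>
  Positivity of the Descartes form comes from that of \<open>sin\<^sup>2 \<beta>\<close>, of which it is a positive multiple.
\<close>

lemma packing_dihedral_angle:
  fixes f :: "real ^ 'v::finite"
  defines "x \<equiv> \<lambda>v. exp (- f $ v)"
  assumes p: "realizes (edge_length (sphere_packing f)) {i, j, k, l} p" and ne: "distinct [i, j, k, l]"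
  defines "D \<equiv> descartes (x i) (x j) (x k) (x l)"
    and "yk \<equiv> x i + x j + x l - x k" and "yl \<equiv> x i + x j + x k - x l"
    and "\<sigma>k \<equiv> inv_inradius_sq (x i) (x j) (x l)" and "\<sigma>l \<equiv> inv_inradius_sq (x i) (x j) (x k)"
  shows "D > 0"
    and "cos (dihedral_angle (edge_length (sphere_packing f)) i j k l) = (D - yk * yl) / (4 * sqrt \<sigma>k * sqrt \<sigma>l)"
    and "sin (dihedral_angle (edge_length (sphere_packing f)) i j k l) = sqrt D * (x i + x j) / (2 * sqrt \<sigma>k * sqrt \<sigma>l)"
proof -
  let ?L = "edge_length (sphere_packing f)"
  let ?\<beta> = "dihedral_angle ?L i j k l"
  have x: "x v > 0" for v by (simp add: x_def)
  have \<sigma>: "\<sigma>k > 0" "\<sigma>l > 0" using x by (simp_all add: \<sigma>k_def \<sigma>l_def inv_inradius_sq_pos)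
  have sub: "realizes ?L {i, k, l} p" "realizes ?L {i, j, l} p" "realizes ?L {i, j, k} p"
    by (rule realizes_subset[OF p], blast)+
  have n: "i \<noteq> j" "i \<noteq> k" "i \<noteq> l" "j \<noteq> k" "j \<noteq> l" "k \<noteq> l" using ne by auto
  note faces = packing_face_angle(1,2)[OF sub(1) n(2,3,6)] packing_face_angle(1,2)[OF sub(2) n(1,3,5)]
    packing_face_angle(1,2)[OF sub(3) n(1,2,4)]
  show cos: "cos ?\<beta> = (D - yk * yl) / (4 * sqrt \<sigma>k * sqrt \<sigma>l)"
    unfolding cos_dihedral_angle(1)[OF p ne] faces x_def[symmetric] D_def yk_def yl_def
    using spherical_cos_law_packing[of "x i" "x j" "x k" "x l" "sqrt \<sigma>k" "sqrt \<sigma>l"] x \<sigma>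
    by (simp add: \<sigma>k_def \<sigma>l_def x_def)
  have N: "16 * \<sigma>k * \<sigma>l - (D - yk * yl)\<^sup>2 = 4 * D * (x i + x j)\<^sup>2"
    unfolding \<sigma>k_def \<sigma>l_def D_def yk_def yl_def by (rule descartes_sine_identity)
  have "(sin ?\<beta>)\<^sup>2 = 1 - (D - yk * yl)\<^sup>2 / (16 * \<sigma>k * \<sigma>l)"
    using \<sigma> by (simp add: sin_squared_eq cos power_divide power_mult_distrib)
  also have "\<dots> = (16 * \<sigma>k * \<sigma>l - (D - yk * yl)\<^sup>2) / (16 * \<sigma>k * \<sigma>l)"
    using \<sigma> by (simp add: diff_divide_distrib)
  finally have S: "(sin ?\<beta>)\<^sup>2 = D * (x i + x j)\<^sup>2 / (4 * \<sigma>k * \<sigma>l)"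
    unfolding N by simp
  have s: "sin ?\<beta> > 0" using cos_dihedral_angle(2,3)[OF p ne] by (rule sin_gt_zero)
  have xij: "(x i + x j)\<^sup>2 > 0" "x i + x j > 0" using x[of i] x[of j] by auto
  have "D * (x i + x j)\<^sup>2 / (4 * \<sigma>k * \<sigma>l) > 0" using s S by (metis zero_less_power)
  then have "D * (x i + x j)\<^sup>2 > 0" using \<sigma> by (simp add: zero_less_divide_iff mult_less_0_iff)
  then show D: "D > 0" using xij by (simp add: zero_less_mult_iff)
  have "(sin ?\<beta>)\<^sup>2 = (sqrt D * (x i + x j) / (2 * sqrt \<sigma>k * sqrt \<sigma>l))\<^sup>2"
    unfolding S using D \<sigma> by (simp add: power_divide power_mult_distrib)
  then show "sin ?\<beta> = sqrt D * (x i + x j) / (2 * sqrt \<sigma>k * sqrt \<sigma>l)"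
    using s D \<sigma> xij by (simp add: power2_eq_iff_nonneg)
qed

text \<open>
  The sign of a dual area is that of \<open>D + yk * yl\<close>. It is negative on the edges of a face if the fourth
  sphere is almost small enough to pass between the three spheres of that face.
\<close>

lemma packing_dual_area:
  fixes f :: "real ^ 'v::finite"
  defines "x \<equiv> \<lambda>v. exp (- f $ v)"
  assumes p: "realizes (edge_length (sphere_packing f)) {i, j, k, l} p" and ne: "distinct [i, j, k, l]"
  defines "D \<equiv> descartes (x i) (x j) (x k) (x l)"
    and "yk \<equiv> x i + x j + x l - x k" and "yl \<equiv> x i + x j + x k - x l"
    and "\<sigma>k \<equiv> inv_inradius_sq (x i) (x j) (x l)" and "\<sigma>l \<equiv> inv_inradius_sq (x i) (x j) (x k)"
  shows "dual_area (sphere_packing f) i j k l / edge_length (sphere_packing f) i j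
    = x i * x j * (D + yk * yl) / (4 * sqrt D * \<sigma>k * \<sigma>l)"
proof -
  let ?L = "edge_length (sphere_packing f)"
  let ?\<beta> = "dihedral_angle ?L i j k l"
  let ?d = "sphere_packing f"
  have x: "x v > 0" for v by (simp add: x_def)
  have \<sigma>: "\<sigma>k > 0" "\<sigma>l > 0" using x by (simp_all add: \<sigma>k_def \<sigma>l_def inv_inradius_sq_pos)
  have sub: "realizes ?L {i, j, l} p" "realizes ?L {i, j, k} p"
    by (rule realizes_subset[OF p], blast)+
  have n: "i \<noteq> j" "i \<noteq> k" "i \<noteq> l" "j \<noteq> k" "j \<noteq> l" "k \<noteq> l" using ne by auto
  have h: "height_edge ?d i j k = 1 / sqrt \<sigma>l" "height_edge ?d i j l = 1 / sqrt \<sigma>k"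
    using packing_face_angle(3)[OF sub(2) n(1,2,4)] packing_face_angle(3)[OF sub(1) n(1,3,5)]
    by (simp_all add: \<sigma>k_def \<sigma>l_def x_def)
  have dih: "D > 0" "cos ?\<beta> = (D - yk * yl) / (4 * sqrt \<sigma>k * sqrt \<sigma>l)"
    "sin ?\<beta> = sqrt D * (x i + x j) / (2 * sqrt \<sigma>k * sqrt \<sigma>l)"
    unfolding D_def yk_def yl_def \<sigma>k_def \<sigma>l_def x_def by (fact packing_dihedral_angle[OF p ne])+
  have \<sigma>D: "4 * \<sigma>k = D + yk\<^sup>2" "4 * \<sigma>l = D + yl\<^sup>2"
    unfolding \<sigma>k_def \<sigma>l_def D_def yk_def yl_def inv_inradius_sq_def descartes_def
    by (simp_all add: power2_eq_square algebra_simps)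
  have y: "yk + yl = 2 * (x i + x j)" by (simp add: yk_def yl_def)
  have w: "x i + x j > 0" using x[of i] x[of j] by simp
  have "2 * ((4 * \<sigma>k) * (4 * \<sigma>l)) - (D - yk * yl) * (4 * \<sigma>k + 4 * \<sigma>l) = (yk + yl)\<^sup>2 * (D + yk * yl)"
    unfolding \<sigma>D by (simp add: power2_eq_square algebra_simps)
  then have N: "8 * \<sigma>k * \<sigma>l - (D - yk * yl) * (\<sigma>k + \<sigma>l) = (x i + x j)\<^sup>2 * (D + yk * yl)"
  proof -
    have "8 * a * b - M * (a + b) = w * R" if "2 * ((4 * a) * (4 * b)) - M * (4 * a + 4 * b) = 4 * w * R"
      for a b M w R :: real
      using that by (simp add: algebra_simps)
    then show ?thesis using \<open>_ = (yk + yl)\<^sup>2 * (D + yk * yl)\<close> unfolding y power_mult_distrib by simp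
  qed
  have "dual_area ?d i j k l = (1 / (sqrt \<sigma>k * sqrt \<sigma>l) - 1 / 2 * cos ?\<beta> * (1 / \<sigma>k + 1 / \<sigma>l)) / sin ?\<beta>"
  proof -
    have sq: "1 / \<sigma>k = 1 / sqrt \<sigma>k * (1 / sqrt \<sigma>k)" "1 / \<sigma>l = 1 / sqrt \<sigma>l * (1 / sqrt \<sigma>l)"
      using \<sigma> by simp_all
    have "1 / 2 * (a * ((b - a * c) / s) + b * ((a - b * c) / s)) = (b * a - 1 / 2 * c * (b * b + a * a)) / s"
      for a b c s :: real
      by (simp add: diff_divide_distrib add_divide_distrib algebra_simps)
    moreover have "1 / (sqrt \<sigma>k * sqrt \<sigma>l) = 1 / sqrt \<sigma>k * (1 / sqrt \<sigma>l)" by simp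
    ultimately show ?thesis
      by (simp only: dual_area_def height_face_def Let_def h dihedral_angle_commute[of _ i j l k] sq)
  qed
  also have "\<dots> = (8 * \<sigma>k * \<sigma>l - (D - yk * yl) * (\<sigma>k + \<sigma>l)) / (8 * (sqrt \<sigma>k * sqrt \<sigma>l) * \<sigma>k * \<sigma>l) / sin ?\<beta>"
  proof -
    have "1 / (sqrt \<sigma>k * sqrt \<sigma>l) - 1 / 2 * cos ?\<beta> * (1 / \<sigma>k + 1 / \<sigma>l)
      = (8 * \<sigma>k * \<sigma>l - (D - yk * yl) * (\<sigma>k + \<sigma>l)) / (8 * (sqrt \<sigma>k * sqrt \<sigma>l) * \<sigma>k * \<sigma>l)"
    proof -
      have "1 / s - 1 / 2 * (M / (4 * s)) * (1 / a + 1 / b) = (8 * a * b - M * (a + b)) / (8 * s * a * b)"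
        if "a > 0" "b > 0" "s > 0" for a b s M :: real
        using that by (simp add: divide_simps)
      from this[of \<sigma>k \<sigma>l "sqrt \<sigma>k * sqrt \<sigma>l" "D - yk * yl"] show ?thesis
        unfolding dih(2) using \<sigma> by (simp add: mult.assoc)
    qed
    then show ?thesis by simp
  qed
  also have "\<dots> = (x i + x j)\<^sup>2 * (D + yk * yl) / (8 * (sqrt \<sigma>k * sqrt \<sigma>l) * \<sigma>k * \<sigma>l)
      / (sqrt D * (x i + x j) / (2 * (sqrt \<sigma>k * sqrt \<sigma>l)))"
    unfolding N dih(3) by (simp add: mult.assoc)
  also have "\<dots> = (x i + x j) * (D + yk * yl) / (4 * sqrt D * \<sigma>k * \<sigma>l)"
  proof -
    have "w\<^sup>2 * M / (8 * s * a * b) / (E * w / (2 * s)) = w * M / (4 * E * a * b)"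
      if "w > 0" "s > 0" "E > 0" "a > 0" "b > 0" for w M s a b E :: real
      using that by (simp add: power2_eq_square mult_ac)
    from this[of "x i + x j" "sqrt \<sigma>k * sqrt \<sigma>l" "sqrt D" \<sigma>k \<sigma>l "D + yk * yl"] show ?thesis
      using w \<sigma> dih(1) by simp
  qed
  finally have A: "dual_area ?d i j k l = (x i + x j) * (D + yk * yl) / (4 * sqrt D * \<sigma>k * \<sigma>l)" .
  have "?L i j = 1 / x i + 1 / x j" by (simp only: packing_edge_length x_def)
  also have "\<dots> = (x i + x j) / (x i * x j)"
    using x[of i] x[of j] by (simp add: add_frac_eq add.commute)
  finally have "?L i j = (x i + x j) / (x i * x j)" .
  moreover have "s * M / c / (s / q) = q * M / c" if "s > 0" for s M c q :: real
    using that by (simp add: mult_ac)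
  ultimately show ?thesis unfolding A using w by (simp, simp add: mult_ac)
qed

section \<open>The domain of the sphere packing structure\<close>

lemma realizes_of_independent:
  assumes fin: "finite \<sigma>" and i: "i \<in> \<sigma>"
    and ind: "\<And>u m. (\<Sum>m\<in>\<sigma> - {i}. u m *\<^sub>R (p m - p i)) = 0 \<Longrightarrow> m \<in> \<sigma> - {i} \<Longrightarrow> u m = (0::real)"
    and L: "\<And>a b. a \<in> \<sigma> \<Longrightarrow> b \<in> \<sigma> \<Longrightarrow> a \<noteq> b \<Longrightarrow> dist (p a) (p b) = L a b"
    and pos: "\<And>a b. a \<in> \<sigma> \<Longrightarrow> b \<in> \<sigma> \<Longrightarrow> a \<noteq> b \<Longrightarrow> L a b > 0"
  shows "realizes L \<sigma> p"
proof -
  have inj: "inj_on p \<sigma>"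
    using L pos by (intro inj_onI) (metis dist_self less_irrefl)
  have "\<not> affine_dependent (p ` \<sigma>)"
  proof
    assume "affine_dependent (p ` \<sigma>)"
    then obtain U where U: "sum U (p ` \<sigma>) = 0" "\<exists>v\<in>p ` \<sigma>. U v \<noteq> 0" "(\<Sum>v\<in>p ` \<sigma>. U v *\<^sub>R v) = 0"
      using affine_dependent_explicit_finite[OF finite_imageI[OF fin]] by blast
    define u where "u m = U (p m)" for m
    have s: "sum u \<sigma> = 0" and w: "(\<Sum>m\<in>\<sigma>. u m *\<^sub>R p m) = 0"
      using U inj by (simp_all add: sum.reindex u_def)
    have "(\<Sum>m\<in>\<sigma> - {i}. u m *\<^sub>R (p m - p i)) = (\<Sum>m\<in>\<sigma>. u m *\<^sub>R (p m - p i))"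
      using fin i by (simp add: sum.remove[of \<sigma> i])
    also have "\<dots> = (\<Sum>m\<in>\<sigma>. u m *\<^sub>R p m) - sum u \<sigma> *\<^sub>R p i"
      by (simp add: scaleR_diff_right sum_subtractf scaleR_sum_left)
    finally have z: "u m = 0" if "m \<in> \<sigma> - {i}" for m
      using ind[of u m] that s w by simp
    moreover have "u i = 0"
      using s z fin i by (simp add: sum.remove[of \<sigma> i])
    moreover obtain v where "v \<in> \<sigma>" "u v \<noteq> 0" using U(2) by (auto simp: u_def)
    ultimately show False by (cases "v = i") blast+
  qed
  then show ?thesis using inj L by (simp add: realizes_def)
qed

lemma dist_vector_3:
  "(dist (vector [a, b, c]) (vector [a', b', c'] :: real ^ 3))\<^sup>2 = (a - a')\<^sup>2 + (b - b')\<^sup>2 + (c - c')\<^sup>2"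
  by (simp add: dist_vec_def L2_set_def sum_3 dist_real_def)

text \<open>
  The vertex \<open>i\<close> is placed at the origin, \<open>j\<close> on the first axis and \<open>k\<close> in the plane of the first
  two axes, in polar coordinates.
\<close>

lemma realizes_triangle_exists:
  assumes ne: "distinct [i, j, k]" and sym: "\<And>a b. L b a = L a b" and pos: "\<And>a b. L a b > 0"
    and cos: "cos \<gamma> = cos_law (L i j) (L i k) (L j k)" and sin: "sin \<gamma> > 0"
  shows "\<exists>p. realizes L {i, j, k} p"
proof -
  define p :: "_ \<Rightarrow> real ^ 3" where
    "p v = (if v = j then vector [L i j, 0, 0]
       else if v = k then vector [L i k * cos \<gamma>, L i k * sin \<gamma>, 0] else vector [0, 0, 0])" for v
  have p: "p i = vector [0, 0, 0]" "p j = vector [L i j, 0, 0]"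
    "p k = vector [L i k * cos \<gamma>, L i k * sin \<gamma>, 0]"
    using ne by (auto simp: p_def)
  have jk: "(L j k)\<^sup>2 = (L i j)\<^sup>2 + (L i k)\<^sup>2 - 2 * L i j * L i k * cos \<gamma>"
    using pos[of i j] pos[of i k] by (simp add: cos cos_law_def)
  note expand = power2_diff power_mult_distrib sin_squared_eq algebra_simps
  have "(dist (p i) (p j))\<^sup>2 = (L i j)\<^sup>2" unfolding p dist_vector_3 by simp
  moreover have "(dist (p i) (p k))\<^sup>2 = (L i k)\<^sup>2"
    unfolding p dist_vector_3 by (simp add: expand)
  moreover have "(dist (p j) (p k))\<^sup>2 = (L j k)\<^sup>2"
    unfolding p dist_vector_3 jk by (simp add: expand)
  ultimately have d: "dist (p i) (p j) = L i j" "dist (p i) (p k) = L i k" "dist (p j) (p k) = L j k"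
    using pos by (simp_all add: power2_eq_iff_nonneg less_imp_le)
  have "realizes L {i, j, k} p"
  proof (rule realizes_of_independent[of _ i])
    fix u :: "_ \<Rightarrow> real" and m
    assume "(\<Sum>m\<in>{i, j, k} - {i}. u m *\<^sub>R (p m - p i)) = 0"
    moreover have "{i, j, k} - {i} = {j, k}" "j \<noteq> k" using ne by auto
    ultimately have "u j *\<^sub>R (p j - p i) + u k *\<^sub>R (p k - p i) = 0" by simp
    then have "u k * (L i k * sin \<gamma>) = 0" "u j * L i j + u k * (L i k * cos \<gamma>) = 0"
      unfolding p vec_eq_iff forall_3 by simp_all
    moreover assume "m \<in> {i, j, k} - {i}"
    ultimately show "u m = 0" using pos[of i j] pos[of i k] sin by auto
  qed (use d ne in \<open>auto simp: sym dist_commute pos\<close>)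
  then show ?thesis by (rule exI[of _ p])
qed

text \<open>
  The triangle \<open>{i, j, k}\<close> is placed as before, and \<open>l\<close> is given by spherical coordinates about the
  axis from \<open>i\<close> to \<open>j\<close>, with the prospective dihedral angle \<open>\<beta>\<close> as longitude.
\<close>

lemma realizes_tetrahedron_exists:
  assumes ne: "distinct [i, j, k, l]" and sym: "\<And>a b. L b a = L a b" and pos: "\<And>a b. L a b > 0"
    and cos\<gamma>: "cos \<gamma> = cos_law (L i j) (L i k) (L j k)" and sin\<gamma>: "sin \<gamma> > 0"
    and cos\<delta>: "cos \<delta> = cos_law (L i j) (L i l) (L j l)" and sin\<delta>: "sin \<delta> > 0"
    and cos\<beta>: "cos \<beta> = (cos_law (L i k) (L i l) (L k l) - cos \<gamma> * cos \<delta>) / (sin \<gamma> * sin \<delta>)"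
    and sin\<beta>: "sin \<beta> > 0"
  shows "\<exists>p. realizes L {i, j, k, l} p"
proof -
  define p :: "_ \<Rightarrow> real ^ 3" where
    "p v = (if v = j then vector [L i j, 0, 0]
       else if v = k then vector [L i k * cos \<gamma>, L i k * sin \<gamma>, 0]
       else if v = l then vector [L i l * cos \<delta>, L i l * sin \<delta> * cos \<beta>, L i l * sin \<delta> * sin \<beta>]
       else vector [0, 0, 0])" for v
  have p: "p i = vector [0, 0, 0]" "p j = vector [L i j, 0, 0]"
    "p k = vector [L i k * cos \<gamma>, L i k * sin \<gamma>, 0]"
    "p l = vector [L i l * cos \<delta>, L i l * sin \<delta> * cos \<beta>, L i l * sin \<delta> * sin \<beta>]"
    using ne by (auto simp: p_def)
  have jk: "(L j k)\<^sup>2 = (L i j)\<^sup>2 + (L i k)\<^sup>2 - 2 * L i j * L i k * cos \<gamma>"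
    using pos[of i j] pos[of i k] by (simp add: cos\<gamma> cos_law_def)
  have jl: "(L j l)\<^sup>2 = (L i j)\<^sup>2 + (L i l)\<^sup>2 - 2 * L i j * L i l * cos \<delta>"
    using pos[of i j] pos[of i l] by (simp add: cos\<delta> cos_law_def)
  have "cos_law (L i k) (L i l) (L k l) = cos \<gamma> * cos \<delta> + sin \<gamma> * sin \<delta> * cos \<beta>"
    using sin\<gamma> sin\<delta> by (simp add: cos\<beta>)
  then have kl: "(L k l)\<^sup>2 = (L i k)\<^sup>2 + (L i l)\<^sup>2 - 2 * L i k * L i l * (cos \<gamma> * cos \<delta> + sin \<gamma> * sin \<delta> * cos \<beta>)"
    using pos[of i k] pos[of i l] by (simp add: cos_law_def divide_simps) (simp add: algebra_simps)
  note expand = power2_diff power_mult_distrib sin_squared_eq algebra_simps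
  have "(dist (p i) (p j))\<^sup>2 = (L i j)\<^sup>2" unfolding p dist_vector_3 by simp
  moreover have "(dist (p i) (p k))\<^sup>2 = (L i k)\<^sup>2"
    unfolding p dist_vector_3 by (simp add: expand)
  moreover have "(dist (p i) (p l))\<^sup>2 = (L i l)\<^sup>2"
    unfolding p dist_vector_3 by (simp add: expand)
  moreover have "(dist (p j) (p k))\<^sup>2 = (L j k)\<^sup>2"
    unfolding p dist_vector_3 jk by (simp add: expand)
  moreover have "(dist (p j) (p l))\<^sup>2 = (L j l)\<^sup>2"
    unfolding p dist_vector_3 jl by (simp add: expand)
  moreover have "(dist (p k) (p l))\<^sup>2 = (L k l)\<^sup>2"
    unfolding p dist_vector_3 kl by (simp add: expand)
  ultimately have d: "dist (p i) (p j) = L i j" "dist (p i) (p k) = L i k" "dist (p i) (p l) = L i l"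
    "dist (p j) (p k) = L j k" "dist (p j) (p l) = L j l" "dist (p k) (p l) = L k l"
    using pos by (simp_all add: power2_eq_iff_nonneg less_imp_le)
  have "realizes L {i, j, k, l} p"
  proof (rule realizes_of_independent[of _ i])
    fix u :: "_ \<Rightarrow> real" and m
    assume "(\<Sum>m\<in>{i, j, k, l} - {i}. u m *\<^sub>R (p m - p i)) = 0"
    moreover have "{i, j, k, l} - {i} = {j, k, l}" "j \<noteq> k" "j \<noteq> l" "k \<noteq> l" using ne by auto
    ultimately have "u j *\<^sub>R (p j - p i) + (u k *\<^sub>R (p k - p i) + u l *\<^sub>R (p l - p i)) = 0" by simp
    then have "u l * (L i l * sin \<delta> * sin \<beta>) = 0"
      "u k * (L i k * sin \<gamma>) + u l * (L i l * sin \<delta> * cos \<beta>) = 0"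
      "u j * L i j + (u k * (L i k * cos \<gamma>) + u l * (L i l * cos \<delta>)) = 0"
      unfolding p vec_eq_iff forall_3 by simp_all
    moreover have "L i l > 0" "L i k > 0" "L i j > 0" by (rule pos)+
    ultimately have "u l = 0" "u k = 0" "u j = 0" using sin\<gamma> sin\<delta> sin\<beta> by auto
    moreover assume "m \<in> {i, j, k, l} - {i}"
    ultimately show "u m = 0" by auto
  qed (use d ne in \<open>auto simp: sym dist_commute pos\<close>)
  then show ?thesis by (rule exI[of _ p])
qed

lemma angle_of_cos:
  fixes c :: real
  assumes "\<bar>c\<bar> < 1"
  obtains \<gamma> where "cos \<gamma> = c" "sin \<gamma> > 0"
proof
  have c: "-1 < c" "c < 1" using assms by auto
  then show "cos (arccos c) = c" by simp
  show "sin (arccos c) > 0" using arccos_lt_bounded[OF c] by (simp add: sin_gt_zero)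
qed

lemma packing_angle_exists:
  fixes x y z :: real
  assumes x: "x > 0" "y > 0" "z > 0"
  obtains \<gamma> where "cos \<gamma> = (inv_inradius_sq x y z - x\<^sup>2) / ((x + y) * (x + z))"
    "sin \<gamma> = 2 * x * sqrt (inv_inradius_sq x y z) / ((x + y) * (x + z))" "sin \<gamma> > 0"
proof -
  have P: "(x + y) * (x + z) = inv_inradius_sq x y z + x\<^sup>2"
    by (simp add: inv_inradius_sq_def power2_eq_square algebra_simps)
  have "inv_inradius_sq x y z > 0" "x\<^sup>2 > 0" using x by (simp_all add: inv_inradius_sq_pos)
  then have "\<bar>inv_inradius_sq x y z - x\<^sup>2\<bar> < inv_inradius_sq x y z + x\<^sup>2" "inv_inradius_sq x y z + x\<^sup>2 > 0" by linarith+
  then have "\<bar>(inv_inradius_sq x y z - x\<^sup>2) / ((x + y) * (x + z))\<bar> < 1"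
    unfolding P by (simp add: abs_divide)
  then obtain \<gamma> where \<gamma>: "cos \<gamma> = (inv_inradius_sq x y z - x\<^sup>2) / ((x + y) * (x + z))" "sin \<gamma> > 0"
    by (rule angle_of_cos)
  show ?thesis by (rule that[OF \<gamma>(1) sin_packing[OF x \<gamma>] \<gamma>(2)])
qed

lemma packing_length_pos: "edge_length (sphere_packing f) a b > 0"
  by (simp add: edge_length_def sphere_packing_def add_pos_pos)

lemma packing_length_commute: "edge_length (sphere_packing f) b a = edge_length (sphere_packing f) a b"
  by (simp add: edge_length_def)

definition packing_descartes :: "real ^ 'v \<Rightarrow> 'v \<Rightarrow> 'v \<Rightarrow> 'v \<Rightarrow> 'v \<Rightarrow> real" where
  "packing_descartes f i j k l = descartes (exp (- f $ i)) (exp (- f $ j)) (exp (- f $ k)) (exp (- f $ l))"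

lemma packing_triangle_exists:
  fixes f :: "real ^ 'v::finite"
  assumes ne: "distinct [i, j, k]"
  shows "\<exists>p. realizes (edge_length (sphere_packing f)) {i, j, k} p"
proof -
  define x where "x v = exp (- f $ v)" for v
  have x: "x v > 0" for v by (simp add: x_def)
  obtain \<gamma> where \<gamma>: "cos \<gamma> = (inv_inradius_sq (x i) (x j) (x k) - (x i)\<^sup>2) / ((x i + x j) * (x i + x k))" "sin \<gamma> > 0"
    by (rule packing_angle_exists[OF x x x])
  have "cos \<gamma> = cos_law (edge_length (sphere_packing f) i j) (edge_length (sphere_packing f) i k)
      (edge_length (sphere_packing f) j k)"
    unfolding packing_edge_length x_def[symmetric] cos_law_packing[OF x x x] by (rule \<gamma>(1))
  from realizes_triangle_exists[OF ne packing_length_commute packing_length_pos this \<gamma>(2)]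
  show ?thesis .
qed

lemma packing_tetrahedron_exists:
  fixes f :: "real ^ 'v::finite"
  assumes ne: "distinct [i, j, k, l]" and D: "packing_descartes f i j k l > 0"
  shows "\<exists>p. realizes (edge_length (sphere_packing f)) {i, j, k, l} p"
proof -
  define x where "x v = exp (- f $ v)" for v
  have x: "x v > 0" for v by (simp add: x_def)
  define D' yk yl where "D' = descartes (x i) (x j) (x k) (x l)"
    and "yk = x i + x j + x l - x k" and "yl = x i + x j + x k - x l"
  let ?\<sigma>k = "inv_inradius_sq (x i) (x j) (x l)" and ?\<sigma>l = "inv_inradius_sq (x i) (x j) (x k)"
  have \<sigma>: "?\<sigma>k > 0" "?\<sigma>l > 0" using x by (simp_all add: inv_inradius_sq_pos)
  obtain \<gamma> where \<gamma>: "cos \<gamma> = (?\<sigma>l - (x i)\<^sup>2) / ((x i + x j) * (x i + x k))"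
    "sin \<gamma> = 2 * x i * sqrt ?\<sigma>l / ((x i + x j) * (x i + x k))" "sin \<gamma> > 0"
    by (rule packing_angle_exists[OF x x x])
  obtain \<delta> where \<delta>: "cos \<delta> = (?\<sigma>k - (x i)\<^sup>2) / ((x i + x j) * (x i + x l))"
    "sin \<delta> = 2 * x i * sqrt ?\<sigma>k / ((x i + x j) * (x i + x l))" "sin \<delta> > 0"
    by (rule packing_angle_exists[OF x x x])
  have D': "D' > 0" using D by (simp add: D'_def packing_descartes_def x_def)
  have "4 * D' * (x i + x j)\<^sup>2 > 0" using D' x[of i] x[of j] by (simp add: add_pos_pos)
  then have "(D' - yk * yl)\<^sup>2 < 16 * ?\<sigma>k * ?\<sigma>l"
    using descartes_sine_identity[of "x i" "x j" "x l" "x k"]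
    unfolding D'_def yk_def yl_def by linarith
  also have "\<dots> = (4 * sqrt ?\<sigma>k * sqrt ?\<sigma>l)\<^sup>2" using \<sigma> by (simp add: power_mult_distrib)
  finally have "\<bar>D' - yk * yl\<bar>\<^sup>2 < (4 * sqrt ?\<sigma>k * sqrt ?\<sigma>l)\<^sup>2" by (simp only: power2_abs)
  then have "\<bar>D' - yk * yl\<bar> < 4 * sqrt ?\<sigma>k * sqrt ?\<sigma>l"
    by (rule power2_less_imp_less) (use \<sigma> in simp)
  then have "\<bar>(D' - yk * yl) / (4 * sqrt ?\<sigma>k * sqrt ?\<sigma>l)\<bar> < 1"
    using \<sigma> by (simp add: abs_mult)
  then obtain \<beta> where \<beta>: "cos \<beta> = (D' - yk * yl) / (4 * sqrt ?\<sigma>k * sqrt ?\<sigma>l)" "sin \<beta> > 0"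
    by (rule angle_of_cos)
  have law: "cos_law (edge_length (sphere_packing f) i a) (edge_length (sphere_packing f) i b)
      (edge_length (sphere_packing f) a b) = (inv_inradius_sq (x i) (x a) (x b) - (x i)\<^sup>2) / ((x i + x a) * (x i + x b))" for a b
    unfolding packing_edge_length x_def[symmetric] by (rule cos_law_packing[OF x x x])
  show ?thesis
  proof (rule realizes_tetrahedron_exists[OF ne packing_length_commute packing_length_pos])
    show "cos \<gamma> = cos_law (edge_length (sphere_packing f) i j) (edge_length (sphere_packing f) i k)
        (edge_length (sphere_packing f) j k)" unfolding law by (rule \<gamma>(1))
    show "cos \<delta> = cos_law (edge_length (sphere_packing f) i j) (edge_length (sphere_packing f) i l)
        (edge_length (sphere_packing f) j l)" unfolding law by (rule \<delta>(1))
    show "cos \<beta> = (cos_law (edge_length (sphere_packing f) i k) (edge_length (sphere_packing f) i l)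
        (edge_length (sphere_packing f) k l) - cos \<gamma> * cos \<delta>) / (sin \<gamma> * sin \<delta>)"
      unfolding law \<beta>(1) \<gamma>(1,2) \<delta>(1,2) D'_def yk_def yl_def
      by (rule spherical_cos_law_packing[symmetric]) (use x \<sigma> in auto)
  qed (fact \<gamma>(3) \<delta>(3) \<beta>(2))+
qed

text \<open>
  Tangent spheres always form edges and triangles, so nondegeneracy is a condition on the tetrahedra only,
  apart from the bound on the dimension, which does not involve the radii.
\<close>

lemma sphere_packing_domain_iff:
  fixes f :: "real ^ 'v::finite"
  assumes T: "abstract_complex T"
  shows "f \<in> sphere_packing_domain T \<longleftrightarrow> (\<forall>\<sigma>\<in>T. card \<sigma> \<le> 4) \<and>
    (\<forall>i j k l. {i, j, k, l} \<in> tetrahedra T \<longrightarrow> packing_descartes f i j k l > 0)"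
proof
  assume "f \<in> sphere_packing_domain T"
  then have pf: "\<exists>p. realizes (edge_length (sphere_packing f)) \<sigma> p" if "\<sigma> \<in> T" for \<sigma>
    using that by (auto simp: sphere_packing_domain_def metrics_def piecewise_flat_def)
  have "card \<sigma> \<le> 4" if "\<sigma> \<in> T" for \<sigma>
  proof -
    obtain p where p: "realizes (edge_length (sphere_packing f)) \<sigma> p" using pf[OF \<open>\<sigma> \<in> T\<close>] ..
    then have "int (card (p ` \<sigma>)) = aff_dim (p ` \<sigma>) + 1"
      using aff_dim_affine_independent[of "p ` \<sigma>"] by (simp add: realizes_def)
    also have "\<dots> \<le> 4" using aff_dim_le_DIM[of "p ` \<sigma>"] by simp
    finally show ?thesis using p by (simp add: realizes_def card_image)
  qed
  moreover have "packing_descartes f i j k l > 0" if t: "{i, j, k, l} \<in> tetrahedra T" for i j k l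
  proof -
    have ne: "distinct [i, j, k, l]" and T: "{i, j, k, l} \<in> T"
      using t by (auto simp: tetrahedra_def card_insert_if split: if_splits)
    obtain p where "realizes (edge_length (sphere_packing f)) {i, j, k, l} p" using pf[OF T] ..
    from packing_dihedral_angle(1)[OF this ne] show ?thesis by (simp only: packing_descartes_def)
  qed
  ultimately show "(\<forall>\<sigma>\<in>T. card \<sigma> \<le> 4) \<and>
    (\<forall>i j k l. {i, j, k, l} \<in> tetrahedra T \<longrightarrow> packing_descartes f i j k l > 0)" by blast
next
  assume *: "(\<forall>\<sigma>\<in>T. card \<sigma> \<le> 4) \<and>
    (\<forall>i j k l. {i, j, k, l} \<in> tetrahedra T \<longrightarrow> packing_descartes f i j k l > 0)"
  let ?L = "edge_length (sphere_packing f)"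
  have "\<exists>p. realizes ?L \<sigma> p" if \<sigma>: "\<sigma> \<in> T" for \<sigma>
  proof -
    have "\<sigma> \<noteq> {}" using T \<sigma> by (auto simp: abstract_complex_def)
    then have "card \<sigma> \<noteq> 0" by simp
    moreover have "card \<sigma> \<le> 4" using * \<sigma> by blast
    ultimately consider "card \<sigma> = 1" | "card \<sigma> = 2" | "card \<sigma> = 3" | "card \<sigma> = 4" by linarith
    then show ?thesis
    proof cases
      case 1
      then obtain i where "\<sigma> = {i}" by (auto simp: card_1_singleton_iff)
      then have "realizes ?L \<sigma> (\<lambda>_. 0)" by (simp add: realizes_def)
      then show ?thesis by (rule exI[of _ "\<lambda>_. 0"])
    next
      case 2
      then obtain i j where ij: "\<sigma> = {i, j}" "i \<noteq> j" by (auto simp: card_2_iff)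
      define p :: "'v \<Rightarrow> real ^ 3" where "p v = (if v = i then 0 else ?L i j *\<^sub>R axis 1 1)" for v
      have "dist (p i) (p j) = ?L i j" "dist (p j) (p i) = ?L j i"
        using ij packing_length_pos[of f i j] packing_length_commute[of f i j]
        by (auto simp: p_def dist_norm)
      moreover have "p i \<noteq> p j"
        using packing_length_pos[of f i j] \<open>dist (p i) (p j) = ?L i j\<close> by auto
      ultimately have "realizes ?L \<sigma> p" using ij by (auto simp: realizes_def)
      then show ?thesis by (rule exI[of _ p])
    next
      case 3
      then obtain i j k where "\<sigma> = {i, j, k}" "distinct [i, j, k]" by (auto simp: card_3_iff)
      then show ?thesis using packing_triangle_exists[of i j k f] by simp
    next
      case 4
      then have "card \<sigma> = Suc 3" by simp
      then obtain i \<tau> where i: "\<sigma> = insert i \<tau>" "i \<notin> \<tau>" "card \<tau> = 3"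
        unfolding card_Suc_eq by blast
      then obtain j k l where "\<tau> = {j, k, l}" "distinct [j, k, l]" by (auto simp: card_3_iff)
      with i have s: "\<sigma> = {i, j, k, l}" "distinct [i, j, k, l]" by auto
      then have "{i, j, k, l} \<in> tetrahedra T" using \<sigma> 4 by (simp add: tetrahedra_def)
      then have "packing_descartes f i j k l > 0" using * by blast
      then show ?thesis unfolding s(1) by (rule packing_tetrahedron_exists[OF s(2)])
    qed
  qed
  then show "f \<in> sphere_packing_domain T"
    by (simp add: sphere_packing_domain_def metrics_def piecewise_flat_def sphere_packing_def)
qed

lemma open_sphere_packing_domain:
  fixes T :: "'v::finite set set"
  assumes T: "abstract_complex T"
  shows "open (sphere_packing_domain T)"
proof (cases "\<forall>\<sigma>\<in>T. card \<sigma> \<le> 4")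
  case True
  have o: "open {f. packing_descartes f i j k l > 0}" for i j k l :: 'v
    unfolding packing_descartes_def descartes_def
    by (intro open_Collect_less continuous_intros)
  have o': "open {f. {i, j, k, l} \<in> tetrahedra T \<longrightarrow> packing_descartes f i j k l > 0}" for i j k l
    by (cases "{i, j, k, l} \<in> tetrahedra T") (simp_all add: o)
  have "sphere_packing_domain T = (\<Inter>i. \<Inter>j. \<Inter>k. \<Inter>l.
      {f. {i, j, k, l} \<in> tetrahedra T \<longrightarrow> packing_descartes f i j k l > 0})"
    using True by (auto simp: sphere_packing_domain_iff[OF T])
  also have "open \<dots>"
    by (intro open_INT ballI o') simp_all
  finally show ?thesis .
next
  case False
  then have "sphere_packing_domain T = {}"
    by (auto simp: sphere_packing_domain_iff[OF T])
  then show ?thesis by simp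
qed

lemma has_derivative_exp_component:
  fixes f :: "real ^ 'v::finite"
  shows "((\<lambda>f. c * exp (f $ i)) has_derivative (\<lambda>h. c * h $ i * exp (f $ i))) (at f)"
proof -
  have "((\<lambda>f. f $ i) has_derivative (\<lambda>h. h $ i)) (at f)"
    by (rule bounded_linear_imp_has_derivative[OF bounded_linear_vec_nth])
  then show ?thesis by (auto intro!: derivative_eq_intros simp: mult_ac)
qed

text \<open>
  The constant factor makes the class of functions closed under directional derivatives.
\<close>

lemma C_k_on_exp_component:
  "C_k_on n S (\<lambda>f :: real ^ 'v::finite. c * exp (f $ i))"
proof (induction n arbitrary: c)
  case 0
  show ?case by (auto intro!: continuous_intros)
next
  case (Suc n)
  have "frechet_derivative (\<lambda>f. c * exp (f $ i)) (at f) = (\<lambda>h. c * h $ i * exp (f $ i))" for f :: "real ^ 'v"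
    using frechet_derivative_at[OF has_derivative_exp_component[of c i f]] ..
  moreover have "(\<lambda>f. c * exp (f $ i)) differentiable (at f)" for f :: "real ^ 'v"
    using has_derivative_exp_component by (rule differentiableI)
  ultimately show ?case using Suc.IH by simp
qed

lemma partial_deriv_sphere_packing:
  fixes f :: "real ^ 'v::finite"
  shows "partial_deriv (\<lambda>f. sphere_packing f i j) k f = (if k = i then exp (f $ i) else 0)"
    and "i \<noteq> j \<Longrightarrow> partial_deriv (\<lambda>f. edge_length (sphere_packing f) i j) i f = exp (f $ i)"
proof -
  have D: "((\<lambda>f. exp (f $ i)) has_derivative (\<lambda>h. h $ i * exp (f $ i))) (at f)" for i
    using has_derivative_exp_component[of 1 i f] by simp
  show "partial_deriv (\<lambda>f. sphere_packing f i j) k f = (if k = i then exp (f $ i) else 0)"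
    unfolding sphere_packing_def partial_deriv_eq[OF D] by (simp add: axis_def)
  show "partial_deriv (\<lambda>f. edge_length (sphere_packing f) i j) i f = exp (f $ i)" if "i \<noteq> j"
    unfolding edge_length_def sphere_packing_def partial_deriv_eq[OF has_derivative_add[OF D D]]
    using that by (simp add: axis_def)
qed

lemma conformal_structure_sphere_packing:
  fixes T :: "'v::finite set set"
  assumes T: "abstract_complex T"
  shows "conformal_structure T (sphere_packing_domain T) sphere_packing"
proof -
  have "smooth_on U (\<lambda>f. sphere_packing f i j)" for U :: "(real ^ 'v) set" and i j :: 'v
    using C_k_on_exp_component[of _ U 1 i] by (simp add: smooth_on_def sphere_packing_def)
  moreover have "i \<noteq> j" if "(i, j) \<in> directed_edges T" for i j
    using that by (auto simp: directed_edges_def edges_def)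
  ultimately show ?thesis
    unfolding conformal_structure_def
    using open_sphere_packing_domain[OF T]
    by (auto simp: partial_deriv_sphere_packing)
       (auto simp: sphere_packing_domain_def sphere_packing_def)
qed

section \<open>The Hessian on sphere packings\<close>

text \<open>
  In a sum over ordered quadruples every tetrahedron contributes all relabellings of \<open>g\<close>, so it is enough
  that the sum over its six edges is nonnegative.
\<close>

lemma sum_ordered_tetrahedra_pairs:
  fixes g :: "'v::finite \<Rightarrow> 'v \<Rightarrow> 'v \<Rightarrow> 'v \<Rightarrow> real"
  assumes nonneg: "\<And>i j k l. {i, j, k, l} \<in> tetrahedra T \<Longrightarrow>
    g i j k l + g i k j l + g i l j k + g j k i l + g j l i k + g k l i j \<ge> 0"
  shows "(\<Sum>(i, j, k, l) | {i, j, k, l} \<in> tetrahedra T. g i j k l) \<ge> 0" (is "?S \<ge> 0")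
proof -
  let ?Q = "{(i, j, k, l). {i, j, k, l} \<in> tetrahedra T}"
  have p: "?S = (\<Sum>(i, j, k, l)\<in>?Q. g i k j l)" "?S = (\<Sum>(i, j, k, l)\<in>?Q. g i l j k)"
    "?S = (\<Sum>(i, j, k, l)\<in>?Q. g j k i l)" "?S = (\<Sum>(i, j, k, l)\<in>?Q. g j l i k)"
    "?S = (\<Sum>(i, j, k, l)\<in>?Q. g k l i j)"
    subgoal by (rule sum.reindex_bij_witness[of _ "\<lambda>(i, j, k, l). (i, k, j, l)" "\<lambda>(i, j, k, l). (i, k, j, l)"])
        (auto simp: insert_commute)
    subgoal by (rule sum.reindex_bij_witness[of _ "\<lambda>(i, j, k, l). (i, l, j, k)" "\<lambda>(i, j, k, l). (i, k, l, j)"])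
        (auto simp: insert_commute)
    subgoal by (rule sum.reindex_bij_witness[of _ "\<lambda>(i, j, k, l). (j, k, i, l)" "\<lambda>(i, j, k, l). (k, i, j, l)"])
        (auto simp: insert_commute)
    subgoal by (rule sum.reindex_bij_witness[of _ "\<lambda>(i, j, k, l). (j, l, i, k)" "\<lambda>(i, j, k, l). (k, i, l, j)"])
        (auto simp: insert_commute)
    subgoal by (rule sum.reindex_bij_witness[of _ "\<lambda>(i, j, k, l). (k, l, i, j)" "\<lambda>(i, j, k, l). (k, l, i, j)"])
        (auto simp: insert_commute)
    done
  have "6 * ?S = (\<Sum>(i, j, k, l)\<in>?Q. g i j k l) + (\<Sum>(i, j, k, l)\<in>?Q. g i k j l)
      + (\<Sum>(i, j, k, l)\<in>?Q. g i l j k) + (\<Sum>(i, j, k, l)\<in>?Q. g j k i l)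
      + (\<Sum>(i, j, k, l)\<in>?Q. g j l i k) + (\<Sum>(i, j, k, l)\<in>?Q. g k l i j)"
    using p by linarith
  also have "\<dots> = (\<Sum>(i, j, k, l)\<in>?Q. g i j k l + g i k j l + g i l j k + g j k i l + g j l i k + g k l i j)"
    by (simp add: sum.distrib case_prod_unfold)
  also have "\<dots> \<ge> 0" using nonneg by (intro sum_nonneg) auto
  finally show ?thesis by simp
qed

text \<open>
  The dual area formula brought to a denominator common to the six edges of the tetrahedron. The quantities
  of the tetrahedron are parameters, so that relabelled instances share them.
\<close>

lemma packing_weight:
  fixes f :: "real ^ 'v::finite"
  assumes p: "realizes (edge_length (sphere_packing f)) \<sigma> p" and \<sigma>: "\<sigma> = {i, j, k, l}"
    and ne: "distinct [i, j, k, l]"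
    and D: "D = descartes (x i) (x j) (x k) (x l)"
    and y: "yk = x i + x j + x l - x k" "yl = x i + x j + x k - x l"
    and s: "si = inv_inradius_sq (x j) (x k) (x l)" "sj = inv_inradius_sq (x i) (x k) (x l)"
      "sk = inv_inradius_sq (x i) (x j) (x l)" "sl = inv_inradius_sq (x i) (x j) (x k)"
    and x: "\<And>v. x v = exp (- f $ v)"
  shows "dual_area (sphere_packing f) i j k l / edge_length (sphere_packing f) i j
    = (x i * si) * (x j * sj) * (D + yk * yl) / (4 * sqrt D * (si * sj * sk * sl))"
proof -
  have pos: "si > 0" "sj > 0" unfolding s x by (simp_all add: inv_inradius_sq_pos)
  have "dual_area (sphere_packing f) i j k l / edge_length (sphere_packing f) i j
    = x i * x j * (D + yk * yl) / (4 * sqrt D * sk * sl)"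
    unfolding D y s x by (rule packing_dual_area[OF p[unfolded \<sigma>] ne])
  also have "\<dots> = (si * sj) * (x i * x j * (D + yk * yl)) / ((si * sj) * (4 * sqrt D * sk * sl))"
    using pos by simp
  finally show ?thesis by (simp only: mult_ac)
qed

lemma packing_weights_nonneg:
  fixes f v :: "real ^ 'v::finite"
  assumes p: "realizes (edge_length (sphere_packing f)) {i, j, k, l} p" and ne: "distinct [i, j, k, l]"
  defines "g \<equiv> \<lambda>i j k l. dual_area (sphere_packing f) i j k l / edge_length (sphere_packing f) i j
    * (v $ i - v $ j)\<^sup>2"
  shows "g i j k l + g i k j l + g i l j k + g j k i l + g j l i k + g k l i j \<ge> 0"
proof -
  define x where "x v = exp (- f $ v)" for v
  define D where "D = descartes (x i) (x j) (x k) (x l)"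
  define yi yj yk yl where "yi = x j + x k + x l - x i" and "yj = x i + x k + x l - x j"
    and "yk = x i + x j + x l - x k" and "yl = x i + x j + x k - x l"
  define si sj sk sl where "si = inv_inradius_sq (x j) (x k) (x l)" and "sj = inv_inradius_sq (x i) (x k) (x l)"
    and "sk = inv_inradius_sq (x i) (x j) (x l)" and "sl = inv_inradius_sq (x i) (x j) (x k)"
  define Z where "Z = 4 * sqrt D * (si * sj * sk * sl)"
  define mi mj mk ml where "mi = x i * si" and "mj = x j * sj" and "mk = x k * sk" and "ml = x l * sl"
  note defs = D_def yi_def yj_def yk_def yl_def si_def sj_def sk_def sl_def descartes_def inv_inradius_sq_def
  have xpos: "x v > 0" for v by (simp add: x_def)
  have spos: "si > 0" "sj > 0" "sk > 0" "sl > 0"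
    using xpos by (simp_all add: si_def sj_def sk_def sl_def inv_inradius_sq_pos)
  have D: "D > 0"
    using packing_dihedral_angle(1)[OF p ne] by (simp only: D_def x_def)
  have Z: "Z > 0" using D spos by (simp add: Z_def)
  have "g i j k l = mi * mj * (D + yk * yl) * (v $ i - v $ j)\<^sup>2 / Z"
    unfolding g_def
    by (subst packing_weight[of f _ p i j k l D x yk yl si sj sk sl, OF p _ _ _ _ _ _ _ _ _ x_def])
       (use ne in \<open>auto simp: defs Z_def mi_def mj_def algebra_simps\<close>)
  moreover have "g i k j l = mi * mk * (D + yj * yl) * (v $ i - v $ k)\<^sup>2 / Z"
    unfolding g_def
    by (subst packing_weight[of f _ p i k j l D x yj yl si sk sj sl, OF p _ _ _ _ _ _ _ _ _ x_def])
       (use ne in \<open>auto simp: defs Z_def mi_def mk_def algebra_simps\<close>)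
  moreover have "g i l j k = mi * ml * (D + yj * yk) * (v $ i - v $ l)\<^sup>2 / Z"
    unfolding g_def
    by (subst packing_weight[of f _ p i l j k D x yj yk si sl sj sk, OF p _ _ _ _ _ _ _ _ _ x_def])
       (use ne in \<open>auto simp: defs Z_def mi_def ml_def algebra_simps\<close>)
  moreover have "g j k i l = mj * mk * (D + yi * yl) * (v $ j - v $ k)\<^sup>2 / Z"
    unfolding g_def
    by (subst packing_weight[of f _ p j k i l D x yi yl sj sk si sl, OF p _ _ _ _ _ _ _ _ _ x_def])
       (use ne in \<open>auto simp: defs Z_def mj_def mk_def algebra_simps\<close>)
  moreover have "g j l i k = mj * ml * (D + yi * yk) * (v $ j - v $ l)\<^sup>2 / Z"
    unfolding g_def
    by (subst packing_weight[of f _ p j l i k D x yi yk sj sl si sk, OF p _ _ _ _ _ _ _ _ _ x_def])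
       (use ne in \<open>auto simp: defs Z_def mj_def ml_def algebra_simps\<close>)
  moreover have "g k l i j = mk * ml * (D + yi * yj) * (v $ k - v $ l)\<^sup>2 / Z"
    unfolding g_def
    by (subst packing_weight[of f _ p k l i j D x yi yj sk sl si sj, OF p _ _ _ _ _ _ _ _ _ x_def])
       (use ne in \<open>auto simp: defs Z_def mk_def ml_def algebra_simps\<close>)
  moreover have "mi * mj * (D + yk * yl) * (v $ i - v $ j)\<^sup>2 + mi * mk * (D + yj * yl) * (v $ i - v $ k)\<^sup>2
    + mi * ml * (D + yj * yk) * (v $ i - v $ l)\<^sup>2 + mj * mk * (D + yi * yl) * (v $ j - v $ k)\<^sup>2
    + mj * ml * (D + yi * yk) * (v $ j - v $ l)\<^sup>2 + mk * ml * (D + yi * yj) * (v $ k - v $ l)\<^sup>2 \<ge> 0"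
    using packing_form_nonneg[OF xpos xpos xpos xpos D[unfolded D_def]]
    unfolding D_def yi_def yj_def yk_def yl_def mi_def mj_def mk_def ml_def si_def sj_def sk_def sl_def .
  ultimately show ?thesis
    using Z by (simp add: add_divide_distrib[symmetric])
qed

lemma sphere_packing_weights_nonneg:
  fixes T :: "'v::finite set set"
  assumes T: "abstract_complex T" and f: "f \<in> sphere_packing_domain T"
  shows "(\<Sum>(i, j)\<in>directed_edges T.
    conformal.weight T sphere_packing f i j * (v $ i - v $ j)\<^sup>2) \<ge> 0"
proof -
  interpret conformal T "sphere_packing_domain T" sphere_packing
    using T conformal_structure_sphere_packing[OF T] by unfold_locales
  let ?S = "\<lambda>i j. {(k, l). k \<noteq> l \<and> {i, j, k, l} \<in> tetrahedra T}"
  let ?g = "\<lambda>i j k l. dual_area (sphere_packing f) i j k l / edge_length (sphere_packing f) i j * (v $ i - v $ j)\<^sup>2"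
  have w: "weight f i j * (v $ i - v $ j)\<^sup>2 = (\<Sum>(k, l)\<in>?S i j. ?g i j k l)"
    if "{i, j} \<in> edges T" for i j
  proof -
    have "weight f i j = (\<Sum>(k, l)\<in>?S i j. dual_area (sphere_packing f) i j k l) / len f i j"
      using edge_distinct[OF that]
      by (simp add: weight_def partial_deriv_sphere_packing dual_length_def sum_tetrahedra_eq)
    then show ?thesis
      by (simp add: sum_distrib_right sum_divide_distrib case_prod_unfold)
  qed
  have "(\<Sum>(i, j)\<in>directed_edges T. weight f i j * (v $ i - v $ j)\<^sup>2)
      = (\<Sum>i\<in>UNIV. \<Sum>j | {i, j} \<in> edges T. weight f i j * (v $ i - v $ j)\<^sup>2)"
    by (rule sum_directed_edges[symmetric])
  also have "\<dots> = (\<Sum>i\<in>UNIV. \<Sum>j | {i, j} \<in> edges T. \<Sum>(k, l)\<in>?S i j. ?g i j k l)"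
    by (intro sum.cong refl) (simp add: w)
  also have "\<dots> = (\<Sum>i\<in>UNIV. \<Sum>(j, k, l) | {i, j, k, l} \<in> tetrahedra T. ?g i j k l)"
    by (intro sum.cong refl sum_edges_tetrahedra[OF T])
  also have "\<dots> = (\<Sum>(i, j, k, l) | {i, j, k, l} \<in> tetrahedra T. ?g i j k l)"
  proof -
    have "{(i, j, k, l). {i, j, k, l} \<in> tetrahedra T}
        = Sigma UNIV (\<lambda>i. {(j, k, l). {i, j, k, l} \<in> tetrahedra T})" by auto
    then show ?thesis by (simp add: sum.Sigma)
  qed
  also have "\<dots> \<ge> 0"
  proof (rule sum_ordered_tetrahedra_pairs)
    fix i j k l assume t: "{i, j, k, l} \<in> tetrahedra T"
    obtain p where "realizes (edge_length (sphere_packing f)) {i, j, k, l} p"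
      using realizable[OF f tetrahedron_faces(2)[OF t]] ..
    from packing_weights_nonneg[OF this tetrahedron_faces(1)[OF t]]
    show "?g i j k l + ?g i k j l + ?g i l j k + ?g j k i l + ?g j l i k + ?g k l i j \<ge> 0" .
  qed
  finally show ?thesis .
qed

theorem theorem41:
  fixes M :: "'m topology" and T :: "'v::finite set set"
  assumes "triangulated_closed_3manifold M T"
  shows "(\<forall>f\<in>sphere_packing_domain T.
            (\<forall>i. scalar_curvature T (sphere_packing f) i \<ge> 0) \<longrightarrow>
            (\<exists>H. has_hessian (\<lambda>f. EHR T (edge_length (sphere_packing f))) H f \<and>
                 positive_semidefinite H))
       \<and> (\<forall>U C. conformal_structure T U C \<longrightarrow>
            (\<forall>f\<in>U.
              (\<forall>(i, j)\<in>directed_edges T.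
                 dual_length T (C f) i j
                   - 1/2 * partial_deriv (\<lambda>f. C f i j) j f * edge_curvature T (edge_length (C f)) i j
                   > 0) \<and>
              (\<forall>i. scalar_curvature T (C f) i \<ge> 0) \<longrightarrow>
              (\<exists>H. has_hessian (\<lambda>f. EHR T (edge_length (C f))) H f \<and>
                   positive_semidefinite H)))"
proof (intro conjI ballI allI impI)
  have T: "abstract_complex T"
    using assms by (simp add: triangulated_closed_3manifold_def)
  {
    fix f assume f: "f \<in> sphere_packing_domain T"
      and K: "\<forall>i. scalar_curvature T (sphere_packing f) i \<ge> 0"
    interpret conformal T "sphere_packing_domain T" sphere_packing
      using T conformal_structure_sphere_packing[OF T] by unfold_locales
    show "\<exists>H. has_hessian (\<lambda>f. EHR T (edge_length (sphere_packing f))) H f \<and> positive_semidefinite H"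
      using hessian_EHR_positive_semidefinite[OF f] K sphere_packing_weights_nonneg[OF T f] by blast
  }
  fix U C f
  assume "conformal_structure T U C" and f: "f \<in> U"
    and *: "(\<forall>(i, j)\<in>directed_edges T. dual_length T (C f) i j
        - 1/2 * partial_deriv (\<lambda>f. C f i j) j f * edge_curvature T (edge_length (C f)) i j > 0) \<and>
      (\<forall>i. scalar_curvature T (C f) i \<ge> 0)"
  then interpret conformal T U C using T by unfold_locales
  show "\<exists>H. has_hessian (\<lambda>f. EHR T (edge_length (C f))) H f \<and> positive_semidefinite H"
    by (rule hessian_EHR_positive_dual_lengths[OF f]) (use * in auto)
qed

end
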